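(* Let $E\neq\{0\}$ be a complex Banach lattice, let $u\in E$ be a quasi-interior point of $E_+$ and let $A$ be a densely defined and real linear operator on $E$ such that $s(A)$ is a spectral value of $A$ and a pole of $\mathcal{R}(\cdot,A)$. Suppose there exists $\lambda_1>s(A)$ such that $\mathcal{R}(\lambda,A)\gg_u 0$ for all $\lambda\in(s(A),\lambda_1)$ and assume that $M:=\sup_{\operatorname{Re}\lambda\ge\lambda_1}\|\mathcal{R}(\lambda,A)\|<\infty$. Then, for every operator $0\le K\in\mathcal{L}(E)$ with norm $\|K\|<\frac1M$, the real spectral bound $s_{\mathbb{R}}(A+K)$ fulfils the following properties: (i) $s_{\mathbb{R}}(A+K)\le s(A+K)<\lambda_1$. (ii) $\mathcal{R}(\lambda,A+K)\gg_u 0$ for all $\lambda\in(s_{\mathbb{R}}(A+K),\lambda_1)$. (iii) If $K$ is $A$-compact, then $s_{\mathbb{R}}(A+K)\ge s(A)$ and $s_{\mathbb{R}}(A+K)$ is a pole of $\mathcal{R}(\cdot,A+K)$. (iv) If $K$ is $A$-compact and non-zero, then $s_{\mathbb{R}}(A+K)>s(A)$.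
   Context: A complex Banach lattice $E$ is the complexification of a real Banach lattice $E_{\mathbb{R}}$; $E_+$ is its positive cone, $f\ge 0$ means $f\in E_+$, and $f>0$ means $f\ge 0$, $f\ne 0$. $\mathcal{L}(E)$ is the space of bounded linear operators on $E$; $T\in\mathcal{L}(E)$ is positive ($T\ge0$) if $TE_+\subseteq E_+$. A linear operator $A\colon E\supseteq D(A)\to E$ is real if $D(A)=E_{\mathbb{R}}\cap D(A)+i\,(E_{\mathbb{R}}\cap D(A))$ and $A$ maps $E_{\mathbb{R}}\cap D(A)$ into $E_{\mathbb{R}}$. $\mathcal{R}(\lambda,A)=(\lambda I-A)^{-1}$ for $\lambda\in\rho(A)$. The spectral bound is $s(A)=\sup\{\operatorname{Re}\lambda:\lambda\in\sigma(A)\}\in[-\infty,\infty]$, and the real spectral bound is $s_{\mathbb{R}}(A)=\sup(\sigma(A)\cap\mathbb{R})\in[-\infty,\infty]$ (with $\sup\emptyset=-\infty$). For $u\in E_+$ let $E_u=\{x\in E:\ |x|\le cu\text{ for some }c\ge 0\}$; $u\in E_+$ is a quasi-interior point of $E_+$ if $E_u$ is dense in $E$. For $f\in E$ write $f\gg_u0$ if there is $\varepsilon>0$ with $f\ge\varepsilon u$; for $T\in\mathcal{L}(E)$ write $T\gg_u 0$ if $Tf\gg_u0$ for all $0<f\in E$. For an operator $A$ with non-empty resolvent set, $K\in\mathcal{L}(E)$ is called $A$-compact if $K\mathcal{R}(\lambda,A)$ is compact for some (equivalently, every) $\lambda\in\rho(A)$. *)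

theory Defs
  imports "HOL-Analysis.Analysis" "HOL-Library.Lattice_Algebras"
begin

section \<open>Real Banach lattices\<close>

class banach_lattice = banach + ordered_real_vector + lattice_ab_group_add_abs +
  assumes norm_le_of_abs_le: "\<bar>x\<bar> \<le> \<bar>y\<bar> \<Longrightarrow> norm x \<le> norm y"

lemma norm_abs_bl: "norm \<bar>x\<bar> = norm (x::'a::banach_lattice)"
  by (intro antisym norm_le_of_abs_le) simp_all

lemma norm_le_of_abs_le': "\<bar>x\<bar> \<le> y \<Longrightarrow> norm x \<le> norm (y::'a::banach_lattice)"
  by (rule norm_le_of_abs_le) (metis abs_ge_self order_trans)

lemma LIMSEQ_nonneg_bl:
  fixes l :: "'a::banach_lattice"
  assumes X: "X \<longlonglongrightarrow> l" and nonneg: "\<And>n. 0 \<le> X n"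
  shows "0 \<le> l"
proof -
  have "(\<lambda>n. norm (X n - l)) \<longlonglongrightarrow> 0"
    using X by (simp add: LIM_zero tendsto_norm_zero)
  moreover have "norm (X n - \<bar>l\<bar>) \<le> norm (X n - l)" for n
    using norm_le_of_abs_le[OF abs_triangle_ineq3[of "X n" l]] nonneg[of n]
    by (simp add: abs_of_nonneg)
  ultimately have "(\<lambda>n. norm (X n - \<bar>l\<bar>)) \<longlonglongrightarrow> 0"
    by (intro Lim_null_comparison[of "\<lambda>n. norm (X n - \<bar>l\<bar>)" "\<lambda>n. norm (X n - l)"]) simp_all
  then have "X \<longlonglongrightarrow> \<bar>l\<bar>"
    using LIM_zero_cancel tendsto_norm_zero_iff by blast
  with X have "l = \<bar>l\<bar>" by (rule LIMSEQ_unique)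
  then show ?thesis by (metis abs_ge_zero)
qed

lemma LIMSEQ_le_bl:
  fixes l m :: "'a::banach_lattice"
  assumes "X \<longlonglongrightarrow> l" "Y \<longlonglongrightarrow> m" "\<And>n. X n \<le> Y n"
  shows "l \<le> m"
  using LIMSEQ_nonneg_bl[OF tendsto_diff[OF assms(2,1)]] assms(3) by simp

lemma abs_scaleR_bl: "\<bar>c *\<^sub>R x\<bar> \<le> \<bar>c\<bar> *\<^sub>R \<bar>x :: 'a::banach_lattice\<bar>"
proof (rule abs_leI)
  show "c *\<^sub>R x \<le> \<bar>c\<bar> *\<^sub>R \<bar>x\<bar>"
  proof (cases "0 \<le> c")
    case True
    then show ?thesis by (simp add: scaleR_left_mono abs_ge_self)
  next
    case False
    then show ?thesis
      using scaleR_left_mono[OF abs_ge_minus_self[of x], of "- c"] by simp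
  qed
  show "- (c *\<^sub>R x) \<le> \<bar>c\<bar> *\<^sub>R \<bar>x\<bar>"
  proof (cases "0 \<le> c")
    case True
    then show ?thesis
      using scaleR_left_mono[OF abs_ge_minus_self[of x], of "c"] by simp
  next
    case False
    then show ?thesis
      using scaleR_left_mono[OF abs_ge_self[of x], of "- c"] by simp
  qed
qed


section \<open>The complexification of a real Banach lattice\<close>

text \<open>\<open>Cpx x y\<close> stands for \<open>x + i y\<close>.\<close>

datatype 'a cpx = Cpx (re: 'a) (im: 'a)

definition modulus :: "'a::banach_lattice cpx \<Rightarrow> 'a" where
  "modulus z = (LEAST m. \<forall>t. cos t *\<^sub>R re z + sin t *\<^sub>R im z \<le> m)"

text \<open>The supremum in question exists by completeness of the norm.\<close>

lemma modulus_exists: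
  fixes x y :: "'a::banach_lattice"
  shows "\<exists>s. (\<forall>t. cos t *\<^sub>R x + sin t *\<^sub>R y \<le> s) \<and>
             (\<forall>b. (\<forall>t. cos t *\<^sub>R x + sin t *\<^sub>R y \<le> b) \<longrightarrow> s \<le> b)"
proof -
  define f where "f z = Re z *\<^sub>R x + Im z *\<^sub>R y" for z :: complex
  define u where "u = \<bar>x\<bar> + \<bar>y\<bar>"
  have u0: "0 \<le> u" by (simp add: u_def)
  have lip: "f z \<le> f w + e *\<^sub>R u" if "dist w z < e" for z w e
  proof -
    have e: "\<bar>Re (z - w)\<bar> \<le> e" "\<bar>Im (z - w)\<bar> \<le> e"
      using that abs_Re_le_cmod[of "z - w"] abs_Im_le_cmod[of "z - w"]
      by (auto simp: dist_norm norm_minus_commute)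
    have "f z - f w = Re (z - w) *\<^sub>R x + Im (z - w) *\<^sub>R y"
      by (simp add: f_def algebra_simps)
    also have "\<dots> \<le> \<bar>Re (z - w)\<bar> *\<^sub>R \<bar>x\<bar> + \<bar>Im (z - w)\<bar> *\<^sub>R \<bar>y\<bar>"
      by (intro add_mono order_trans[OF abs_ge_self abs_scaleR_bl])
    also have "\<dots> \<le> e *\<^sub>R \<bar>x\<bar> + e *\<^sub>R \<bar>y\<bar>"
      by (intro add_mono scaleR_right_mono e) simp_all
    finally show ?thesis by (simp add: u_def algebra_simps)
  qed
  have "\<exists>T. finite T \<and> T \<subseteq> sphere (0::complex) 1 \<and>
          sphere 0 1 \<subseteq> (\<Union>w\<in>T. ball w (inverse (real (Suc n))))" for n
  proof -
    let ?B = "\<lambda>w::complex. ball w (inverse (real (Suc n)))"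
    have "sphere (0::complex) 1 \<subseteq> (\<Union>w\<in>sphere 0 1. ?B w)"
    proof
      fix z :: complex assume "z \<in> sphere 0 1"
      moreover have "z \<in> ?B z" by (simp del: of_nat_Suc)
      ultimately show "z \<in> (\<Union>w\<in>sphere 0 1. ?B w)" by blast
    qed
    from compactE_image[OF compact_sphere _ this] obtain T
      where "T \<subseteq> sphere 0 1" "finite T" "sphere 0 1 \<subseteq> (\<Union>w\<in>T. ?B w)"
      using open_ball by blast
    then show ?thesis by blast
  qed
  then obtain T where finT: "\<And>n. finite (T n)"
    and subT: "\<And>n. T n \<subseteq> sphere (0::complex) 1"
    and covT: "\<And>n. sphere 0 1 \<subseteq> (\<Union>w\<in>T n. ball w (inverse (real (Suc n))))"
    by metis
  have neT: "T n \<noteq> {}" for n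
  proof
    assume "T n = {}"
    with covT[of n] have "sphere (0::complex) 1 = {}" by auto
    moreover have "(1::complex) \<in> sphere 0 1" by simp
    ultimately show False by blast
  qed
  define g where "g n = Sup_fin (f ` T n)" for n
  have fg: "f z \<le> g n + inverse (real (Suc n)) *\<^sub>R u" if z: "z \<in> sphere 0 1" for z n
  proof -
    from z covT[of n] obtain w where w: "w \<in> T n" "dist w z < inverse (real (Suc n))"
      by (meson UN_iff mem_ball subsetD)
    have "f z \<le> f w + inverse (real (Suc n)) *\<^sub>R u" using w(2) by (rule lip)
    also have "f w \<le> g n" unfolding g_def
      using finT w(1) by (intro Sup_fin.coboundedI) auto
    finally show ?thesis by simp
  qed
  have g_le: "g n \<le> b" if "\<And>z. z \<in> sphere 0 1 \<Longrightarrow> f z \<le> b" for n b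
  proof -
    have "y \<le> b" if "y \<in> f ` T n" for y
      using that \<open>\<And>z. z \<in> sphere 0 1 \<Longrightarrow> f z \<le> b\<close> subT[of n] by blast
    then show ?thesis
      unfolding g_def using finT neT by (intro Sup_fin.boundedI) blast+
  qed
  have gg: "norm (g m - g n) \<le> inverse (real (Suc (min m n))) * norm u" for m n
  proof -
    define c where "c = inverse (real (Suc (min m n)))"
    have c: "inverse (real (Suc m)) \<le> c" "inverse (real (Suc n)) \<le> c"
      by (auto simp: c_def intro!: le_imp_inverse_le)
    have "g m \<le> g n + inverse (real (Suc n)) *\<^sub>R u"
      using fg by (rule g_le)
    also have "\<dots> \<le> g n + c *\<^sub>R u"
      by (intro add_left_mono scaleR_right_mono c u0)
    finally have 1: "g m - g n \<le> c *\<^sub>R u" by (simp add: algebra_simps)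
    have "g n \<le> g m + inverse (real (Suc m)) *\<^sub>R u"
      using fg by (rule g_le)
    also have "\<dots> \<le> g m + c *\<^sub>R u"
      by (intro add_left_mono scaleR_right_mono c u0)
    finally have 2: "- (g m - g n) \<le> c *\<^sub>R u" by (simp add: algebra_simps)
    have "norm (g m - g n) \<le> norm (c *\<^sub>R u)"
      by (rule norm_le_of_abs_le'[OF abs_leI[OF 1 2]])
    then show ?thesis by (simp add: c_def)
  qed
  have inv0: "(\<lambda>n. inverse (real (Suc n))) \<longlonglongrightarrow> 0"
    by (rule LIMSEQ_inverse_real_of_nat)
  have "Cauchy g"
  proof (rule metric_CauchyI)
    fix e :: real assume "0 < e"
    have "(\<lambda>n. inverse (real (Suc n)) * norm u) \<longlonglongrightarrow> 0"
      using tendsto_mult_right[OF inv0, of "norm u"] by simp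
    then have "eventually (\<lambda>n. inverse (real (Suc n)) * norm u < e) sequentially"
      using \<open>0 < e\<close> by (rule order_tendstoD)
    then obtain N where N: "\<And>n. n \<ge> N \<Longrightarrow> inverse (real (Suc n)) * norm u < e"
      by (auto simp: eventually_sequentially)
    show "\<exists>M. \<forall>m\<ge>M. \<forall>n\<ge>M. dist (g m) (g n) < e"
    proof (intro exI allI impI)
      fix m n assume "m \<ge> N" "n \<ge> N"
      then have "inverse (real (Suc (min m n))) * norm u < e" by (intro N) simp
      with gg[of m n] show "dist (g m) (g n) < e" by (simp add: dist_norm)
    qed
  qed
  then obtain s where s: "g \<longlonglongrightarrow> s"
    by (meson Cauchy_convergent convergent_def)
  have up: "f z \<le> s" if "z \<in> sphere 0 1" for z
  proof (rule LIMSEQ_le_bl[OF tendsto_const _ fg[OF that]])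
    show "(\<lambda>n. g n + inverse (real (Suc n)) *\<^sub>R u) \<longlonglongrightarrow> s"
      using tendsto_add[OF s tendsto_scaleR[OF inv0 tendsto_const[of u]]] by simp
  qed
  have least: "s \<le> b" if "\<And>z. z \<in> sphere 0 1 \<Longrightarrow> f z \<le> b" for b
    by (rule LIMSEQ_le_bl[OF s tendsto_const g_le[OF that]])
  show ?thesis
  proof (intro exI conjI allI impI)
    fix t show "cos t *\<^sub>R x + sin t *\<^sub>R y \<le> s"
      using up[of "cis t"] by (simp add: f_def)
  next
    fix b assume b: "\<forall>t. cos t *\<^sub>R x + sin t *\<^sub>R y \<le> b"
    show "s \<le> b"
    proof (rule least)
      fix z :: complex assume "z \<in> sphere 0 1"
      then have "z = cis (Arg z)" using rcis_cmod_Arg[of z] by (simp add: rcis_def)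
      with b show "f z \<le> b" unfolding f_def by (metis cis.sel)
    qed
  qed
qed

lemma modulus_upper: "cos t *\<^sub>R re z + sin t *\<^sub>R im z \<le> modulus z"
  and modulus_least: "(\<And>t. cos t *\<^sub>R re z + sin t *\<^sub>R im z \<le> b) \<Longrightarrow> modulus z \<le> b"
proof -
  obtain s where s: "\<forall>t. cos t *\<^sub>R re z + sin t *\<^sub>R im z \<le> s"
      "\<forall>b. (\<forall>t. cos t *\<^sub>R re z + sin t *\<^sub>R im z \<le> b) \<longrightarrow> s \<le> b"
    using modulus_exists by blast
  have "modulus z = s"
    unfolding modulus_def by (rule Least_equality) (use s in blast)+
  then show "cos t *\<^sub>R re z + sin t *\<^sub>R im z \<le> modulus z"
    "(\<And>t. cos t *\<^sub>R re z + sin t *\<^sub>R im z \<le> b) \<Longrightarrow> modulus z \<le> b"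
    using s by auto
qed

lemma abs_re_le_modulus: "\<bar>re z\<bar> \<le> modulus z"
  using modulus_upper[of 0 z] modulus_upper[of pi z] by (intro abs_leI) simp_all

lemma abs_im_le_modulus: "\<bar>im z\<bar> \<le> modulus z"
  using modulus_upper[of "pi/2" z] modulus_upper[of "- (pi/2)" z] by (intro abs_leI) simp_all

lemma modulus_nonneg: "0 \<le> modulus z"
  using abs_re_le_modulus abs_ge_zero order_trans by blast

lemma modulus_le_sum: "modulus z \<le> \<bar>re z\<bar> + \<bar>im z\<bar>"
proof (rule modulus_least)
  fix t
  have "cos t *\<^sub>R re z + sin t *\<^sub>R im z \<le> \<bar>cos t\<bar> *\<^sub>R \<bar>re z\<bar> + \<bar>sin t\<bar> *\<^sub>R \<bar>im z\<bar>"
    by (intro add_mono order_trans[OF abs_ge_self abs_scaleR_bl])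
  also have "\<dots> \<le> 1 *\<^sub>R \<bar>re z\<bar> + 1 *\<^sub>R \<bar>im z\<bar>"
    by (intro add_mono scaleR_right_mono) simp_all
  finally show "cos t *\<^sub>R re z + sin t *\<^sub>R im z \<le> \<bar>re z\<bar> + \<bar>im z\<bar>" by simp
qed

instantiation cpx :: (ab_group_add) ab_group_add
begin
definition "0 = Cpx 0 0"
definition "z + w = Cpx (re z + re w) (im z + im w)"
definition "- z = Cpx (- re z) (- im z)"
definition "z - w = Cpx (re z - re w) (im z - im w)"
instance
  by standard (auto simp: zero_cpx_def plus_cpx_def uminus_cpx_def minus_cpx_def)
end

lemma re_im_simps [simp]:
  "re 0 = 0" "im 0 = 0" "re (z + w) = re z + re w" "im (z + w) = im z + im w"
  "re (- z) = - re z" "im (- z) = - im z" "re (z - w) = re z - re w" "im (z - w) = im z - im w"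
  by (auto simp: zero_cpx_def plus_cpx_def uminus_cpx_def minus_cpx_def)

definition scaleC :: "complex \<Rightarrow> 'a::real_vector cpx \<Rightarrow> 'a cpx" (infixr "*\<^sub>C" 75) where
  "c *\<^sub>C z = Cpx (Re c *\<^sub>R re z - Im c *\<^sub>R im z) (Re c *\<^sub>R im z + Im c *\<^sub>R re z)"

lemma re_scaleC [simp]: "re (c *\<^sub>C z) = Re c *\<^sub>R re z - Im c *\<^sub>R im z"
  and im_scaleC [simp]: "im (c *\<^sub>C z) = Re c *\<^sub>R im z + Im c *\<^sub>R re z"
  by (simp_all add: scaleC_def)

interpretation cpx: vector_space "scaleC :: complex \<Rightarrow> 'a::real_vector cpx \<Rightarrow> 'a cpx"
  by standard (auto intro!: cpx.expand simp: algebra_simps)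

instantiation cpx :: (real_vector) real_vector
begin
definition "r *\<^sub>R z = complex_of_real r *\<^sub>C z"
instance
  by standard (auto intro!: cpx.expand simp: scaleR_cpx_def algebra_simps)
end

lemma re_scaleR [simp]: "re (r *\<^sub>R z) = r *\<^sub>R re z"
  and im_scaleR [simp]: "im (r *\<^sub>R z) = r *\<^sub>R im z"
  by (simp_all add: scaleR_cpx_def)

lemma modulus_scaleC: "modulus (c *\<^sub>C z) = cmod c *\<^sub>R modulus z"
proof -
  have le: "modulus (c *\<^sub>C z) \<le> cmod c *\<^sub>R modulus z" for c z
  proof (rule modulus_least)
    fix t
    define a where "a = Arg c"
    have "c = rcis (cmod c) a" by (simp add: a_def rcis_cmod_Arg)
    then have c: "Re c = cmod c * cos a" "Im c = cmod c * sin a"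
      by (metis Re_rcis) (metis Im_rcis \<open>c = rcis (cmod c) a\<close>)
    have "cos t *\<^sub>R re (c *\<^sub>C z) + sin t *\<^sub>R im (c *\<^sub>C z)
        = cmod c *\<^sub>R (cos (t - a) *\<^sub>R re z + sin (t - a) *\<^sub>R im z)"
      by (simp add: c cos_diff sin_diff algebra_simps)
    also have "\<dots> \<le> cmod c *\<^sub>R modulus z"
      by (intro scaleR_left_mono modulus_upper) simp
    finally show "cos t *\<^sub>R re (c *\<^sub>C z) + sin t *\<^sub>R im (c *\<^sub>C z) \<le> cmod c *\<^sub>R modulus z" .
  qed
  show ?thesis
  proof (cases "c = 0")
    case True
    have "modulus 0 \<le> (0::'a)" by (rule modulus_least) simp
    with True show ?thesis by (simp add: antisym modulus_nonneg)
  next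
    case False
    have "modulus z = modulus (inverse c *\<^sub>C (c *\<^sub>C z))" using False by simp
    also have "\<dots> \<le> inverse (cmod c) *\<^sub>R modulus (c *\<^sub>C z)"
      using le[of "inverse c" "c *\<^sub>C z"] by (simp add: norm_inverse)
    finally have "cmod c *\<^sub>R modulus z \<le> cmod c *\<^sub>R (inverse (cmod c) *\<^sub>R modulus (c *\<^sub>C z))"
      by (rule scaleR_left_mono) simp
    with False have "cmod c *\<^sub>R modulus z \<le> modulus (c *\<^sub>C z)" by simp
    with le show ?thesis by (rule antisym)
  qed
qed

lemma modulus_triangle: "modulus (z + w) \<le> modulus z + modulus w"
proof (rule modulus_least)
  fix t
  show "cos t *\<^sub>R re (z + w) + sin t *\<^sub>R im (z + w) \<le> modulus z + modulus w"
    using add_mono[OF modulus_upper[of t z] modulus_upper[of t w]] by (simp add: algebra_simps)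
qed

instantiation cpx :: (banach_lattice) real_normed_vector
begin
definition norm_cpx where "norm z = norm (modulus z)"
definition dist_cpx where "dist z w = norm (z - w)" for z w :: "'a cpx"
definition sgn_cpx where "sgn z = z /\<^sub>R norm z" for z :: "'a cpx"
definition uniformity_cpx :: "('a cpx \<times> 'a cpx) filter"
  where "uniformity_cpx = (INF e\<in>{0<..}. principal {(z, w). dist z w < e})"
definition open_cpx :: "'a cpx set \<Rightarrow> bool"
  where "open_cpx U = (\<forall>z\<in>U. eventually (\<lambda>(z', w). z' = z \<longrightarrow> w \<in> U) uniformity)"
instance
proof
  fix z w :: "'a cpx" and r :: real
  show "norm z = 0 \<longleftrightarrow> z = 0"
  proof
    assume "norm z = 0"
    then have "\<bar>re z\<bar> \<le> 0" "\<bar>im z\<bar> \<le> 0"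
      using abs_re_le_modulus[of z] abs_im_le_modulus[of z] by (simp_all add: norm_cpx_def)
    then show "z = 0" by (auto intro!: cpx.expand)
  next
    assume "z = 0"
    then show "norm z = 0" using modulus_scaleC[of 0 z] by (simp add: norm_cpx_def)
  qed
  have "norm (modulus (z + w)) \<le> norm (modulus z + modulus w)"
    by (rule norm_le_of_abs_le') (simp add: abs_of_nonneg modulus_nonneg modulus_triangle)
  then show "norm (z + w) \<le> norm z + norm w"
    unfolding norm_cpx_def using norm_triangle_ineq order_trans by blast
  show "norm (r *\<^sub>R z) = \<bar>r\<bar> * norm z"
    by (simp add: norm_cpx_def scaleR_cpx_def modulus_scaleC)
qed (simp_all add: dist_cpx_def sgn_cpx_def uniformity_cpx_def open_cpx_def)
end

lemma norm_re_le: "norm (re z) \<le> norm z"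
  unfolding norm_cpx_def by (rule norm_le_of_abs_le'[OF abs_re_le_modulus])

lemma norm_im_le: "norm (im z) \<le> norm z"
  unfolding norm_cpx_def by (rule norm_le_of_abs_le'[OF abs_im_le_modulus])

lemma norm_cpx_le: "norm z \<le> norm (re z) + norm (im z)"
proof -
  have "norm (modulus z) \<le> norm (\<bar>re z\<bar> + \<bar>im z\<bar>)"
    by (rule norm_le_of_abs_le') (simp add: abs_of_nonneg modulus_nonneg modulus_le_sum)
  also have "\<dots> \<le> norm (re z) + norm (im z)"
    by (metis norm_abs_bl norm_triangle_ineq)
  finally show ?thesis by (simp add: norm_cpx_def)
qed

instance cpx :: (banach_lattice) banach
proof
  fix X :: "nat \<Rightarrow> 'a cpx" assume X: "Cauchy X"
  have "Cauchy (\<lambda>n. re (X n))" "Cauchy (\<lambda>n. im (X n))"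
    using X norm_re_le[of "X m - X n" for m n] norm_im_le[of "X m - X n" for m n]
    unfolding Cauchy_def dist_norm by (auto, meson order_le_less_trans)+
  then obtain x y where xy: "(\<lambda>n. re (X n)) \<longlonglongrightarrow> x" "(\<lambda>n. im (X n)) \<longlonglongrightarrow> y"
    by (meson Cauchy_convergent convergent_def)
  have "(\<lambda>n. norm (re (X n) - x) + norm (im (X n) - y)) \<longlonglongrightarrow> 0"
    using tendsto_add[OF tendsto_norm_zero[OF LIM_zero[OF xy(1)]]
        tendsto_norm_zero[OF LIM_zero[OF xy(2)]]] by simp
  moreover have "norm (X n - Cpx x y) \<le> norm (re (X n) - x) + norm (im (X n) - y)" for n
    using norm_cpx_le[of "X n - Cpx x y"] by simp
  ultimately have "(\<lambda>n. X n - Cpx x y) \<longlonglongrightarrow> 0"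
    by (rule Lim_null_comparison[OF always_eventually, OF allI, rotated])
  then have "X \<longlonglongrightarrow> Cpx x y" by (rule LIM_zero_cancel)
  then show "convergent X" by (rule convergentI)
qed

definition of_re :: "'a::zero \<Rightarrow> 'a cpx" where
  "of_re x = Cpx x 0"

definition real_elements :: "'a::zero cpx set" where
  "real_elements = range of_re"

definition pos_cone :: "'a::banach_lattice cpx set" where
  "pos_cone = of_re ` {x. 0 \<le> x}"

lemma pos_cone_iff: "z \<in> pos_cone \<longleftrightarrow> 0 \<le> re z \<and> im z = 0"
  by (cases z) (auto simp: pos_cone_def of_re_def)

text \<open>Thus \<open>0 < z\<close> means that \<open>z\<close> is a non-zero element of the cone.\<close>

instantiation cpx :: (banach_lattice) ordered_real_vector
begin
definition less_eq_cpx where "z \<le> w \<longleftrightarrow> w - z \<in> pos_cone" for z w :: "'a cpx"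
definition less_cpx where "z < w \<longleftrightarrow> z \<le> w \<and> z \<noteq> w" for z w :: "'a cpx"
instance
  by standard
    (auto simp: less_eq_cpx_def less_cpx_def pos_cone_iff intro!: cpx.expand
      intro: scaleR_left_mono scaleR_right_mono)
end


section \<open>Bounded operators\<close>

text \<open>
  The library's bounded operators between spaces over the reals, restricted to the
  complex linear ones. The operator norm does not depend on the scalar field.
\<close>

definition bounded_ops :: "('a::banach_lattice cpx \<Rightarrow>\<^sub>L 'a cpx) set" where
  "bounded_ops = {T. Vector_Spaces.linear scaleC scaleC (blinfun_apply T)}"

definition positive_op :: "('a::banach_lattice cpx \<Rightarrow>\<^sub>L 'a cpx) \<Rightarrow> bool" where
  "positive_op T \<longleftrightarrow> blinfun_apply T ` pos_cone \<subseteq> pos_cone"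

definition compact_op :: "('a::banach_lattice cpx \<Rightarrow>\<^sub>L 'a cpx) \<Rightarrow> bool" where
  "compact_op T \<longleftrightarrow> compact (closure (blinfun_apply T ` cball 0 1))"

lift_definition scalar_op :: "complex \<Rightarrow> 'a::banach_lattice cpx \<Rightarrow>\<^sub>L 'a cpx" is scaleC
proof
  fix c :: complex and z w :: "'a cpx" and r :: real
  show "c *\<^sub>C (z + w) = c *\<^sub>C z + c *\<^sub>C w" by (rule cpx.scale_right_distrib)
  show "c *\<^sub>C r *\<^sub>R z = r *\<^sub>R c *\<^sub>C z" by (simp add: scaleR_cpx_def mult.commute)
  show "\<exists>K. \<forall>z::'a cpx. norm (c *\<^sub>C z) \<le> norm z * K"
    by (intro exI[of _ "cmod c"]) (simp add: norm_cpx_def modulus_scaleC mult.commute)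
qed


section \<open>Unbounded operators, spectrum and resolvent\<close>

text \<open>
  An operator \<open>A : D(A) \<rightarrow> E\<close> is given by its domain \<open>D\<close> and a function \<open>A\<close> whose values
  outside \<open>D\<close> are irrelevant.
\<close>

definition linear_operator :: "'a::banach_lattice cpx set \<Rightarrow> ('a cpx \<Rightarrow> 'a cpx) \<Rightarrow> bool" where
  "linear_operator D A \<longleftrightarrow> cpx.subspace D \<and>
     (\<forall>x\<in>D. \<forall>y\<in>D. A (x + y) = A x + A y) \<and> (\<forall>c. \<forall>x\<in>D. A (c *\<^sub>C x) = c *\<^sub>C A x)"

definition densely_defined :: "'a::banach_lattice cpx set \<Rightarrow> bool" where
  "densely_defined D \<longleftrightarrow> closure D = UNIV"

definition real_operator :: "'a::banach_lattice cpx set \<Rightarrow> ('a cpx \<Rightarrow> 'a cpx) \<Rightarrow> bool" where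
  "real_operator D A \<longleftrightarrow>
     D = {x + \<i> *\<^sub>C y | x y. x \<in> real_elements \<inter> D \<and> y \<in> real_elements \<inter> D} \<and>
     A ` (real_elements \<inter> D) \<subseteq> real_elements"

definition resolvent_set :: "'a::banach_lattice cpx set \<Rightarrow> ('a cpx \<Rightarrow> 'a cpx) \<Rightarrow> complex set" where
  "resolvent_set D A = {l. bij_betw (\<lambda>x. l *\<^sub>C x - A x) D UNIV \<and>
     bounded_linear (inv_into D (\<lambda>x. l *\<^sub>C x - A x))}"

text \<open>Meaningful for \<open>l \<in> resolvent_set D A\<close> only.\<close>

definition resolvent ::
  "'a::banach_lattice cpx set \<Rightarrow> ('a cpx \<Rightarrow> 'a cpx) \<Rightarrow> complex \<Rightarrow> 'a cpx \<Rightarrow>\<^sub>L 'a cpx" where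
  "resolvent D A l = Blinfun (inv_into D (\<lambda>x. l *\<^sub>C x - A x))"

definition spectrum :: "'a::banach_lattice cpx set \<Rightarrow> ('a cpx \<Rightarrow> 'a cpx) \<Rightarrow> complex set" where
  "spectrum D A = - resolvent_set D A"

definition spectral_bound :: "'a::banach_lattice cpx set \<Rightarrow> ('a cpx \<Rightarrow> 'a cpx) \<Rightarrow> ereal" where
  "spectral_bound D A = (SUP l\<in>spectrum D A. ereal (Re l))"

definition real_spectral_bound :: "'a::banach_lattice cpx set \<Rightarrow> ('a cpx \<Rightarrow> 'a cpx) \<Rightarrow> ereal" where
  "real_spectral_bound D A = (SUP r\<in>{r. complex_of_real r \<in> spectrum D A}. ereal r)"

definition op_add ::
  "('a::banach_lattice cpx \<Rightarrow> 'a cpx) \<Rightarrow> ('a cpx \<Rightarrow>\<^sub>L 'a cpx) \<Rightarrow> 'a cpx \<Rightarrow> 'a cpx" where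
  "op_add A K = (\<lambda>x. A x + blinfun_apply K x)"

text \<open>
  A pole is an isolated singularity whose Laurent expansion (convergent in operator norm)
  starts with a non-zero coefficient at the power \<open>-n\<close>, where \<open>n \<ge> 1\<close>; \<open>U k\<close> is the
  coefficient at the power \<open>k - n\<close>. The library's \<open>is_pole\<close> only asks for the norm to tend to
  infinity, which for operator-valued functions does not exclude essential singularities.
\<close>

definition resolvent_pole ::
  "'a::banach_lattice cpx set \<Rightarrow> ('a cpx \<Rightarrow> 'a cpx) \<Rightarrow> complex \<Rightarrow> bool" where
  "resolvent_pole D A l0 \<longleftrightarrow>
     (\<exists>n\<ge>1. \<exists>r>0. \<exists>U. range U \<subseteq> bounded_ops \<and> U 0 \<noteq> 0 \<and>
        (\<forall>l\<in>ball l0 r - {l0}. l \<in> resolvent_set D A \<and>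
          (\<lambda>k. scalar_op ((l - l0) powi (int k - int n)) o\<^sub>L U k) sums resolvent D A l))"

definition relatively_compact_op ::
  "'a::banach_lattice cpx set \<Rightarrow> ('a cpx \<Rightarrow> 'a cpx) \<Rightarrow> ('a cpx \<Rightarrow>\<^sub>L 'a cpx) \<Rightarrow> bool" where
  "relatively_compact_op D A K \<longleftrightarrow> (\<exists>l\<in>resolvent_set D A. compact_op (K o\<^sub>L resolvent D A l))"


section \<open>Quasi-interior points and strong positivity\<close>

definition principal_ideal :: "'a::banach_lattice cpx \<Rightarrow> 'a cpx set" where
  "principal_ideal u = {x. \<exists>c\<ge>0. of_re (modulus x) \<le> c *\<^sub>R u}"

definition quasi_interior :: "'a::banach_lattice cpx \<Rightarrow> bool" where
  "quasi_interior u \<longleftrightarrow> u \<in> pos_cone \<and> closure (principal_ideal u) = UNIV"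

definition vec_strongly_pos :: "'a::banach_lattice cpx \<Rightarrow> 'a cpx \<Rightarrow> bool" where
  "vec_strongly_pos u f \<longleftrightarrow> (\<exists>\<epsilon>>0. \<epsilon> *\<^sub>R u \<le> f)"

definition op_strongly_pos :: "'a::banach_lattice cpx \<Rightarrow> ('a cpx \<Rightarrow>\<^sub>L 'a cpx) \<Rightarrow> bool" where
  "op_strongly_pos u T \<longleftrightarrow> (\<forall>f>0. vec_strongly_pos u (blinfun_apply T f))"

end

theory Submission
  imports Defs
begin

text \<open>
  Every comparison comes from the Neumann series: wherever both resolvents are positive,
  \<open>R(l, A + K) \<ge> R(l, A)\<close>. Positivity of \<open>R(\<cdot>, A + K)\<close> starts close to \<open>l\<^sub>1\<close> and
  propagates to the left along the real resolvent set, since for \<open>l < m\<close> close to each other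
  \<open>R(l) = \<Sum>k. (m - l)\<^sup>k R(m)\<^sup>k\<^sup>+\<^sup>1\<close>.
  If \<open>s\<^sub>\<real>(A + K) < s\<close>, then \<open>R(l, A)\<close> would stay bounded as \<open>l\<close> decreases to \<open>s\<close>.

  For \<open>K \<noteq> 0\<close> and \<open>K\<close> compact relative to \<open>A\<close>, strict inequality is shown before the pole
  property, so that the point \<open>r = s\<^sub>\<real>(A + K)\<close> lies in the resolvent set of \<open>A\<close>. Relative
  compactness and positivity then replace Fredholm theory and spectral projections defined by
  contour integrals: \<open>A + K\<close> has a positive eigenvector for \<open>r\<close> dominating a multiple of
  \<open>u\<close>, which forces \<open>(l - r) R(l, A + K)\<close> to be bounded and to converge strongly to a
  projection \<open>P\<close>; on the kernel of \<open>P\<close> the resolvent stays bounded and hence extends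
  to \<open>r\<close>. So the pole is simple.
\<close>

subsection \<open>The order and positive operators\<close>

text \<open>Once \<open>r\<close> lies in the resolvent set of \<open>A\<close>,
  \<open>R(l, A)\<close> converges in norm as \<open>l\<close> decreases to \<open>r\<close>. Hence
  \<open>K R(l_n, A) f_n\<close> has a convergent subsequence for every bounded sequence
  \<open>f_n\<close>, and the equations \<open>S = R + R K S\<close> and
  \<open>S = R + S K R\<close> for \<open>S = R(., A + K)\<close> turn this into compactness
  statements about \<open>S\<close>. At a pole of \<open>R(., A)\<close> this mechanism breaks down,
  which is why the strict inequality must come before the pole property. For \<open>K = 0\<close>
  the pole is that of \<open>A\<close> itself.

  A quasi-interior point lets single vectors control positive operators: such an operator vanishes
  if it vanishes at \<open>u\<close>, and a norm bounded sequence of them tends to zero strongly as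
  soon as it does so at one vector dominating a positive multiple of \<open>u\<close>.

  All limits run along real sequences right of the critical point, where positivity is available. A
  complex neighbourhood of \<open>r\<close> is entered only at the very end, by two Neumann series:
  one leads from a point \<open>m > r\<close> to \<open>r\<close>, the other from \<open>r\<close>
  into a disc.\<close>

lemma cpx_le_iff: "z \<le> w \<longleftrightarrow> re z \<le> re w \<and> im z = im w"
  by (auto simp: less_eq_cpx_def pos_cone_iff)

lemma nonneg_cpx_iff: "0 \<le> z \<longleftrightarrow> z \<in> pos_cone"
  by (simp add: less_eq_cpx_def)

lemma nonneg_of_re_modulus: "0 \<le> of_re (modulus z)"
  by (simp add: cpx_le_iff of_re_def modulus_nonneg)

lemma LIMSEQ_nonneg_cpx:
  fixes l :: "'a::banach_lattice cpx"
  assumes X: "X \<longlonglongrightarrow> l" and nonneg: "\<And>n. 0 \<le> X n"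
  shows "0 \<le> l"
proof -
  have 0: "(\<lambda>n. norm (X n - l)) \<longlonglongrightarrow> 0"
    using X by (simp add: LIM_zero tendsto_norm_zero)
  have "(\<lambda>n. re (X n) - re l) \<longlonglongrightarrow> 0"
    by (rule Lim_null_comparison[OF _ 0]) (use norm_re_le[of "X _ - l"] in simp)
  then have "(\<lambda>n. re (X n)) \<longlonglongrightarrow> re l" by (rule LIM_zero_cancel)
  then have re: "0 \<le> re l"
    by (rule LIMSEQ_nonneg_bl) (use nonneg in \<open>simp add: cpx_le_iff\<close>)
  have "(\<lambda>n. im (X n) - im l) \<longlonglongrightarrow> 0"
    by (rule Lim_null_comparison[OF _ 0]) (use norm_im_le[of "X _ - l"] in simp)
  then have "(\<lambda>n. im (X n)) \<longlonglongrightarrow> im l" by (rule LIM_zero_cancel)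
  moreover have "im (X n) = 0" for n using nonneg[of n] by (simp add: cpx_le_iff)
  ultimately have "im l = 0" using LIMSEQ_unique[OF tendsto_const, of 0] by force
  with re show ?thesis by (simp add: cpx_le_iff)
qed

lemma modulus_of_re: "0 \<le> x \<Longrightarrow> modulus (of_re x) = x"
  using modulus_le_sum[of "of_re x"] abs_re_le_modulus[of "of_re x"]
  by (simp add: of_re_def antisym)

lemma norm_of_re_modulus: "norm (of_re (modulus z)) = norm z"
  by (simp add: norm_cpx_def modulus_of_re modulus_nonneg)

lemma norm_mono_cpx:
  fixes z w :: "'a::banach_lattice cpx"
  assumes "0 \<le> z" "z \<le> w"
  shows "norm z \<le> norm w"
proof -
  have "z = of_re (re z)" "w = of_re (re w)" "0 \<le> re z" "re z \<le> re w"
    using assms by (auto simp: cpx_le_iff of_re_def intro!: cpx.expand)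
  then have "modulus z = re z" "modulus w = re w"
    by (metis modulus_of_re order_trans)+
  with \<open>0 \<le> re z\<close> \<open>re z \<le> re w\<close> show ?thesis
    by (simp add: norm_cpx_def norm_le_of_abs_le')
qed

lemma norm_scaleC [simp]: "norm (c *\<^sub>C z) = cmod c * norm (z :: 'a::banach_lattice cpx)"
  by (simp add: norm_cpx_def modulus_scaleC)

lemma scaleC_of_real [simp]: "complex_of_real c *\<^sub>C z = c *\<^sub>R z"
  by (simp add: scaleR_cpx_def)

lemma bounded_ops_iff: "T \<in> bounded_ops \<longleftrightarrow> (\<forall>c x. blinfun_apply T (c *\<^sub>C x) = c *\<^sub>C blinfun_apply T x)"
proof -
  have "Vector_Spaces.linear scaleC scaleC (blinfun_apply T)
    \<longleftrightarrow> (\<forall>c x. blinfun_apply T (c *\<^sub>C x) = c *\<^sub>C blinfun_apply T x)"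
    unfolding Vector_Spaces.linear_iff
    by (auto simp: blinfun.add_right cpx.vector_space_axioms)
  then show ?thesis by (simp add: bounded_ops_def)
qed

lemma bounded_opsD: "T \<in> bounded_ops \<Longrightarrow> blinfun_apply T (c *\<^sub>C x) = c *\<^sub>C blinfun_apply T x"
  by (simp add: bounded_ops_iff)

lemma blinfun_tendsto_apply:
  "(T \<longlongrightarrow> L) F \<Longrightarrow> ((\<lambda>i. blinfun_apply (T i) x) \<longlongrightarrow> blinfun_apply L x) F"
  by (intro tendsto_intros)

lemma tendsto_scaleC:
  fixes X :: "_ \<Rightarrow> 'a::banach_lattice cpx"
  assumes "(X \<longlongrightarrow> x) F" shows "((\<lambda>i. c *\<^sub>C X i) \<longlongrightarrow> c *\<^sub>C x) F"
  using bounded_linear.tendsto[OF blinfun.bounded_linear_right[of "scalar_op c"] assms]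
  by (simp add: scalar_op.rep_eq)

lemma bounded_ops_limit:
  assumes "T \<longlonglongrightarrow> L" "\<And>n::nat. T n \<in> bounded_ops"
  shows "L \<in> bounded_ops"
  unfolding bounded_ops_iff
proof (intro allI)
  fix c x
  have "(\<lambda>n. blinfun_apply (T n) (c *\<^sub>C x)) \<longlonglongrightarrow> c *\<^sub>C blinfun_apply L x"
    using tendsto_scaleC[OF blinfun_tendsto_apply[OF assms(1)], of c x] assms(2)
    by (simp add: bounded_opsD)
  then show "blinfun_apply L (c *\<^sub>C x) = c *\<^sub>C blinfun_apply L x"
    using LIMSEQ_unique blinfun_tendsto_apply[OF assms(1)] by blast
qed

lemma bounded_ops_intros [intro, simp]:
  "scalar_op c \<in> bounded_ops" "id_blinfun \<in> bounded_ops" "0 \<in> bounded_ops"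
  "S \<in> bounded_ops \<Longrightarrow> T \<in> bounded_ops \<Longrightarrow> S o\<^sub>L T \<in> bounded_ops"
  "S \<in> bounded_ops \<Longrightarrow> T \<in> bounded_ops \<Longrightarrow> S + T \<in> bounded_ops"
  "S \<in> bounded_ops \<Longrightarrow> T \<in> bounded_ops \<Longrightarrow> S - T \<in> bounded_ops"
  by (simp_all add: bounded_ops_iff scalar_op.rep_eq blinfun.add_left blinfun.diff_left
      cpx.scale_right_distrib cpx.scale_right_diff_distrib mult.commute)

lemma norm_scalar_op: "norm (scalar_op c :: 'a::banach_lattice cpx \<Rightarrow>\<^sub>L _) \<le> cmod c"
  by (rule norm_blinfun_bound) (simp_all add: scalar_op.rep_eq)

lemma positive_opD: "positive_op T \<Longrightarrow> 0 \<le> x \<Longrightarrow> 0 \<le> blinfun_apply T x"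
  by (auto simp: positive_op_def nonneg_cpx_iff)

lemma positive_opI: "(\<And>x. 0 \<le> x \<Longrightarrow> 0 \<le> blinfun_apply T x) \<Longrightarrow> positive_op T"
  by (auto simp: positive_op_def nonneg_cpx_iff)

lemma positive_op_mono: "positive_op T \<Longrightarrow> x \<le> y \<Longrightarrow> blinfun_apply T x \<le> blinfun_apply T y"
  using positive_opD[of T "y - x"] by (simp add: blinfun.diff_right)

lemma positive_op_compose: "positive_op S \<Longrightarrow> positive_op T \<Longrightarrow> positive_op (S o\<^sub>L T)"
  by (rule positive_opI) (simp add: positive_opD)

lemma positive_op_limit:
  assumes "T \<longlonglongrightarrow> L" "\<And>n::nat. positive_op (T n)" shows "positive_op L"
  by (rule positive_opI, rule LIMSEQ_nonneg_cpx[OF blinfun_tendsto_apply[OF assms(1)]])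
    (use assms(2) in \<open>simp_all add: positive_opD\<close>)

text \<open>The modulus is the supremum of the real parts of all rotations of a vector, and a
  complex linear \<open>T\<close> commutes with rotations. It therefore suffices to compare real
  parts, where positivity applies directly.\<close>

lemma modulus_positive_op:
  assumes T: "T \<in> bounded_ops" "positive_op T"
  shows "of_re (modulus (blinfun_apply T z)) \<le> blinfun_apply T (of_re (modulus z))"
proof -
  \<comment> \<open>Positive operators map real elements to real elements, since every real element
    is a difference of two positive ones.\<close>
  have real: "im (blinfun_apply T (of_re x)) = 0" for x
  proof -
    have "of_re x = of_re \<bar>x\<bar> - of_re (\<bar>x\<bar> - x)"
      by (auto simp: of_re_def intro!: cpx.expand)
    moreover have "0 \<le> of_re \<bar>x\<bar>" "0 \<le> of_re (\<bar>x\<bar> - x)"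
      by (simp_all add: cpx_le_iff of_re_def abs_ge_self)
    then have "im (blinfun_apply T (of_re \<bar>x\<bar>)) = 0" "im (blinfun_apply T (of_re (\<bar>x\<bar> - x))) = 0"
      using positive_opD[OF T(2)] by (force simp: cpx_le_iff)+
    ultimately show ?thesis by (simp add: blinfun.diff_right)
  qed
  let ?m = "blinfun_apply T (of_re (modulus z))"
  have "modulus (blinfun_apply T z) \<le> re ?m"
  proof (rule modulus_least)
    fix t
    \<comment> \<open>The rotation is chosen so that the real part of \<open>w\<close> is the
      expression inside the supremum that defines the modulus of \<open>z\<close>.\<close>
    define w where "w = cis (- t) *\<^sub>C z"
    have "w = of_re (re w) + \<i> *\<^sub>C of_re (im w)"
      by (auto simp: of_re_def intro!: cpx.expand)
    then have "blinfun_apply T w = blinfun_apply T (of_re (re w)) + \<i> *\<^sub>C blinfun_apply T (of_re (im w))"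
      by (metis blinfun.add_right bounded_opsD[OF T(1)])
    then have "re (blinfun_apply T w) = re (blinfun_apply T (of_re (re w)))"
      by (simp add: real)
    also have "\<dots> \<le> re ?m"
    proof -
      have "re w \<le> modulus z"
        using modulus_upper[of t z] by (simp add: w_def)
      then have "of_re (re w) \<le> of_re (modulus z)" by (simp add: cpx_le_iff of_re_def)
      from positive_op_mono[OF T(2) this] show ?thesis by (simp add: cpx_le_iff)
    qed
    finally show "cos t *\<^sub>R re (blinfun_apply T z) + sin t *\<^sub>R im (blinfun_apply T z) \<le> re ?m"
      by (simp add: w_def bounded_opsD[OF T(1)])
  qed
  then show ?thesis by (simp add: cpx_le_iff real) (simp add: of_re_def)
qed

text \<open>A vector and its modulus have the same norm, so norms of positive operators may be
  tested on the cone.\<close>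

lemma norm_positive_op_le:
  assumes "T \<in> bounded_ops" "positive_op T"
  shows "norm (blinfun_apply T z) \<le> norm (blinfun_apply T (of_re (modulus z)))"
  using norm_mono_cpx[OF nonneg_of_re_modulus modulus_positive_op[OF assms]]
  by (simp add: norm_of_re_modulus)

lemma norm_le_of_dominated:
  assumes T: "T \<in> bounded_ops" "positive_op T"
    and le: "\<And>x. 0 \<le> x \<Longrightarrow> blinfun_apply T x \<le> blinfun_apply S x"
  shows "norm T \<le> norm S"
proof (rule norm_blinfun_bound)
  fix z
  have "norm (blinfun_apply T z) \<le> norm (blinfun_apply T (of_re (modulus z)))"
    by (rule norm_positive_op_le[OF T])
  also have "\<dots> \<le> norm (blinfun_apply S (of_re (modulus z)))"
    by (intro norm_mono_cpx positive_opD[OF T(2)] le nonneg_of_re_modulus)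
  also have "\<dots> \<le> norm S * norm z"
    using norm_blinfun[of S "of_re (modulus z)"] by (simp add: norm_of_re_modulus)
  finally show "norm (blinfun_apply T z) \<le> norm S * norm z" .
qed simp

lemma norm_positive_op_principal_ideal:
  assumes T: "T \<in> bounded_ops" "positive_op T" and x: "of_re (modulus x) \<le> v"
  shows "norm (blinfun_apply T x) \<le> norm (blinfun_apply T v)"
  using norm_positive_op_le[OF T] norm_mono_cpx[OF positive_opD[OF T(2) nonneg_of_re_modulus]
      positive_op_mono[OF T(2) x]] order_trans by blast

text \<open>On the principal ideal, \<open>T y\<close> is dominated by a multiple of
  \<open>T u\<close>; density and continuity do the rest.\<close>

lemma quasi_interior_positive_op_eq_0:
  assumes u: "quasi_interior u" and T: "T \<in> bounded_ops" "positive_op T"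
    and Tu: "blinfun_apply T u = 0"
  shows "T = 0"
proof (rule blinfun_eqI)
  fix x
  have zero: "blinfun_apply T y = 0" if y: "y \<in> principal_ideal u" for y
  proof -
    obtain c where "of_re (modulus y) \<le> c *\<^sub>R u"
      using y by (auto simp: principal_ideal_def)
    from norm_positive_op_principal_ideal[OF T this] Tu show ?thesis
      by (simp add: blinfun.scaleR_right)
  qed
  have "x \<in> closure (principal_ideal u)" using u by (simp add: quasi_interior_def)
  then obtain X where X: "\<And>n. X n \<in> principal_ideal u" "X \<longlonglongrightarrow> x"
    by (auto simp: closure_sequential)
  have "(\<lambda>n. blinfun_apply T (X n)) \<longlonglongrightarrow> blinfun_apply T x"
    by (intro tendsto_intros X)
  with X(1) show "blinfun_apply T x = blinfun_apply 0 x"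
    by (simp add: zero LIMSEQ_const_iff)
qed

lemma quasi_interior_pos:
  assumes "(UNIV :: 'a::banach_lattice cpx set) \<noteq> {0}" "quasi_interior (u :: 'a cpx)"
  shows "0 < u"
proof -
  have "u \<noteq> 0"
  proof
    assume "u = 0"
    \<comment> \<open>The identity is positive and vanishes at \<open>u = 0\<close>, so it would be
      the zero operator.\<close>
    with quasi_interior_positive_op_eq_0[OF assms(2), of id_blinfun]
    have "(id_blinfun :: 'a cpx \<Rightarrow>\<^sub>L _) = 0"
      by (simp add: positive_opI)
    then have "x = 0" for x :: "'a cpx"
      by (metis blinfun_apply_id_blinfun id_apply zero_blinfun.rep_eq)
    then have "(UNIV :: 'a cpx set) = {0}" by auto
    with assms(1) show False by blast
  qed
  with assms(2) show ?thesis
    by (simp add: quasi_interior_def nonneg_cpx_iff less_le)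
qed

lemma op_strongly_pos_imp_positive:
  assumes "0 \<le> u" "op_strongly_pos u T"
  shows "positive_op T"
proof (rule positive_opI)
  fix x :: "'a cpx" assume x: "0 \<le> x"
  show "0 \<le> blinfun_apply T x"
  proof (cases "x = 0")
    case True then show ?thesis by (simp add: blinfun.zero_right)
  next
    case False
    with x have "0 < x" by (simp add: less_le)
    then obtain e where "e > 0" "e *\<^sub>R u \<le> blinfun_apply T x"
      using assms(2) by (auto simp: op_strongly_pos_def vec_strongly_pos_def)
    moreover have "0 \<le> e *\<^sub>R u" using assms(1) \<open>e > 0\<close> by (simp add: scaleR_nonneg_nonneg)
    ultimately show ?thesis by order
  qed
qed

subsection \<open>Neumann series\<close>

lemma blinfun_compose_assoc: "(S o\<^sub>L T) o\<^sub>L R = S o\<^sub>L (T o\<^sub>L R)"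
  by (rule blinfun_eqI) simp

primrec bpow :: "('a::real_normed_vector \<Rightarrow>\<^sub>L 'a) \<Rightarrow> nat \<Rightarrow> 'a \<Rightarrow>\<^sub>L 'a" where
  "bpow T 0 = id_blinfun"
| "bpow T (Suc k) = T o\<^sub>L bpow T k"

lemma bpow_Suc_right: "bpow T (Suc k) = bpow T k o\<^sub>L T"
proof (induction k)
  case (Suc k)
  then show ?case by (metis bpow.simps(2) blinfun_compose_assoc)
qed (simp add: blinfun_eqI)

lemma norm_bpow_le: "norm (bpow T k) \<le> norm T ^ k"
proof (induction k)
  case 0 show ?case using norm_blinfun_id_le by simp
next
  case (Suc k)
  then show ?case
    using norm_blinfun_compose[of T "bpow T k"]
    by (simp add: order_trans[OF norm_blinfun_compose] mult_left_mono)
qed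

lemma bpow_bounded_ops: "T \<in> bounded_ops \<Longrightarrow> bpow T k \<in> bounded_ops"
  by (induction k) auto

lemma bpow_positive: "positive_op T \<Longrightarrow> positive_op (bpow T k)"
  by (induction k) (simp_all add: positive_op_compose positive_opI)

text \<open>Both fixed point equations are recorded because a resolvent has to be a left and a right
  inverse: each equation supplies one side.\<close>

lemma neumann:
  fixes T :: "'a::banach \<Rightarrow>\<^sub>L 'a"
  assumes "norm T < 1"
  obtains G where "bpow T sums G" "G = id_blinfun + (T o\<^sub>L G)" "G = id_blinfun + (G o\<^sub>L T)"
proof -
  have "summable (bpow T)"
    by (rule summable_comparison_test'[OF summable_geometric[of "norm T"]])
      (use assms norm_bpow_le in auto)
  then obtain G where G: "bpow T sums G" by (auto simp: summable_def)
  have "(\<lambda>k. T o\<^sub>L bpow T k) sums (T o\<^sub>L G)"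
    by (rule bounded_linear.sums[OF bounded_bilinear.bounded_linear_right[OF bounded_bilinear_blinfun_compose] G])
  then have "(\<lambda>k. bpow T (Suc k)) sums (T o\<^sub>L G)" by simp
  moreover have "(\<lambda>k. bpow T k o\<^sub>L T) sums (G o\<^sub>L T)"
    by (rule bounded_linear.sums[OF bounded_bilinear.bounded_linear_left[OF bounded_bilinear_blinfun_compose] G])
  then have "(\<lambda>k. bpow T (Suc k)) sums (G o\<^sub>L T)" by (simp only: bpow_Suc_right)
  moreover have "(\<lambda>k. bpow T (Suc k)) sums (G - id_blinfun)"
    using G sums_Suc_iff[of "bpow T" "G - id_blinfun"] by simp
  ultimately have "T o\<^sub>L G = G - id_blinfun" "G o\<^sub>L T = G - id_blinfun"
    using sums_unique2 by blast+
  with that[OF G] show ?thesis by simp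
qed

lemma sums_bounded_ops:
  assumes "f sums G" "\<And>k. f k \<in> bounded_ops" shows "G \<in> bounded_ops"
proof (rule bounded_ops_limit)
  show "(\<lambda>n. sum f {..<n}) \<longlonglongrightarrow> G" using assms(1) by (simp add: sums_def)
  show "sum f {..<n} \<in> bounded_ops" for n
    by (induction n) (use assms(2) in auto)
qed

lemma sums_positive:
  assumes "f sums G" "\<And>k. positive_op (f k)" shows "positive_op G"
proof (rule positive_op_limit)
  show "(\<lambda>n. sum f {..<n}) \<longlonglongrightarrow> G" using assms(1) by (simp add: sums_def)
  show "positive_op (sum f {..<n})" for n
    by (rule positive_opI)
      (simp add: blinfun.sum_left sum_nonneg positive_opD[OF assms(2)])
qed

subsection \<open>Resolvents\<close>

text \<open>A relational form of \<open>X = R(l, A)\<close>. It lets an explicitly constructed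
  operator be recognised as the resolvent by algebra alone, without touching
  \<open>inv_into\<close>.\<close>

definition is_resolvent ::
  "'a::banach_lattice cpx set \<Rightarrow> ('a cpx \<Rightarrow> 'a cpx) \<Rightarrow> complex \<Rightarrow> ('a cpx \<Rightarrow>\<^sub>L 'a cpx) \<Rightarrow> bool" where
  "is_resolvent D A l X \<longleftrightarrow> X \<in> bounded_ops \<and>
     (\<forall>x. X x \<in> D \<and> l *\<^sub>C X x - A (X x) = x) \<and> (\<forall>x\<in>D. X (l *\<^sub>C x - A x) = x)"

text \<open>Membership in \<open>resolvent_set\<close> yields only a real linear inverse; complex
  homogeneity has to be derived from the linearity of \<open>A\<close> on \<open>D\<close>.\<close>

lemma is_resolvent_resolvent:
  assumes A: "linear_operator D A" and l: "l \<in> resolvent_set D A"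
  shows "is_resolvent D A l (resolvent D A l)"
proof -
  let ?f = "\<lambda>x. l *\<^sub>C x - A x"
  have bij: "bij_betw ?f D UNIV" and bl: "bounded_linear (inv_into D ?f)"
    using l by (auto simp: resolvent_set_def)
  have R: "blinfun_apply (resolvent D A l) = inv_into D ?f"
    unfolding resolvent_def by (rule bounded_linear_Blinfun_apply[OF bl])
  have D: "inv_into D ?f x \<in> D" and f: "?f (inv_into D ?f x) = x" for x
    using bij_betw_imp_surj_on[OF bij] by (auto intro: inv_into_into f_inv_into_f)
  have inv: "inv_into D ?f (?f x) = x" if "x \<in> D" for x
    by (rule inv_into_f_f[OF bij_betw_imp_inj_on[OF bij] that])
  have "inv_into D ?f (c *\<^sub>C x) = c *\<^sub>C inv_into D ?f x" for c x
  proof -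
    let ?y = "inv_into D ?f x"
    have "c *\<^sub>C ?y \<in> D" using A D by (simp add: linear_operator_def cpx.subspace_scale)
    moreover have "?f (c *\<^sub>C ?y) = c *\<^sub>C ?f ?y"
      using A D by (simp add: linear_operator_def cpx.scale_right_diff_distrib mult.commute)
    ultimately show ?thesis using inv[of "c *\<^sub>C ?y"] f by simp
  qed
  then show ?thesis
    using D f inv by (simp add: is_resolvent_def R bounded_ops_iff)
qed

lemma is_resolventD:
  assumes "is_resolvent D A l X"
  shows "l \<in> resolvent_set D A" "resolvent D A l = X" "X \<in> bounded_ops"
proof -
  let ?f = "\<lambda>x. l *\<^sub>C x - A x"
  have D: "X x \<in> D" and f: "?f (X x) = x" for x
    using assms by (auto simp: is_resolvent_def)
  have X: "X (?f x) = x" if "x \<in> D" for x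
    using assms that by (auto simp: is_resolvent_def)
  have inj: "inj_on ?f D" by (rule inj_on_inverseI) (rule X)
  have "x \<in> ?f ` D" for x
    by (rule image_eqI[of _ _ "X x"]) (simp_all only: D f)
  then have bij: "bij_betw ?f D UNIV"
    unfolding bij_betw_def using inj by blast
  have inv: "inv_into D ?f = blinfun_apply X"
    using inv_into_f_eq[OF inj D f] by (simp add: fun_eq_iff)
  show "l \<in> resolvent_set D A"
    using bij by (simp add: resolvent_set_def inv blinfun.bounded_linear_right)
  show "resolvent D A l = X" by (simp add: resolvent_def inv blinfun_apply_inverse)
  show "X \<in> bounded_ops" using assms by (simp add: is_resolvent_def)
qed

lemma linear_operator_op_add:
  "linear_operator D A \<Longrightarrow> K \<in> bounded_ops \<Longrightarrow> linear_operator D (op_add A K)"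
  by (auto simp: linear_operator_def op_add_def blinfun.add_right bounded_opsD
      cpx.scale_right_distrib)

text \<open>The first equation reads \<open>X x = R (x + K (X x))\<close>, so \<open>X\<close> takes
  values in \<open>D\<close> and is a right inverse of \<open>l - A - K\<close>; the second makes it
  a left inverse.\<close>

lemma is_resolvent_perturb:
  fixes R X K :: "'a::banach_lattice cpx \<Rightarrow>\<^sub>L 'a cpx"
  assumes R: "is_resolvent D A l R" and X: "X \<in> bounded_ops"
    and 1: "\<And>x. X x = R x + R (K (X x))" and 2: "\<And>x. X x = R x + X (K (R x))"
  shows "is_resolvent D (op_add A K) l X"
  unfolding is_resolvent_def
proof (intro conjI allI ballI)
  fix x
  have eq: "X x = R (x + K (X x))" using 1[of x] by (simp add: blinfun.add_right)
  show "X x \<in> D" using R by (subst eq) (simp add: is_resolvent_def)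
  have "l *\<^sub>C X x - A (X x) = x + K (X x)"
    using R by (subst (1 2) eq) (simp add: is_resolvent_def)
  then show "l *\<^sub>C X x - op_add A K (X x) = x"
    by (simp add: op_add_def diff_diff_add[symmetric])
next
  fix x assume "x \<in> D"
  define z where "z = l *\<^sub>C x - A x"
  have x: "R z = x" using R \<open>x \<in> D\<close> by (simp add: is_resolvent_def z_def)
  have "l *\<^sub>C x - op_add A K x = z - K (R z)"
    unfolding x by (simp add: op_add_def z_def)
  then have "X (l *\<^sub>C x - op_add A K x) = X z - X (K (R z))"
    by (simp only: blinfun.diff_right)
  also have "\<dots> = x" using 2[of z] x by (simp add: algebra_simps)
  finally show "X (l *\<^sub>C x - op_add A K x) = x" .
qed (rule X)

lemma is_resolvent_perturb_eq:
  fixes R S K :: "'a::banach_lattice cpx \<Rightarrow>\<^sub>L 'a cpx"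
  assumes R: "is_resolvent D A l R" and S: "is_resolvent D (op_add A K) l S"
  shows "S x = R x + R (K (S x))" "S x = R x + S (K (R x))"
proof -
  have "l *\<^sub>C S x - (A (S x) + K (S x)) = x"
    using S by (simp add: is_resolvent_def op_add_def)
  then have "x + K (S x) = l *\<^sub>C S x - A (S x)" by (simp add: algebra_simps)
  then have "R (x + K (S x)) = S x"
    using R S by (simp add: is_resolvent_def)
  then show "S x = R x + R (K (S x))" by (simp add: blinfun.add_right)
  have "l *\<^sub>C R x - A (R x) = x" using R by (simp add: is_resolvent_def)
  then have "l *\<^sub>C R x - op_add A K (R x) = x - K (R x)"
    by (simp add: op_add_def algebra_simps)
  moreover have "S (l *\<^sub>C R x - op_add A K (R x)) = R x"
    using R S by (auto simp: is_resolvent_def)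
  ultimately have "S (x - K (R x)) = R x" by simp
  then show "S x = R x + S (K (R x))" by (simp add: blinfun.diff_right algebra_simps)
qed

text \<open>Moving the spectral parameter from \<open>l\<close> to \<open>m\<close> is the
  perturbation of \<open>A\<close> by the scalar operator \<open>l - m\<close>. The resolvent
  identity and the local power series thereby become special cases of perturbation theory.\<close>

lemma is_resolvent_shift:
  "is_resolvent D (op_add A (scalar_op (l - m))) l X \<longleftrightarrow> is_resolvent D A m X"
proof -
  have "l *\<^sub>C x - op_add A (scalar_op (l - m)) x = m *\<^sub>C x - A x" for x
    by (simp add: op_add_def scalar_op.rep_eq cpx.scale_left_diff_distrib)
  then show ?thesis by (simp add: is_resolvent_def)
qed

lemma resolvent_identity:
  fixes R S :: "'a::banach_lattice cpx \<Rightarrow>\<^sub>L 'a cpx"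
  assumes "is_resolvent D A l R" "is_resolvent D A m S"
  shows "S x = R x + (l - m) *\<^sub>C R (S x)" "S x = R x + (l - m) *\<^sub>C S (R x)"
proof -
  have S: "is_resolvent D (op_add A (scalar_op (l - m))) l S"
    using assms(2) by (simp add: is_resolvent_shift)
  show "S x = R x + (l - m) *\<^sub>C R (S x)"
    using is_resolvent_perturb_eq(1)[OF assms(1) S, of x]
    by (simp only: scalar_op.rep_eq bounded_opsD[OF is_resolventD(3)[OF assms(1)]])
  show "S x = R x + (l - m) *\<^sub>C S (R x)"
    using is_resolvent_perturb_eq(2)[OF assms(1) S, of x]
    by (simp only: scalar_op.rep_eq bounded_opsD[OF is_resolventD(3)[OF assms(2)]])
qed

text \<open>A converse of the resolvent identity: an operator tied to one known resolvent by both
  forms of the identity is itself a resolvent. The candidate Laurent series is verified this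
  way.\<close>

lemma is_resolvent_of_identity:
  fixes R S :: "'a::banach_lattice cpx \<Rightarrow>\<^sub>L 'a cpx"
  assumes "is_resolvent D A l R" "S \<in> bounded_ops"
    "\<And>x. S x = R x + (l - m) *\<^sub>C R (S x)" "\<And>x. S x = R x + (l - m) *\<^sub>C S (R x)"
  shows "is_resolvent D A m S"
proof -
  have "is_resolvent D (op_add A (scalar_op (l - m))) l S"
  proof (rule is_resolvent_perturb[OF assms(1,2)])
    show "S x = R x + R (scalar_op (l - m) (S x))" for x
      using assms(3)[of x]
      by (simp only: scalar_op.rep_eq bounded_opsD[OF is_resolventD(3)[OF assms(1)]])
    show "S x = R x + S (scalar_op (l - m) (R x))" for x
      using assms(4)[of x] by (simp only: scalar_op.rep_eq bounded_opsD[OF assms(2)])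
  qed
  then show ?thesis by (simp add: is_resolvent_shift)
qed

text \<open>The resolvent is \<open>R\<close> composed with the sum \<open>G\<close> of the powers
  of \<open>K R\<close>; positivity is inherited term by term.\<close>

lemma is_resolvent_neumann:
  assumes R: "is_resolvent D A l R" and K: "K \<in> bounded_ops" "norm (K o\<^sub>L R) < 1"
  obtains X where "is_resolvent D (op_add A K) l X"
    "positive_op R \<and> positive_op K \<longrightarrow> positive_op X"
proof -
  obtain G where G: "bpow (K o\<^sub>L R) sums G" and
    1: "G = id_blinfun + ((K o\<^sub>L R) o\<^sub>L G)" and 2: "G = id_blinfun + (G o\<^sub>L (K o\<^sub>L R))"
    using neumann[OF K(2)] by metis
  have Rb: "R \<in> bounded_ops" by (rule is_resolventD(3)[OF R])
  have "G \<in> bounded_ops"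
    by (rule sums_bounded_ops[OF G]) (intro bpow_bounded_ops bounded_ops_intros K Rb)
  with Rb have "R o\<^sub>L G \<in> bounded_ops" by simp
  moreover have "G x = x + K (R (G x))" for x
    using arg_cong[OF 1, of "\<lambda>T. blinfun_apply T x"]
    by (simp only: blinfun.add_left blinfun_apply_blinfun_compose id_blinfun.rep_eq id_apply)
  then have "(R o\<^sub>L G) x = R x + R (K ((R o\<^sub>L G) x))" for x
    by (metis blinfun_apply_blinfun_compose blinfun.add_right)
  moreover have "G x = x + G (K (R x))" for x
    using arg_cong[OF 2, of "\<lambda>T. blinfun_apply T x"]
    by (simp only: blinfun.add_left blinfun_apply_blinfun_compose id_blinfun.rep_eq id_apply)
  then have "(R o\<^sub>L G) x = R x + (R o\<^sub>L G) (K (R x))" for x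
    by (metis blinfun_apply_blinfun_compose blinfun.add_right)
  ultimately have "is_resolvent D (op_add A K) l (R o\<^sub>L G)"
    using is_resolvent_perturb[OF R] by blast
  moreover have "positive_op (R o\<^sub>L G)" if "positive_op R" "positive_op K"
    by (intro positive_op_compose sums_positive[OF G] bpow_positive that)
  ultimately show ?thesis using that by blast
qed

text \<open>Positivity survives a move to the left only: it needs the perturbing scalar
  \<open>l - m\<close> to be a nonnegative real.\<close>

lemma is_resolvent_near:
  fixes R :: "'a::banach_lattice cpx \<Rightarrow>\<^sub>L 'a cpx"
  assumes R: "is_resolvent D A l R" and m: "cmod (l - m) * norm R < 1"
  obtains X where "is_resolvent D A m X"
    "\<forall>d\<ge>0. l - m = complex_of_real d \<longrightarrow> positive_op R \<longrightarrow> positive_op X"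
proof -
  have "norm (scalar_op (l - m) o\<^sub>L R) \<le> cmod (l - m) * norm R"
    by (rule order_trans[OF norm_blinfun_compose mult_right_mono[OF norm_scalar_op]]) simp
  with m have lt: "norm (scalar_op (l - m) o\<^sub>L R) < 1" by simp
  obtain X where
    X: "is_resolvent D (op_add A (scalar_op (l - m))) l X"
      "positive_op R \<and> positive_op (scalar_op (l - m) :: 'a cpx \<Rightarrow>\<^sub>L _) \<longrightarrow> positive_op X"
    by (rule is_resolvent_neumann[OF R bounded_ops_intros(1) lt])
  show ?thesis
  proof
    show "is_resolvent D A m X" using X(1) by (simp add: is_resolvent_shift)
    show "\<forall>d\<ge>0. l - m = complex_of_real d \<longrightarrow> positive_op R \<longrightarrow> positive_op X"
    proof (intro allI impI)
      fix d :: real assume d: "0 \<le> d" "l - m = complex_of_real d" "positive_op R"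
      then have "positive_op (scalar_op (l - m) :: 'a cpx \<Rightarrow>\<^sub>L _)"
        by (intro positive_opI) (simp add: scalar_op.rep_eq scaleR_nonneg_nonneg)
      with X(2) d(3) show "positive_op X" by blast
    qed
  qed
qed

lemma resolvent_set_near:
  assumes "linear_operator D A" "l \<in> resolvent_set D A"
    "cmod (l - m) * norm (resolvent D A l) < 1"
  shows "m \<in> resolvent_set D A"
  using is_resolvent_near[OF is_resolvent_resolvent[OF assms(1,2)] assms(3)] is_resolventD(1)
  by metis

text \<open>Every spectral value has distance at least \<open>1 / norm (resolvent D A (X n))\<close>
  from \<open>X n\<close>, so a uniform bound keeps the spectrum away from the limit. Read
  backwards, resolvents blow up along sequences approaching the spectrum.\<close>

lemma LIMSEQ_resolvent_bounded:
  assumes A: "linear_operator D A" and X: "X \<longlonglongrightarrow> l" "\<And>n. X n \<in> resolvent_set D A"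
    and C: "\<And>n. norm (resolvent D A (X n)) \<le> C"
  shows "l \<in> resolvent_set D A"
proof -
  have "0 \<le> C" using C[of 0] norm_ge_zero order_trans by blast
  then have "0 < 1 / (C + 1)" by simp
  from LIMSEQ_D[OF X(1) this] obtain n where n: "cmod (X n - l) < 1 / (C + 1)" by blast
  have "cmod (X n - l) * norm (resolvent D A (X n)) \<le> cmod (X n - l) * (C + 1)"
    using C[of n] by (intro mult_left_mono) auto
  also have "\<dots> < 1" using n \<open>0 \<le> C\<close> by (simp add: field_simps)
  finally show ?thesis by (rule resolvent_set_near[OF A X(2)])
qed

lemma isCont_resolvent:
  assumes A: "linear_operator D A" and l: "l \<in> resolvent_set D A"
  shows "isCont (resolvent D A) l"
proof -
  define R where "R = resolvent D A l"
  define c where "c = norm R + 1"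
  have c: "0 < c" "norm R \<le> c" by (auto simp: c_def intro: add_nonneg_pos)
  have R: "is_resolvent D A l R" unfolding R_def by (rule is_resolvent_resolvent[OF A l])
  have key: "norm (resolvent D A m - R) \<le> 2 * c\<^sup>2 * cmod (l - m)"
    if "cmod (l - m) < 1 / (2 * c)" for m
  proof -
    have half: "cmod (l - m) * c \<le> 1/2" using that c by (simp add: field_simps)
    have le: "cmod (l - m) * norm R \<le> cmod (l - m) * c"
      using c by (intro mult_left_mono) auto
    with half have "cmod (l - m) * norm R < 1" by linarith
    then have "m \<in> resolvent_set D A" using resolvent_set_near[OF A l] by (simp add: R_def)
    then have S: "is_resolvent D A m (resolvent D A m)" (is "is_resolvent D A m ?S")
      by (rule is_resolvent_resolvent[OF A])
    have "?S - R = scalar_op (l - m) o\<^sub>L (R o\<^sub>L ?S)"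
    proof (rule blinfun_eqI)
      fix x
      have "?S x - R x = (l - m) *\<^sub>C R (?S x)"
        by (metis resolvent_identity(1)[OF R S] add_diff_cancel_left')
      then show "(?S - R) x = (scalar_op (l - m) o\<^sub>L (R o\<^sub>L ?S)) x"
        by (simp add: blinfun.diff_left scalar_op.rep_eq)
    qed
    then have "norm (?S - R) \<le> norm (scalar_op (l - m) :: 'a cpx \<Rightarrow>\<^sub>L _) * norm (R o\<^sub>L ?S)"
      using norm_blinfun_compose by metis
    also have "\<dots> \<le> cmod (l - m) * (c * norm ?S)"
      by (intro mult_mono norm_scalar_op order_trans[OF norm_blinfun_compose]
          mult_right_mono c) auto
    finally have le: "norm (?S - R) \<le> cmod (l - m) * (c * norm ?S)" .
    \<comment> \<open>The unknown norm of \<open>?S\<close> reappears on the right with factor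
      \<open>1/2\<close> and is absorbed.\<close>
    have "norm ?S \<le> norm R + norm (?S - R)"
      using norm_triangle_ineq[of R "?S - R"] by simp
    also have "\<dots> \<le> c + (cmod (l - m) * c) * norm ?S" using le c by (simp add: mult.assoc)
    also have "\<dots> \<le> c + 1/2 * norm ?S" by (intro add_left_mono mult_right_mono half) simp
    finally have "norm ?S \<le> 2 * c" by simp
    then have "cmod (l - m) * (c * norm ?S) \<le> cmod (l - m) * (c * (2 * c))"
      using c by (intro mult_left_mono) auto
    with le show ?thesis by (simp add: power2_eq_square mult_ac)
  qed
  have "(\<lambda>m. 2 * c\<^sup>2 * cmod (l - m)) \<midarrow>l\<rightarrow> 2 * c\<^sup>2 * cmod (l - l)"
    by (intro tendsto_intros)
  then have 0: "(\<lambda>m. 2 * c\<^sup>2 * cmod (l - m)) \<midarrow>l\<rightarrow> 0" by simp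
  have "eventually (\<lambda>m. norm (resolvent D A m - R) \<le> 2 * c\<^sup>2 * cmod (l - m)) (at l)"
    unfolding eventually_at
    by (rule exI[of _ "1 / (2 * c)"]) (use c key in \<open>auto simp: dist_norm norm_minus_commute\<close>)
  from Lim_null_comparison[OF this 0] have "(\<lambda>m. resolvent D A m - R) \<midarrow>l\<rightarrow> 0" .
  then show ?thesis by (simp add: isCont_def R_def LIM_zero_iff)
qed

lemma LIMSEQ_resolvent:
  assumes "linear_operator D A" "complex_of_real l \<in> resolvent_set D A" "X \<longlonglongrightarrow> l"
  shows "(\<lambda>n. resolvent D A (complex_of_real (X n))) \<longlonglongrightarrow> resolvent D A (complex_of_real l)"
  using isCont_tendsto_compose[OF isCont_resolvent[OF assms(1,2)] tendsto_of_real[OF assms(3)]]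
  by simp

lemma resolvent_identity_real:
  assumes "linear_operator D A" "complex_of_real l \<in> resolvent_set D A"
    "complex_of_real m \<in> resolvent_set D A"
  shows "resolvent D A m x = resolvent D A l x + (l - m) *\<^sub>R resolvent D A l (resolvent D A m x)"
  using resolvent_identity(1)[OF is_resolvent_resolvent[OF assms(1,2)]
      is_resolvent_resolvent[OF assms(1,3)], of x]
  by (simp flip: of_real_diff)

subsection \<open>Spectral bounds\<close>

lemma less_real_spectral_bound_resolvent_set:
  assumes "real_spectral_bound D A < ereal l"
  shows "complex_of_real l \<in> resolvent_set D A"
proof (rule ccontr)
  assume "complex_of_real l \<notin> resolvent_set D A"
  then have "ereal l \<le> real_spectral_bound D A"
    unfolding real_spectral_bound_def by (intro SUP_upper) (simp add: spectrum_def)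
  with assms show False by simp
qed

lemma real_spectral_bound_le: "real_spectral_bound D A \<le> spectral_bound D A"
  unfolding real_spectral_bound_def spectral_bound_def
proof (rule SUP_least)
  fix r assume "r \<in> {r. complex_of_real r \<in> spectrum D A}"
  then show "ereal r \<le> (SUP l\<in>spectrum D A. ereal (Re l))"
    by (intro SUP_upper2[of "complex_of_real r"]) auto
qed

lemma less_spectral_bound_resolvent_set:
  assumes "spectral_bound D A < ereal (Re l)"
  shows "l \<in> resolvent_set D A"
proof (rule ccontr)
  assume "l \<notin> resolvent_set D A"
  then have "ereal (Re l) \<le> spectral_bound D A"
    unfolding spectral_bound_def by (intro SUP_upper) (simp add: spectrum_def)
  with assms show False by simp
qed

text \<open>If \<open>r\<close> were in the resolvent set, a disc of radius \<open>1 / N\<close>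
  around it would be free of spectrum, and the supremum would be at most
  \<open>r - 1 / N\<close>.\<close>

lemma real_spectral_bound_spectrum:
  assumes A: "linear_operator D A" and r: "real_spectral_bound D A = ereal r"
  shows "complex_of_real r \<in> spectrum D A"
proof (rule ccontr)
  assume "complex_of_real r \<notin> spectrum D A"
  then have rr: "complex_of_real r \<in> resolvent_set D A" by (simp add: spectrum_def)
  define N where "N = norm (resolvent D A r) + 1"
  have N: "0 < N" by (simp add: N_def add_nonneg_pos)
  have "real_spectral_bound D A \<le> ereal (r - 1 / N)"
    unfolding real_spectral_bound_def
  proof (rule SUP_least)
    fix t assume "t \<in> {r. complex_of_real r \<in> spectrum D A}"
    then have t: "complex_of_real t \<in> spectrum D A" by simp
    then have "\<not> cmod (r - complex_of_real t) * norm (resolvent D A r) < 1"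
      using resolvent_set_near[OF A rr, of t] by (auto simp: spectrum_def)
    then have "1 \<le> \<bar>r - t\<bar> * norm (resolvent D A r)" by (simp flip: of_real_diff)
    also have "\<dots> \<le> \<bar>r - t\<bar> * N" by (intro mult_left_mono) (auto simp: N_def)
    finally have "1 / N \<le> \<bar>r - t\<bar>" using N by (simp add: field_simps)
    moreover have "t \<le> r"
    proof -
      have "\<not> real_spectral_bound D A < ereal t"
        using less_real_spectral_bound_resolvent_set t by (auto simp: spectrum_def)
      with r show ?thesis by simp
    qed
    ultimately show "ereal t \<le> ereal (r - 1 / N)" by simp
  qed
  with r N show False by simp
qed

subsection \<open>Positivity of resolvents\<close>

text \<open>The points of the interval with positive resolvent form a closed set by continuity, and
  the Neumann series moves its infimum further left unless that infimum is \<open>a\<close>.\<close>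

lemma positive_resolvent_left:
  assumes A: "linear_operator D A"
    and res: "\<And>m. a \<le> m \<Longrightarrow> m \<le> b \<Longrightarrow> complex_of_real m \<in> resolvent_set D A"
    and ab: "a \<le> b" and b: "positive_op (resolvent D A (complex_of_real b))"
  shows "positive_op (resolvent D A (complex_of_real a))"
proof -
  let ?R = "\<lambda>m::real. resolvent D A (complex_of_real m)"
  define Z where "Z = {m. a \<le> m \<and> m \<le> b \<and> positive_op (?R m)}"
  have "closed Z"
    unfolding closed_sequential_limits
  proof (intro allI impI)
    fix X l assume X: "(\<forall>n. X n \<in> Z) \<and> X \<longlonglongrightarrow> l"
    then have lim: "X \<longlonglongrightarrow> l" and XZ: "\<And>n. X n \<in> Z" by auto
    have "a \<le> l" "l \<le> b"
      using LIMSEQ_le_const[OF lim, of a] LIMSEQ_le_const2[OF lim, of b] XZ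
      by (auto simp: Z_def)
    moreover have "positive_op (?R l)"
      using positive_op_limit[OF LIMSEQ_resolvent[OF A res[OF calculation] lim]] XZ
      by (auto simp: Z_def)
    ultimately show "l \<in> Z" by (simp add: Z_def)
  qed
  moreover have bZ: "b \<in> Z" using ab b by (simp add: Z_def)
  moreover have bdd: "bdd_below Z" by (rule bdd_belowI[of _ a]) (auto simp: Z_def)
  ultimately have inf: "Inf Z \<in> Z" using closed_contains_Inf[of Z] by blast
  define m where "m = Inf Z"
  have m: "a \<le> m" "m \<le> b" "positive_op (?R m)" using inf by (auto simp: Z_def m_def)
  have "m = a"
  proof (rule ccontr)
    assume "m \<noteq> a"
    \<comment> \<open>The first bound keeps \<open>m - d\<close> in the interval, the second makes
      the Neumann series at \<open>m\<close> converge; the added \<open>1\<close> gives a strict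
      inequality and a positive denominator.\<close>
    define d where "d = min (m - a) (1 / (norm (?R m) + 1))"
    have d: "0 < d" "d \<le> m - a" "d \<le> 1 / (norm (?R m) + 1)"
      using m \<open>m \<noteq> a\<close> by (auto simp: d_def add_nonneg_pos)
    have n: "0 < norm (?R m) + 1" by (simp add: add_nonneg_pos)
    have "d * norm (?R m) < d * (norm (?R m) + 1)" using d by (intro mult_strict_left_mono) auto
    also have "\<dots> \<le> 1" using d(3) n by (simp add: field_simps)
    finally have lt: "cmod (complex_of_real m - complex_of_real (m - d)) * norm (?R m) < 1"
      using d(1) by simp
    obtain X where X: "is_resolvent D A (complex_of_real (m - d)) X"
      "\<forall>e\<ge>0. complex_of_real m - complex_of_real (m - d) = complex_of_real e \<longrightarrow>
         positive_op (?R m) \<longrightarrow> positive_op X"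
      by (rule is_resolvent_near[OF is_resolvent_resolvent[OF A res[OF m(1,2)]] lt])
    have "positive_op (?R (m - d))"
      using X(2)[rule_format, of d] m(3) d is_resolventD(2)[OF X(1)] by simp
    then have "m - d \<in> Z" using d m by (simp add: Z_def)
    with cInf_lower[OF _ bdd] d show False by (force simp: m_def)
  qed
  with m show ?thesis by simp
qed

lemma resolvent_antimono:
  assumes A: "linear_operator D A"
    and res: "complex_of_real m \<in> resolvent_set D A" "complex_of_real l \<in> resolvent_set D A"
    and pos: "positive_op (resolvent D A m)" "positive_op (resolvent D A l)"
    and "m \<le> l" "0 \<le> x"
  shows "resolvent D A l x \<le> resolvent D A m x"
proof -
  have "0 \<le> (l - m) *\<^sub>R resolvent D A l (resolvent D A m x)"
    using assms by (intro scaleR_nonneg_nonneg positive_opD) auto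
  then show ?thesis using resolvent_identity_real[OF A res(2,1), of x]
    by (metis le_add_same_cancel1)
qed

subsection \<open>Compactness\<close>

lemma compact_op_subsequence:
  assumes T: "compact_op T" and x: "\<And>n. norm (x n) \<le> C"
  obtains y h where "strict_mono (h :: nat \<Rightarrow> nat)" "(\<lambda>n. blinfun_apply T (x (h n))) \<longlonglongrightarrow> y"
proof -
  define c where "c = \<bar>C\<bar> + 1"
  have c: "0 < c" by (simp add: c_def add_nonneg_pos)
  have "seq_compact (closure (blinfun_apply T ` cball 0 1))"
    using T by (simp add: compact_op_def compact_eq_seq_compact_metric)
  moreover have "blinfun_apply T (x n /\<^sub>R c) \<in> closure (blinfun_apply T ` cball 0 1)" for n
  proof -
    have "norm (x n) \<le> c" using x[of n] by (simp add: c_def)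
    then have "x n /\<^sub>R c \<in> cball 0 1" using c by (simp add: field_simps)
    then show ?thesis by (intro subsetD[OF closure_subset] imageI)
  qed
  ultimately obtain y h where h: "strict_mono (h :: nat \<Rightarrow> nat)"
    and y: "((\<lambda>n. blinfun_apply T (x n /\<^sub>R c)) \<circ> h) \<longlonglongrightarrow> y"
    using seq_compactE[of _ "\<lambda>n. blinfun_apply T (x n /\<^sub>R c)"] by metis
  have "(\<lambda>n. c *\<^sub>R blinfun_apply T (x (h n) /\<^sub>R c)) \<longlonglongrightarrow> c *\<^sub>R y"
    using tendsto_scaleR[OF tendsto_const y] by (simp add: o_def)
  then show ?thesis using that h c by (simp add: blinfun.scaleR_right)
qed

text \<open>The factorization \<open>K R(l) = K R(m) (I + (m - l) R(l))\<close> carries compactness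
  from the one \<open>m\<close> of the definition to every \<open>l\<close> in the resolvent
  set.\<close>

lemma relatively_compact_subsequence:
  assumes A: "linear_operator D A" and K: "K \<in> bounded_ops" "relatively_compact_op D A K"
    and l: "l \<in> resolvent_set D A" and x: "\<And>n. norm (x n) \<le> C"
  obtains y h where "strict_mono (h :: nat \<Rightarrow> nat)" "(\<lambda>n. K (resolvent D A l (x (h n)))) \<longlonglongrightarrow> y"
proof -
  from K(2) obtain m where m: "m \<in> resolvent_set D A" "compact_op (K o\<^sub>L resolvent D A m)"
    by (auto simp: relatively_compact_op_def)
  let ?R = "resolvent D A l" and ?S = "resolvent D A m"
  define T where "T = id_blinfun + (scalar_op (m - l) o\<^sub>L ?R)"
  have "norm (T (x n)) \<le> norm T * C" for n
    by (rule order_trans[OF norm_blinfun]) (intro mult_left_mono x norm_ge_zero)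
  then obtain y h
    where h: "strict_mono (h :: nat \<Rightarrow> nat)" "(\<lambda>n. (K o\<^sub>L ?S) (T (x (h n)))) \<longlonglongrightarrow> y"
    by (rule compact_op_subsequence[OF m(2)])
  have "(K o\<^sub>L ?S) (T z) = K (?R z)" for z
    using arg_cong[OF resolvent_identity(1)[OF is_resolvent_resolvent[OF A m(1)]
        is_resolvent_resolvent[OF A l], of z], of K, symmetric]
    by (simp add: T_def blinfun.add_left blinfun.add_right scalar_op.rep_eq
        bounded_opsD[OF is_resolventD(3)[OF is_resolvent_resolvent[OF A m(1)]]])
  with h that show ?thesis by simp
qed

subsection \<open>The pole of the perturbed resolvent\<close>

lemma scaleC_scaleR_commute: "c *\<^sub>C a *\<^sub>R x = a *\<^sub>R c *\<^sub>C x"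
  by (simp add: scaleR_cpx_def mult.commute del: scaleC_of_real)

lemma bounded_ops_scaleR [simp]: "T \<in> bounded_ops \<Longrightarrow> c *\<^sub>R T \<in> bounded_ops"
  by (simp add: bounded_ops_iff blinfun.scaleR_left scaleC_scaleR_commute)

lemma positive_op_scaleR: "positive_op T \<Longrightarrow> 0 \<le> c \<Longrightarrow> positive_op (c *\<^sub>R T)"
  by (rule positive_opI) (simp add: blinfun.scaleR_left positive_opD scaleR_nonneg_nonneg)

lemma norm_gt_obtain_vector:
  fixes T :: "'a::real_normed_vector \<Rightarrow>\<^sub>L 'b::real_normed_vector"
  assumes "C < norm T" "0 \<le> C"
  obtains x where "C * norm x < norm (T x)"
  using norm_blinfun_bound[OF assms(2), of T] assms(1) by (meson not_le)

text \<open>Extracts points tending to \<open>r\<close> from the right at which some quantity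
  exceeds the index; with a constantly true \<open>P\<close> it merely supplies such points.\<close>

lemma right_sequence:
  fixes r b :: real
  assumes "r < b" and P: "\<And>d C. 0 < d \<Longrightarrow> \<exists>t. r < t \<and> t < r + d \<and> P C t"
  obtains l where "l \<longlonglongrightarrow> r" "\<forall>k. r < l k \<and> l k < b \<and> P (real k) (l k)"
proof -
  have "\<exists>t. r < t \<and> t < b \<and> t < r + inverse (real (Suc k)) \<and> P (real k) t" for k
    using P[of "min (b - r) (inverse (real (Suc k)))" "real k"] \<open>r < b\<close> by force
  then obtain l where l: "\<And>k. r < l k \<and> l k < b \<and> l k < r + inverse (real (Suc k)) \<and> P (real k) (l k)"
    by metis
  have "(\<lambda>k. l k - r) \<longlonglongrightarrow> 0"
    by (rule Lim_null_comparison[OF _ LIMSEQ_inverse_real_of_nat])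
      (use l in \<open>auto simp: abs_of_pos less_imp_le algebra_simps\<close>)
  then have "l \<longlonglongrightarrow> r" by (rule LIM_zero_cancel)
  with l that show ?thesis by blast
qed

text \<open>Blow-up in normalised form: once the images \<open>y n\<close> are scaled to norm one,
  the preimages \<open>x n\<close> tend to zero.\<close>

lemma LIMSEQ_normalized_zero:
  fixes x :: "nat \<Rightarrow> 'a::real_normed_vector" and y :: "nat \<Rightarrow> 'b::real_normed_vector"
  assumes "\<And>n. real n * norm (x n) \<le> norm (y n)" "\<And>n. norm (y n) \<noteq> 0"
  shows "(\<lambda>n. x n /\<^sub>R norm (y n)) \<longlonglongrightarrow> 0"
proof (rule Lim_null_comparison[OF _ lim_inverse_n])
  have "norm (x n /\<^sub>R norm (y n)) \<le> inverse (real n)" if "n > 0" for n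
    using assms[of n] that by (simp add: field_simps)
  then show "eventually (\<lambda>n. norm (x n /\<^sub>R norm (y n)) \<le> inverse (real n)) sequentially"
    by (auto simp: eventually_sequentially intro!: exI[of _ 1])
qed

lemma LIMSEQ_zero_on_dense:
  fixes T :: "nat \<Rightarrow> 'a::real_normed_vector \<Rightarrow>\<^sub>L 'b::real_normed_vector"
  assumes C: "\<And>n. norm (T n) \<le> C" and X: "closure X = UNIV"
    and lim: "\<And>x. x \<in> X \<Longrightarrow> (\<lambda>n. T n x) \<longlonglongrightarrow> 0"
  shows "(\<lambda>n. T n x) \<longlonglongrightarrow> 0"
proof (rule LIMSEQ_I)
  fix e :: real assume "0 < e"
  have C0: "0 \<le> C" using C[of 0] norm_ge_zero order_trans by blast
  then have "0 < e / (2 * (C + 1))" using \<open>0 < e\<close> by simp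
  moreover have "x \<in> closure X" using X by simp
  ultimately obtain y where y: "y \<in> X" "dist y x < e / (2 * (C + 1))"
    by (meson closure_approachable)
  from LIMSEQ_D[OF lim[OF y(1)], of "e / 2"] \<open>0 < e\<close>
  obtain N where N: "\<And>n. n \<ge> N \<Longrightarrow> norm (T n y) < e / 2" by auto
  show "\<exists>N. \<forall>n\<ge>N. norm (T n x - 0) < e"
  proof (intro exI allI impI)
    fix n assume "n \<ge> N"
    have "norm (T n (x - y)) \<le> norm (T n) * norm (x - y)" by (rule norm_blinfun)
    also have "\<dots> \<le> (C + 1) * (e / (2 * (C + 1)))"
      by (rule mult_mono) (use C[of n] y(2) C0 in \<open>auto simp: dist_norm norm_minus_commute\<close>)
    also have "\<dots> = e / 2" using C0 by (simp add: field_simps)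
    finally have "norm (T n (x - y)) \<le> e / 2" .
    moreover have "T n x = T n (x - y) + T n y" by (simp add: blinfun.diff_right)
    ultimately show "norm (T n x - 0) < e"
      using norm_triangle_ineq[of "T n (x - y)" "T n y"] N[OF \<open>n \<ge> N\<close>] by simp
  qed
qed

lemma bounded_ops_pointwise_limit:
  fixes T :: "nat \<Rightarrow> 'a::banach_lattice cpx \<Rightarrow>\<^sub>L 'a cpx"
  assumes T: "\<And>n. T n \<in> bounded_ops" and C: "\<And>n. norm (T n) \<le> C"
    and conv: "\<And>x. convergent (\<lambda>n. T n x)"
  obtains P where "P \<in> bounded_ops" "\<forall>x. (\<lambda>n. T n x) \<longlonglongrightarrow> P x"
proof -
  obtain p where p: "\<And>x. (\<lambda>n. T n x) \<longlonglongrightarrow> p x"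
    using conv unfolding convergent_def by metis
  have "bounded_linear p"
  proof (rule bounded_linear_intro)
    fix x y
    show "p (x + y) = p x + p y"
      by (rule LIMSEQ_unique[OF p]) (use tendsto_add[OF p p] in \<open>simp add: blinfun.add_right\<close>)
  next
    fix c x
    show "p (c *\<^sub>R x) = c *\<^sub>R p x"
      by (rule LIMSEQ_unique[OF p])
        (use tendsto_scaleR[OF tendsto_const p] in \<open>simp add: blinfun.scaleR_right\<close>)
  next
    fix x
    have "norm (T n x) \<le> norm x * C" for n
      using order_trans[OF norm_blinfun mult_right_mono[OF C norm_ge_zero]]
      by (simp add: mult.commute)
    then show "norm (p x) \<le> norm x * C"
      using LIMSEQ_le_const2[OF tendsto_norm[OF p]] by blast
  qed
  then obtain P where P: "p = blinfun_apply P" by (metis bounded_linear_Blinfun_apply)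
  have "P (c *\<^sub>C x) = c *\<^sub>C P x" for c x
    using LIMSEQ_unique[OF p[of "c *\<^sub>C x"]] tendsto_scaleC[OF p[of x], of c]
    by (simp add: P bounded_opsD[OF T])
  then have "P \<in> bounded_ops" by (simp add: bounded_ops_iff)
  with p that show ?thesis by (simp add: P)
qed

section \<open>Pseudo-resolvents and their power series\<close>

lemma pseudo_resolvent_trans:
  fixes X Y Z :: "'a::banach_lattice cpx \<Rightarrow>\<^sub>L 'a cpx"
  assumes "X \<in> bounded_ops" "Y \<in> bounded_ops" "Z \<in> bounded_ops"
    and XY: "\<And>x. Y x = X x + (a - b) *\<^sub>C X (Y x)" "\<And>x. Y x = X x + (a - b) *\<^sub>C Y (X x)"
    and YZ: "\<And>x. Z x = Y x + (b - c) *\<^sub>C Y (Z x)" "\<And>x. Z x = Y x + (b - c) *\<^sub>C Z (Y x)"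
  shows "Z x = X x + (a - c) *\<^sub>C X (Z x)" "Z x = X x + (a - c) *\<^sub>C Z (X x)"
proof -
  \<comment> \<open>Used with \<open>v = X x\<close>, and with \<open>p = X (Z x)\<close>,
    \<open>q = X (Y (Z x))\<close> for the first identity, \<open>p = Z (X x)\<close>,
    \<open>q = Z (Y (X x))\<close> for the second.\<close>
  have algebra: "v + (a - b) *\<^sub>C (p - (b - c) *\<^sub>C q) + (b - c) *\<^sub>C (p + (a - b) *\<^sub>C q)
      = v + (a - c) *\<^sub>C p" for v p q :: "'a cpx"
  proof -
    have "(a - c) *\<^sub>C p = (a - b) *\<^sub>C p + (b - c) *\<^sub>C p" by (simp flip: cpx.scale_left_distrib)
    then show ?thesis
      by (simp add: cpx.scale_right_distrib cpx.scale_right_diff_distrib mult.commute)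
  qed
  have "X (Z x) = X (Y x) + (b - c) *\<^sub>C X (Y (Z x))"
    using arg_cong[OF YZ(1)[of x], of X] assms(1) by (simp only: blinfun.add_right bounded_opsD)
  then have "X (Y x) = X (Z x) - (b - c) *\<^sub>C X (Y (Z x))" by (simp only: add_diff_cancel_right')
  with XY(1)[of x] YZ(1)[of x] XY(1)[of "Z x"] show "Z x = X x + (a - c) *\<^sub>C X (Z x)"
    using algebra by metis
  have "Z (Y x) = Z (X x) + (a - b) *\<^sub>C Z (Y (X x))"
    using arg_cong[OF XY(2)[of x], of Z] assms(3) by (simp only: blinfun.add_right bounded_opsD)
  moreover have "Y (X x) = Z (X x) - (b - c) *\<^sub>C Z (Y (X x))"
    using YZ(2)[of "X x"] by (simp only: add_diff_cancel_right')
  ultimately show "Z x = X x + (a - c) *\<^sub>C Z (X x)"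
    using algebra XY(2)[of x] YZ(2)[of x] by metis
qed

lemma bpow_scalar_op:
  "W \<in> bounded_ops \<Longrightarrow> bpow (scalar_op c o\<^sub>L W) k = scalar_op (c ^ k) o\<^sub>L bpow W k"
  by (induction k) (auto intro!: blinfun_eqI simp: scalar_op.rep_eq bounded_opsD)

lemma pseudo_resolvent_series:
  fixes W :: "'a::banach_lattice cpx \<Rightarrow>\<^sub>L 'a cpx"
  assumes W: "W \<in> bounded_ops" and l: "cmod (r - l) * norm W < 1"
  obtains Z where "Z \<in> bounded_ops" "(\<lambda>k. scalar_op ((r - l) ^ k) o\<^sub>L bpow W (Suc k)) sums Z"
    "\<forall>x. Z x = W x + (r - l) *\<^sub>C W (Z x)" "\<forall>x. Z x = W x + (r - l) *\<^sub>C Z (W x)"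
proof -
  define T where "T = (scalar_op (r - l) o\<^sub>L W :: 'a cpx \<Rightarrow>\<^sub>L 'a cpx)"
  have T: "T \<in> bounded_ops" using W by (simp add: T_def)
  have "norm T \<le> cmod (r - l) * norm W" unfolding T_def
    by (rule order_trans[OF norm_blinfun_compose mult_right_mono[OF norm_scalar_op]]) simp
  with l have "norm T < 1" by simp
  then obtain G where G: "bpow T sums G" "G = id_blinfun + (T o\<^sub>L G)" "G = id_blinfun + (G o\<^sub>L T)"
    by (rule neumann)
  have Gb: "G \<in> bounded_ops" by (rule sums_bounded_ops[OF G(1) bpow_bounded_ops[OF T]])
  show ?thesis
  proof
    show "W o\<^sub>L G \<in> bounded_ops" using W Gb by simp
    have "(\<lambda>k. W o\<^sub>L bpow T k) sums (W o\<^sub>L G)"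
      by (rule bounded_linear.sums[OF bounded_bilinear.bounded_linear_right[OF bounded_bilinear_blinfun_compose] G(1)])
    moreover have "W o\<^sub>L bpow T k = scalar_op ((r - l) ^ k) o\<^sub>L bpow W (Suc k)" for k
      by (rule blinfun_eqI) (simp add: T_def bpow_scalar_op W scalar_op.rep_eq bounded_opsD)
    ultimately show "(\<lambda>k. scalar_op ((r - l) ^ k) o\<^sub>L bpow W (Suc k)) sums (W o\<^sub>L G)" by simp
    have 1: "G x = x + (r - l) *\<^sub>C W (G x)" for x
      using arg_cong[OF G(2), of "\<lambda>T. blinfun_apply T x"]
      by (simp only: blinfun.add_left blinfun_apply_blinfun_compose id_blinfun.rep_eq id_apply
          T_def scalar_op.rep_eq)
    have "W (G x) = W (x + (r - l) *\<^sub>C W (G x))" for x by (rule arg_cong[OF 1])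
    then show "\<forall>x. (W o\<^sub>L G) x = W x + (r - l) *\<^sub>C W ((W o\<^sub>L G) x)"
      by (metis blinfun_apply_blinfun_compose blinfun.add_right bounded_opsD[OF W])
    have 2: "G x = x + (r - l) *\<^sub>C G (W x)" for x
      using arg_cong[OF G(3), of "\<lambda>T. blinfun_apply T x"]
      by (simp only: blinfun.add_left blinfun_apply_blinfun_compose id_blinfun.rep_eq id_apply
          T_def scalar_op.rep_eq bounded_opsD[OF Gb])
    have "W (G x) = W (x + (r - l) *\<^sub>C G (W x))" for x by (rule arg_cong[OF 2])
    then show "\<forall>x. (W o\<^sub>L G) x = W x + (r - l) *\<^sub>C (W o\<^sub>L G) (W x)"
      by (metis blinfun_apply_blinfun_compose blinfun.add_right bounded_opsD[OF W])
  qed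
qed

text \<open>The situation reached after the strict inequality, with \<open>r\<close> the real
  spectral bound of \<open>A + K\<close> and \<open>b\<close> the number \<open>l\<^sub>1\<close>.
  The decisive asymmetry is that \<open>rA\<close> includes the endpoint \<open>r\<close>, whereas
  \<open>rB\<close> stops short of it.\<close>

locale compact_perturbation =
  fixes u :: "'a::banach_lattice cpx" and D A K and r b :: real
  assumes u: "quasi_interior u" "0 < u"
    and A: "linear_operator D A"
    and K: "K \<in> bounded_ops" "relatively_compact_op D A K"
    and rb: "r < b"
    and rA: "\<And>t. r \<le> t \<Longrightarrow> t < b \<Longrightarrow> complex_of_real t \<in> resolvent_set D A"
    and rB: "\<And>t. r < t \<Longrightarrow> t < b \<Longrightarrow> complex_of_real t \<in> resolvent_set D (op_add A K)"
    and strong: "\<And>t. r < t \<Longrightarrow> t < b \<Longrightarrow> op_strongly_pos u (resolvent D (op_add A K) (complex_of_real t))"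
    and spec: "complex_of_real r \<in> spectrum D (op_add A K)"
begin

abbreviation R :: "real \<Rightarrow> 'a cpx \<Rightarrow>\<^sub>L 'a cpx" where
  "R t \<equiv> resolvent D A (complex_of_real t)"

abbreviation S :: "real \<Rightarrow> 'a cpx \<Rightarrow>\<^sub>L 'a cpx" where
  "S t \<equiv> resolvent D (op_add A K) (complex_of_real t)"

lemma B: "linear_operator D (op_add A K)"
  by (rule linear_operator_op_add[OF A K(1)])

lemma R: "r \<le> t \<Longrightarrow> t < b \<Longrightarrow> is_resolvent D A (complex_of_real t) (R t)"
  by (rule is_resolvent_resolvent[OF A rA])

lemma S: "r < t \<Longrightarrow> t < b \<Longrightarrow> is_resolvent D (op_add A K) (complex_of_real t) (S t)"
  by (rule is_resolvent_resolvent[OF B rB])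

lemma S_bounded_ops: "r < t \<Longrightarrow> t < b \<Longrightarrow> S t \<in> bounded_ops"
  using S is_resolventD(3) by blast

lemma S_positive: "r < t \<Longrightarrow> t < b \<Longrightarrow> positive_op (S t)"
  using op_strongly_pos_imp_positive[OF less_imp_le[OF u(2)] strong] .

lemma S_eq_left: "r < t \<Longrightarrow> t < b \<Longrightarrow> S t x = R t (x + K (S t x))"
  unfolding blinfun.add_right by (rule is_resolvent_perturb_eq(1)[OF R S]) auto

lemma S_eq_right: "r < t \<Longrightarrow> t < b \<Longrightarrow> S t x = R t x + S t (K (R t x))"
  by (rule is_resolvent_perturb_eq(2)[OF R S]) auto

lemma S_identity:
  assumes "r < t" "t < b" "r < t'" "t' < b"
  shows "S t x = S t' x + (t' - t) *\<^sub>R S t' (S t x)"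
  by (rule resolvent_identity_real[OF B rB rB]) (use assms in auto)

lemma S_commute:
  assumes "r < t" "t < b" "r < t'" "t' < b"
  shows "S t (S t' x) = S t' (S t x)"
proof (cases "t = t'")
  case False
  have "(t' - t) *\<^sub>R S t' (S t x) = S t x - S t' x"
    using S_identity[OF assms, of x] by (metis add_diff_cancel_left')
  also have "\<dots> = - ((t - t') *\<^sub>R S t (S t' x))"
    using S_identity[OF assms(3,4,1,2), of x] by (metis add_diff_cancel_left' minus_diff_eq)
  also have "\<dots> = (t' - t) *\<^sub>R S t (S t' x)" by (simp flip: scaleR_minus_left)
  finally have "(t' - t) *\<^sub>R S t' (S t x) = (t' - t) *\<^sub>R S t (S t' x)" .
  with False show ?thesis by simp
qed simp

lemma LIMSEQ_R:
  assumes "l \<longlonglongrightarrow> r" shows "(\<lambda>n. R (l n)) \<longlonglongrightarrow> R r"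
  by (rule LIMSEQ_resolvent[OF A rA assms]) (use rb in auto)

text \<open>Compactness is known for the fixed operator \<open>K R(r)\<close>; norm convergence of
  \<open>R (l n)\<close> to \<open>R r\<close> makes the error of replacing one by the other a null
  sequence.\<close>

lemma KR_subsequence:
  assumes l: "l \<longlonglongrightarrow> r" and f: "\<And>n. norm (f n) \<le> C"
  obtains h y where "strict_mono (h :: nat \<Rightarrow> nat)" "(\<lambda>n. K (R (l (h n)) (f (h n)))) \<longlonglongrightarrow> y"
proof -
  have "complex_of_real r \<in> resolvent_set D A" using rA rb by simp
  then obtain y h
    where h: "strict_mono (h :: nat \<Rightarrow> nat)" and y: "(\<lambda>n. K (R r (f (h n)))) \<longlonglongrightarrow> y"
    by (rule relatively_compact_subsequence[OF A K _ f])
  have "(\<lambda>n. norm (R (l (h n)) - R r)) \<longlonglongrightarrow> 0"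
    using LIMSEQ_subseq_LIMSEQ[OF LIMSEQ_R[OF l] h]
    by (simp add: o_def tendsto_norm_zero LIM_zero)
  from tendsto_mult_right[OF this, of C]
  have "(\<lambda>n. norm (R (l (h n)) - R r) * C) \<longlonglongrightarrow> 0" by simp
  then have "(\<lambda>n. (R (l (h n)) - R r) (f (h n))) \<longlonglongrightarrow> 0"
    by (rule Lim_null_comparison[rotated])
      (intro always_eventually allI order_trans[OF norm_blinfun] mult_left_mono f norm_ge_zero)
  then have "(\<lambda>n. K (R r (f (h n))) + K ((R (l (h n)) - R r) (f (h n)))) \<longlonglongrightarrow> y + K 0"
    by (intro tendsto_add y blinfun.tendsto tendsto_const)
  then have "(\<lambda>n. K (R (l (h n)) (f (h n)))) \<longlonglongrightarrow> y"
    by (simp add: blinfun.diff_left blinfun.diff_right)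
  with h that show ?thesis by blast
qed

text \<open>The compactness principle behind all later limits. Since
  \<open>y n = S (l n) (g n)\<close> satisfies \<open>y n = R (l n) (g n + K (y n))\<close>, a
  convergent subsequence of \<open>K (y n)\<close> forces one of \<open>y n\<close>. The limit is an
  eigenvector of \<open>A + K\<close> for \<open>r\<close> or zero; writing this as
  \<open>(t - r) S(t) y = y\<close> avoids all questions of domain.\<close>

lemma S_subsequence:
  assumes l: "l \<longlonglongrightarrow> r" "\<And>n. r < l n" "\<And>n. l n < b"
    and g: "g \<longlonglongrightarrow> 0" and C: "\<And>n. norm (S (l n) (g n)) \<le> C"
  obtains h y where "strict_mono (h :: nat \<Rightarrow> nat)" "(\<lambda>n. S (l (h n)) (g (h n))) \<longlonglongrightarrow> y"
    "\<forall>t. r < t \<and> t < b \<longrightarrow> (t - r) *\<^sub>R S t y = y"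
proof -
  define y where "y n = S (l n) (g n)" for n
  obtain c where c: "\<And>n. norm (g n) \<le> c"
    using convergent_imp_Bseq[OF convergentI[OF g]] by (metis BseqE)
  have "norm (g n + K (y n)) \<le> c + norm K * C" for n
    by (intro order_trans[OF norm_triangle_ineq] add_mono c
        order_trans[OF norm_blinfun] mult_left_mono) (simp_all add: y_def C)
  then obtain h k where h: "strict_mono (h :: nat \<Rightarrow> nat)"
    and k: "(\<lambda>n. K (R (l (h n)) (g (h n) + K (y (h n))))) \<longlonglongrightarrow> k"
    by (rule KR_subsequence[OF l(1)])
  have y: "y n = R (l n) (g n + K (y n))" for n
    unfolding y_def by (rule S_eq_left[OF l(2,3)])
  have k: "(\<lambda>n. K (y (h n))) \<longlonglongrightarrow> k" using k y by simp
  have gh: "(\<lambda>n. g (h n)) \<longlonglongrightarrow> 0" using LIMSEQ_subseq_LIMSEQ[OF g h] by (simp add: o_def)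
  have lh: "(\<lambda>n. l (h n)) \<longlonglongrightarrow> r" using LIMSEQ_subseq_LIMSEQ[OF l(1) h] by (simp add: o_def)
  have "(\<lambda>n. R (l (h n)) (g (h n) + K (y (h n)))) \<longlonglongrightarrow> R r (0 + k)"
    by (intro blinfun.tendsto tendsto_add LIMSEQ_R lh gh k)
  then obtain z where z: "(\<lambda>n. y (h n)) \<longlonglongrightarrow> z" using y by simp
  have "\<forall>t. r < t \<and> t < b \<longrightarrow> (t - r) *\<^sub>R S t z = z"
  proof (intro allI impI)
    fix t assume t: "r < t \<and> t < b"
    \<comment> \<open>The resolvent identity between \<open>t\<close> and \<open>l (h n)\<close>,
      whose inhomogeneous term \<open>S t (g (h n))\<close> disappears in the limit.\<close>
    have "(\<lambda>n. S t (g (h n)) + (t - l (h n)) *\<^sub>R S t (y (h n))) \<longlonglongrightarrow> S t 0 + (t - r) *\<^sub>R S t z"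
      by (intro tendsto_intros gh lh z)
    moreover have "S t (g n) + (t - l n) *\<^sub>R S t (y n) = y n" for n
      unfolding y_def by (rule S_identity[symmetric]) (use l t in auto)
    ultimately have "(\<lambda>n. y (h n)) \<longlonglongrightarrow> (t - r) *\<^sub>R S t z" by (simp add: blinfun.zero_right)
    from LIMSEQ_unique[OF this z] show "(t - r) *\<^sub>R S t z = z" .
  qed
  with h z show ?thesis unfolding y_def by (rule that)
qed

lemma S_unbounded:
  assumes "0 < d" shows "\<exists>t. r < t \<and> t < r + d \<and> t < b \<and> C < norm (S t)"
proof (rule ccontr)
  assume *: "\<not> ?thesis"
  define e where "e = min d (b - r)"
  have e: "0 < e" "e \<le> d" "e \<le> b - r" using assms rb by (auto simp: e_def)
  \<comment> \<open>The shift by two keeps the factor strictly below one, so that \<open>l n\<close>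
    stays below \<open>r + e\<close> from \<open>n = 0\<close> on.\<close>
  define l where "l n = r + e * inverse (real (Suc (Suc n)))" for n
  have inv: "inverse (real (Suc (Suc n))) < 1" for n by (simp add: field_simps)
  have lt: "r < l n" "l n < r + e" for n
    using e inv[of n] by (auto simp: l_def simp del: of_nat_Suc)
  have "l \<longlonglongrightarrow> r + e * 0"
    unfolding l_def by (intro tendsto_intros LIMSEQ_Suc[OF LIMSEQ_inverse_real_of_nat])
  then have "(\<lambda>n. complex_of_real (l n)) \<longlonglongrightarrow> complex_of_real r" by (simp add: tendsto_of_real)
  moreover have "complex_of_real (l n) \<in> resolvent_set D (op_add A K)" for n
    using rB lt[of n] e by simp
  moreover have "norm (S (l n)) \<le> C" for n
  proof -
    have "l n < r + d" "l n < b" using lt[of n] e by auto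
    with * lt(1)[of n] show ?thesis by (meson not_le)
  qed
  ultimately have "complex_of_real r \<in> resolvent_set D (op_add A K)"
    by (rule LIMSEQ_resolvent_bounded[OF B])
  with spec show False by (simp add: spectrum_def)
qed

text \<open>An argument of Krein-Rutman type: \<open>S\<close> is unbounded near \<open>r\<close>,
  the blow-up can be witnessed by positive vectors, and the normalised images converge along a
  subsequence. The limit keeps norm one and positivity.\<close>

lemma eigenvector:
  obtains w where "0 \<le> w" "norm w = 1" "\<forall>t. r < t \<and> t < b \<longrightarrow> (t - r) *\<^sub>R S t w = w"
proof -
  obtain l where l: "l \<longlonglongrightarrow> r" and lk: "\<forall>k. r < l k \<and> l k < b \<and> real k < norm (S (l k))"
    by (rule right_sequence[OF rb, of "\<lambda>C t. C < norm (S t)"]) (use S_unbounded in blast)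
  note lk = lk[rule_format]
  have "\<exists>x. 0 \<le> x \<and> real k * norm x < norm (S (l k) x)" for k
  proof -
    obtain x where x: "real k * norm x < norm (S (l k) x)"
      by (rule norm_gt_obtain_vector[of "real k" "S (l k)"]) (use lk in auto)
    then have "real k * norm (of_re (modulus x)) < norm (S (l k) (of_re (modulus x)))"
      using norm_positive_op_le[OF S_bounded_ops S_positive, of "l k" x] lk[of k]
      by (simp add: norm_of_re_modulus)
    with nonneg_of_re_modulus show ?thesis by blast
  qed
  then obtain x where x: "\<And>k. 0 \<le> x k" "\<And>k. real k * norm (x k) < norm (S (l k) (x k))" by metis
  define a where "a k = norm (S (l k) (x k))" for k
  have a: "0 < a k" for k
    using le_less_trans[OF _ x(2)[of k], of 0] by (simp add: a_def)
  have g: "(\<lambda>k. x k /\<^sub>R a k) \<longlonglongrightarrow> 0" unfolding a_def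
    by (rule LIMSEQ_normalized_zero) (use x(2) a in \<open>auto simp: a_def less_imp_le\<close>)
  have 1: "norm (S (l k) (x k /\<^sub>R a k)) = 1" for k
    using a[of k] by (simp add: blinfun.scaleR_right a_def)
  then have le: "norm (S (l k) (x k /\<^sub>R a k)) \<le> 1" for k by simp
  obtain h y where h: "strict_mono (h :: nat \<Rightarrow> nat)"
    and y: "(\<lambda>n. S (l (h n)) (x (h n) /\<^sub>R a (h n))) \<longlonglongrightarrow> y"
    and ev: "\<forall>t. r < t \<and> t < b \<longrightarrow> (t - r) *\<^sub>R S t y = y"
    by (rule S_subsequence[OF l _ _ g le]) (use lk in blast)+
  have "0 \<le> y"
  proof (rule LIMSEQ_nonneg_cpx[OF y])
    show "0 \<le> S (l (h n)) (x (h n) /\<^sub>R a (h n))" for n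
      by (intro positive_opD[OF S_positive] scaleR_nonneg_nonneg x) (use lk a[of "h n"] in auto)
  qed
  moreover have "norm y = 1"
    using LIMSEQ_unique[OF tendsto_norm[OF y]] by (simp add: 1)
  ultimately show ?thesis using ev that by blast
qed

text \<open>If \<open>J(t) = (t - r) S(t)\<close> were unbounded, then \<open>J(t) / \<parallel>J(t)\<parallel>\<close> would tend to zero
  strongly, since it does so at the eigenvector and therefore on the dense ideal generated
  by it. Because of \<open>S = R + S K R\<close> and the compactness of \<open>K R\<close> the convergence would even
  be uniform on the unit ball.\<close>

lemma S_order_one:
  obtains c C where "r < c" "c \<le> b" "\<forall>t. r < t \<and> t < c \<longrightarrow> norm ((t - r) *\<^sub>R S t) \<le> C"
proof (rule ccontr)
  note main = that
  assume neg: "\<not> thesis"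
  let ?J = "\<lambda>t. (t - r) *\<^sub>R S t"
  obtain w where w: "0 \<le> w" "norm w = 1" and ev: "\<forall>t. r < t \<and> t < b \<longrightarrow> (t - r) *\<^sub>R S t w = w"
    by (rule eigenvector)
  \<comment> \<open>Strong positivity applied to the eigenvector itself, as
    \<open>w = (t - r) S(t) w\<close>; the midpoint is just one admissible \<open>t\<close>.\<close>
  obtain e where e: "0 < e" "e *\<^sub>R u \<le> w"
  proof -
    define t where "t = (r + b) / 2"
    have t: "r < t" "t < b" using rb by (auto simp: t_def)
    have "0 < w" using w by (auto simp: less_le)
    then obtain e where "0 < e" "e *\<^sub>R u \<le> S t w"
      using strong[OF t] by (auto simp: op_strongly_pos_def vec_strongly_pos_def)
    moreover then have "(t - r) *\<^sub>R e *\<^sub>R u \<le> (t - r) *\<^sub>R S t w"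
      using t by (intro scaleR_left_mono) auto
    ultimately show ?thesis using that[of "(t - r) * e"] t ev by simp
  qed
  have ex: "\<exists>t. r < t \<and> t < r + d \<and> t < b \<and> C < norm (?J t)" if "0 < d" for d C
  proof (rule ccontr)
    assume "\<not> ?thesis"
    then have "norm (?J t) \<le> C" if "r < t" "t < min (r + d) b" for t
      using that by (meson not_le min_less_iff_conj)
    with main[of "min (r + d) b" C] neg that rb show False by simp
  qed
  obtain l where l: "l \<longlonglongrightarrow> r" and lk: "\<forall>k. r < l k \<and> l k < b \<and> real k < norm (?J (l k))"
    by (rule right_sequence[OF rb, of "\<lambda>C t. C < norm (?J t)"]) (use ex in blast)
  note lk = lk[rule_format]
  define T where "T k = ?J (l k) /\<^sub>R norm (?J (l k))" for k
  define N where "N k = norm (?J (l k))" for k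
  have N: "0 < N k" "real k < N k" for k
    using lk[of k] le_less_trans[OF of_nat_0_le_iff, of k "N k"] by (auto simp: N_def)
  have T: "T k = inverse (N k) *\<^sub>R ?J (l k)" for k by (simp add: T_def N_def)
  have Tb: "T k \<in> bounded_ops" "positive_op (T k)" for k
    using lk[of k] N(1)[of k] unfolding T
    by (auto intro!: positive_op_scaleR S_positive S_bounded_ops bounded_ops_scaleR)
  have "norm (X /\<^sub>R norm X) = 1" if "0 < norm X" for X :: "'a cpx \<Rightarrow>\<^sub>L 'a cpx"
    using that by simp
  then have T1: "norm (T k) = 1" for k using N(1)[of k] by (simp only: T_def N_def)
  have invN: "(\<lambda>k. inverse (N k)) \<longlonglongrightarrow> 0"
  proof (rule Lim_null_comparison[OF _ lim_inverse_n])
    have "norm (inverse (N n)) \<le> inverse (real n)" if "n > 0" for n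
      using N[of n] that by (simp add: le_imp_inverse_le less_imp_le)
    then show "eventually (\<lambda>n. norm (inverse (N n)) \<le> inverse (real n)) sequentially"
      by (auto simp: eventually_sequentially intro!: exI[of _ 1])
  qed
  have Tw: "T k w = inverse (N k) *\<^sub>R w" for k
    using ev[rule_format, of "l k"] lk[of k] by (simp only: T blinfun.scaleR_left)
  have "(\<lambda>k. T k x) \<longlonglongrightarrow> 0" if x: "x \<in> principal_ideal u" for x
  proof -
    obtain c where c: "0 \<le> c" "of_re (modulus x) \<le> c *\<^sub>R u"
      using x by (auto simp: principal_ideal_def)
    have "(c / e) *\<^sub>R (e *\<^sub>R u) \<le> (c / e) *\<^sub>R w"
      using c e by (intro scaleR_left_mono) auto
    moreover have "(c / e) *\<^sub>R (e *\<^sub>R u) = c *\<^sub>R u" using e by simp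
    ultimately have "of_re (modulus x) \<le> (c / e) *\<^sub>R w" using c(2) by (metis order_trans)
    have "norm (T k x) \<le> (c / e) * inverse (N k)" for k
      using norm_positive_op_principal_ideal[OF Tb \<open>of_re (modulus x) \<le> (c / e) *\<^sub>R w\<close>, of k]
        c e w(2) N(1)[of k] by (simp add: blinfun.scaleR_right Tw abs_mult)
    moreover have "(\<lambda>k. (c / e) * inverse (N k)) \<longlonglongrightarrow> 0"
      using tendsto_mult_left[OF invN, of "c / e"] by simp
    ultimately show ?thesis by (intro Lim_null_comparison[of "\<lambda>k. T k x"] always_eventually allI)
  qed
  then have T0: "(\<lambda>k. T k x) \<longlonglongrightarrow> 0" for x
    by (rule LIMSEQ_zero_on_dense[of T 1 "principal_ideal u", rotated 2])
      (use T1 u in \<open>auto simp: quasi_interior_def\<close>)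
  have "\<exists>f. norm f = 1 \<and> 1 / 2 < norm (T k f)" for k
  proof -
    obtain f where f: "1 / 2 * norm f < norm (T k f)"
      by (rule norm_gt_obtain_vector[of "1/2" "T k"]) (simp_all add: T1)
    then have "f \<noteq> 0" by (auto simp: blinfun.zero_right)
    then have "norm (f /\<^sub>R norm f) = 1" "1 / 2 < norm (T k (f /\<^sub>R norm f))"
      using f by (auto simp: blinfun.scaleR_right field_simps)
    then show ?thesis by blast
  qed
  then obtain f where f: "\<And>k. norm (f k) = 1" "\<And>k. 1 / 2 < norm (T k (f k))" by metis
  then have "norm (f k) \<le> 1" for k by simp
  then obtain h g where h: "strict_mono (h :: nat \<Rightarrow> nat)"
    and g: "(\<lambda>n. K (R (l (h n)) (f (h n)))) \<longlonglongrightarrow> g"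
    by (rule KR_subsequence[OF l])
  \<comment> \<open>Each of the three terms tends to zero: the first by its scalar factor, the
    second because \<open>K R f\<close> approaches \<open>g\<close> while \<open>T k\<close> has
    norm one, the third by strong convergence at the fixed vector \<open>g\<close>. Yet
    \<open>f\<close> was chosen with images of norm above \<open>1/2\<close>.\<close>
  have Tf: "T k (f k) = (inverse (N k) * (l k - r)) *\<^sub>R R (l k) (f k)
      + (T k (K (R (l k) (f k)) - g) + T k g)" for k
  proof -
    have TS: "T k z = (inverse (N k) * (l k - r)) *\<^sub>R S (l k) z" for z
      by (simp only: T blinfun.scaleR_left scaleR_scaleR)
    have "S (l k) (f k) = R (l k) (f k) + S (l k) (K (R (l k) (f k)))"
      by (rule S_eq_right) (use lk in auto)
    then have "T k (f k) = (inverse (N k) * (l k - r)) *\<^sub>R R (l k) (f k) + T k (K (R (l k) (f k)))"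
      by (simp only: TS scaleR_add_right)
    then show ?thesis by (simp add: blinfun.diff_right)
  qed
  have lh: "(\<lambda>n. l (h n)) \<longlonglongrightarrow> r" using LIMSEQ_subseq_LIMSEQ[OF l h] by (simp add: o_def)
  obtain C where C: "\<And>n. norm (R (l n)) \<le> C"
    using convergent_imp_Bseq[OF convergentI[OF LIMSEQ_R[OF l]]] by (metis BseqE)
  have 1: "(\<lambda>n. (inverse (N (h n)) * (l (h n) - r)) *\<^sub>R R (l (h n)) (f (h n))) \<longlonglongrightarrow> 0"
  proof (rule Lim_null_comparison)
    have "norm (R (l (h n)) (f (h n))) \<le> C" for n
      using order_trans[OF norm_blinfun C[of "h n", THEN mult_right_mono], of "f (h n)"] f(1) by simp
    then show "eventually (\<lambda>n. norm ((inverse (N (h n)) * (l (h n) - r)) *\<^sub>R R (l (h n)) (f (h n)))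
        \<le> \<bar>inverse (N (h n)) * (l (h n) - r)\<bar> * C) sequentially"
      by (intro always_eventually allI) (simp add: mult_left_mono del: abs_mult)
    have "(\<lambda>n. \<bar>inverse (N (h n)) * (l (h n) - r)\<bar> * C) \<longlonglongrightarrow> \<bar>0 * (r - r)\<bar> * C"
      by (intro tendsto_intros lh LIMSEQ_subseq_LIMSEQ[OF invN h, unfolded o_def])
    then show "(\<lambda>n. \<bar>inverse (N (h n)) * (l (h n) - r)\<bar> * C) \<longlonglongrightarrow> 0" by simp
  qed
  have 2: "(\<lambda>n. T (h n) (K (R (l (h n)) (f (h n))) - g)) \<longlonglongrightarrow> 0"
  proof (rule Lim_null_comparison)
    show "eventually (\<lambda>n. norm (T (h n) (K (R (l (h n)) (f (h n))) - g))
        \<le> norm (K (R (l (h n)) (f (h n))) - g)) sequentially"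
      using norm_blinfun[of "T _"] by (intro always_eventually allI) (simp add: T1)
    show "(\<lambda>n. norm (K (R (l (h n)) (f (h n))) - g)) \<longlonglongrightarrow> 0"
      using g by (simp add: tendsto_norm_zero LIM_zero)
  qed
  have 3: "(\<lambda>n. T (h n) g) \<longlonglongrightarrow> 0"
    using LIMSEQ_subseq_LIMSEQ[OF T0 h, unfolded o_def] .
  have "(\<lambda>n. T (h n) (f (h n))) \<longlonglongrightarrow> 0"
    unfolding Tf using tendsto_add[OF 1 tendsto_add[OF 2 3]] by simp
  from LIMSEQ_D[OF this, of "1/2"] obtain n where "norm (T (h n) (f (h n))) < 1 / 2" by auto
  with f(2)[of "h n"] show False by simp
qed

text \<open>A mean ergodic argument for \<open>J k = (l k - r) S (l k)\<close>: compactness gives a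
  limit point of \<open>J k x\<close> fixed by every \<open>J i\<close>, and boundedness of the
  \<open>J k\<close> upgrades it to a limit of the whole sequence. \<open>P\<close> is nonzero since
  it fixes the eigenvector.\<close>

lemma spectral_projection:
  obtains P where "P \<in> bounded_ops" "P \<noteq> 0"
    "\<forall>t x. r < t \<and> t < b \<longrightarrow> (t - r) *\<^sub>R S t (P x) = P x \<and> (t - r) *\<^sub>R P (S t x) = P x"
    "\<forall>y. (\<forall>t. r < t \<and> t < b \<longrightarrow> (t - r) *\<^sub>R S t y = y) \<longrightarrow> P y = y"
proof -
  obtain c C where c: "r < c" "c \<le> b" and C: "\<forall>t. r < t \<and> t < c \<longrightarrow> norm ((t - r) *\<^sub>R S t) \<le> C"
    by (rule S_order_one)
  obtain l where l: "l \<longlonglongrightarrow> r" and lk: "\<forall>k. r < l k \<and> l k < c \<and> True"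
  proof (rule right_sequence[OF c(1), of "\<lambda>_ _. True"])
    fix d :: real assume "0 < d"
    then show "\<exists>t>r. t < r + d \<and> True" by (intro exI[of _ "r + d / 2"]) auto
  qed
  have l1: "r < l k" "l k < c" "l k < b" for k
    using lk[rule_format, of k] c by auto
  define J where "J k = (l k - r) *\<^sub>R S (l k)" for k
  have Jb: "J k \<in> bounded_ops" and JC: "norm (J k) \<le> C" for k
    using l1[of k] C S_bounded_ops by (auto simp: J_def)
  have J_fix: "J k y = y" if "\<forall>t. r < t \<and> t < b \<longrightarrow> (t - r) *\<^sub>R S t y = y" for y k
    using that l1[of k] by (simp add: J_def blinfun.scaleR_left)
  have lr: "(\<lambda>k. l k - r) \<longlonglongrightarrow> 0" using l by (simp add: LIM_zero)
  have C0: "0 \<le> C" using JC[of 0] norm_ge_zero order_trans by blast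
  \<comment> \<open>This shows that \<open>J i\<close> tends to zero, as \<open>i\<close> grows, on
    all vectors of the form \<open>x - J j x\<close>, because of the factor
    \<open>l i - r\<close>.\<close>
  have J_diff: "J i (x - J j x) = (l i - r) *\<^sub>R (S (l j) x - J i (S (l j) x))" for i j x
  proof -
    have "S (l i) x = S (l j) x + (l j - l i) *\<^sub>R S (l i) (S (l j) x)"
      using S_identity[of "l i" "l j" x] S_commute[of "l i" "l j" x] l1 by simp
    then have "S (l i) x - (l j - r) *\<^sub>R S (l i) (S (l j) x)
        = S (l j) x + ((l j - l i) *\<^sub>R S (l i) (S (l j) x) - (l j - r) *\<^sub>R S (l i) (S (l j) x))"
      by (simp only: add_diff_eq)
    also have "\<dots> = S (l j) x - (l i - r) *\<^sub>R S (l i) (S (l j) x)"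
      by (simp add: algebra_simps)
    finally have "(l i - r) *\<^sub>R (S (l i) x - (l j - r) *\<^sub>R S (l i) (S (l j) x))
        = (l i - r) *\<^sub>R (S (l j) x - (l i - r) *\<^sub>R S (l i) (S (l j) x))" by (rule arg_cong)
    then show ?thesis
      by (simp only: J_def blinfun.scaleR_left blinfun.diff_right blinfun.scaleR_right
          scaleR_left_commute scaleR_diff_right)
  qed
  have conv: "\<exists>y. (\<lambda>k. J k x) \<longlonglongrightarrow> y \<and> (\<forall>t. r < t \<and> t < b \<longrightarrow> (t - r) *\<^sub>R S t y = y)" for x
  proof -
    have g: "(\<lambda>k. (l k - r) *\<^sub>R x) \<longlonglongrightarrow> 0"
      using tendsto_scaleR[OF lr tendsto_const[of x]] by simp
    \<comment> \<open>Moving the scalar inside turns \<open>J k x\<close> into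
      \<open>S (l k)\<close> applied to a null sequence, the form required by
      \<open>S_subsequence\<close>.\<close>
    have Jx: "S (l k) ((l k - r) *\<^sub>R x) = J k x" for k
      by (simp add: J_def blinfun.scaleR_left blinfun.scaleR_right)
    have bd: "norm (S (l k) ((l k - r) *\<^sub>R x)) \<le> C * norm x" for k
      unfolding Jx by (rule order_trans[OF norm_blinfun mult_right_mono[OF JC]]) simp
    obtain h y where h: "strict_mono (h :: nat \<Rightarrow> nat)"
      and y: "(\<lambda>n. S (l (h n)) ((l (h n) - r) *\<^sub>R x)) \<longlonglongrightarrow> y"
      and ev: "\<forall>t. r < t \<and> t < b \<longrightarrow> (t - r) *\<^sub>R S t y = y"
      by (rule S_subsequence[OF l l1(1,3) g bd])
    have y: "(\<lambda>n. J (h n) x) \<longlonglongrightarrow> y" using y by (simp only: Jx)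
    have "(\<lambda>i. J i x) \<longlonglongrightarrow> y"
    proof (rule LIMSEQ_I)
      fix e :: real assume "0 < e"
      then have "0 < e / (2 * (C + 1))" using C0 by simp
      from LIMSEQ_D[OF y this] obtain n where n: "norm (J (h n) x - y) < e / (2 * (C + 1))" by blast
      define z where "z = S (l (h n)) x"
      have "norm (J i (x - J (h n) x)) \<le> \<bar>l i - r\<bar> * ((1 + C) * norm z)" for i
      proof -
        have "norm (z - J i z) \<le> norm z + C * norm z"
          by (intro order_trans[OF norm_triangle_ineq4] add_mono order_refl
              order_trans[OF norm_blinfun mult_right_mono[OF JC]]) simp
        then have "norm (z - J i z) \<le> (1 + C) * norm z" by (simp add: algebra_simps)
        then show ?thesis unfolding J_diff z_def[symmetric] norm_scaleR
          by (rule mult_left_mono) simp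
      qed
      moreover have "(\<lambda>i. \<bar>l i - r\<bar> * ((1 + C) * norm z)) \<longlonglongrightarrow> 0"
        using tendsto_mult_right[OF tendsto_rabs_zero[OF lr]] by simp
      ultimately have "(\<lambda>i. J i (x - J (h n) x)) \<longlonglongrightarrow> 0"
        by (intro Lim_null_comparison[of "\<lambda>i. J i (x - J (h n) x)"] always_eventually allI)
      from LIMSEQ_D[OF this, of "e / 2"] \<open>0 < e\<close> obtain N
        where N: "\<And>i. i \<ge> N \<Longrightarrow> norm (J i (x - J (h n) x)) < e / 2" by auto
      show "\<exists>N. \<forall>i\<ge>N. norm (J i x - y) < e"
      proof (intro exI allI impI)
        fix i assume "i \<ge> N"
        have "norm (J i (J (h n) x - y)) \<le> (C + 1) * (e / (2 * (C + 1)))"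
          by (rule order_trans[OF norm_blinfun], rule mult_mono)
            (use JC[of i] n C0 in auto)
        also have "\<dots> = e / 2" using C0 by (simp add: field_simps)
        finally have "norm (J i (J (h n) x - y)) \<le> e / 2" .
        moreover have "J i x - y = J i (x - J (h n) x) + J i (J (h n) x - y)"
          using J_fix[OF ev, of i] by (simp add: blinfun.diff_right)
        ultimately show "norm (J i x - y) < e"
          using norm_triangle_ineq[of "J i (x - J (h n) x)" "J i (J (h n) x - y)"] N[OF \<open>i \<ge> N\<close>]
          by simp
      qed
    qed
    with ev show ?thesis by blast
  qed
  have "convergent (\<lambda>k. J k x)" for x
    using conv[of x] by (auto intro: convergentI)
  then obtain P where P: "P \<in> bounded_ops" "\<forall>x. (\<lambda>k. J k x) \<longlonglongrightarrow> P x"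
    by (rule bounded_ops_pointwise_limit[OF Jb JC])
  note P = P(1) P(2)[rule_format]
  have Pfix: "P y = y" if "\<forall>t. r < t \<and> t < b \<longrightarrow> (t - r) *\<^sub>R S t y = y" for y
    using LIMSEQ_unique[OF P(2)[of y]] J_fix[OF that] by simp
  have P1: "(t - r) *\<^sub>R S t (P x) = P x" if t: "r < t" "t < b" for t x
  proof -
    obtain y where "(\<lambda>k. J k x) \<longlonglongrightarrow> y" "(t - r) *\<^sub>R S t y = y" using conv[of x] t by blast
    then show ?thesis using LIMSEQ_unique[OF P(2)] by metis
  qed
  have P2: "(t - r) *\<^sub>R P (S t x) = P x" if t: "r < t" "t < b" for t x
  proof -
    have "J k (S t x) = S t (J k x)" for k
      using S_commute[of "l k" t x] l1[of k] t by (simp add: J_def blinfun.scaleR_left blinfun.scaleR_right)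
    then have "(\<lambda>k. J k (S t x)) \<longlonglongrightarrow> S t (P x)"
      using blinfun.tendsto[OF tendsto_const P(2)] by simp
    from LIMSEQ_unique[OF P(2) this] P1[OF t, of x] show ?thesis by simp
  qed
  obtain w where w: "norm w = 1" "\<forall>t. r < t \<and> t < b \<longrightarrow> (t - r) *\<^sub>R S t w = w"
    using eigenvector by metis
  have "P w = w" by (rule Pfix[OF w(2)])
  with w(1) have "P \<noteq> 0" by auto
  with P(1) show ?thesis
  proof (rule that)
    show "\<forall>t x. r < t \<and> t < b \<longrightarrow> (t - r) *\<^sub>R S t (P x) = P x \<and> (t - r) *\<^sub>R P (S t x) = P x"
      using P1 P2 by blast
    show "\<forall>y. (\<forall>t. r < t \<and> t < b \<longrightarrow> (t - r) *\<^sub>R S t y = y) \<longrightarrow> P y = y"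
      using Pfix by blast
  qed
qed

text \<open>Blow-up on the kernel of \<open>P\<close> would produce an eigenvector of norm one in
  that kernel, although \<open>P\<close> fixes all eigenvectors.\<close>

lemma complementary_resolvent_bounded:
  assumes P: "P \<in> bounded_ops"
    and PS: "\<forall>t x. r < t \<and> t < b \<longrightarrow> (t - r) *\<^sub>R S t (P x) = P x \<and> (t - r) *\<^sub>R P (S t x) = P x"
    and Pfix: "\<forall>y. (\<forall>t. r < t \<and> t < b \<longrightarrow> (t - r) *\<^sub>R S t y = y) \<longrightarrow> P y = y"
  shows "\<exists>c C. r < c \<and> c \<le> b \<and> 0 \<le> C \<and> (\<forall>t. r < t \<and> t < c \<longrightarrow> norm (S t o\<^sub>L (id_blinfun - P)) \<le> C)"
proof (rule ccontr)
  assume neg: "\<not> ?thesis"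
  let ?V = "\<lambda>t. S t o\<^sub>L (id_blinfun - P)"
  have PP: "P (P x) = P x" for x using Pfix PS by blast
  have ex: "\<exists>t. r < t \<and> t < r + d \<and> t < b \<and> C < norm (?V t)" if "0 < d" for d C
  proof (rule ccontr)
    assume "\<not> ?thesis"
    then have "\<forall>t. r < t \<and> t < min (r + d) b \<longrightarrow> norm (?V t) \<le> max C 0"
      by (meson le_max_iff_disj not_le min_less_iff_conj)
    moreover have "r < min (r + d) b" using that rb by simp
    ultimately show False using neg by (meson max.cobounded2 min.cobounded2)
  qed
  obtain l where l: "l \<longlonglongrightarrow> r" and lk: "\<forall>k. r < l k \<and> l k < b \<and> real k < norm (?V (l k))"
    by (rule right_sequence[OF rb, of "\<lambda>C t. C < norm (?V t)"]) (use ex in blast)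
  note lk = lk[rule_format]
  have "\<exists>x. real k * norm x < norm (?V (l k) x)" for k
    using norm_gt_obtain_vector[of "real k" "?V (l k)"] lk[of k] by (metis of_nat_0_le_iff)
  then obtain x where x: "\<And>k. real k * norm (x k) < norm (?V (l k) (x k))" by metis
  define a where "a k = norm (?V (l k) (x k))" for k
  have a: "0 < a k" for k
    using le_less_trans[OF _ x[of k], of 0] by (simp add: a_def)
  have x0: "(\<lambda>k. x k /\<^sub>R a k) \<longlonglongrightarrow> 0" unfolding a_def
    by (rule LIMSEQ_normalized_zero) (use x a in \<open>auto simp: a_def less_imp_le simp del: blinfun_apply_blinfun_compose\<close>)
  define g where "g k = x k /\<^sub>R a k - P (x k /\<^sub>R a k)" for k
  have "g \<longlonglongrightarrow> 0 - P 0" unfolding g_def by (intro tendsto_intros x0)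
  then have g: "g \<longlonglongrightarrow> 0" by (simp add: blinfun.zero_right)
  have Sg: "norm (S (l k) (g k)) = 1" for k
  proof -
    have "S (l k) (g k) = ?V (l k) (x k) /\<^sub>R a k"
      by (simp add: g_def blinfun.diff_right blinfun.diff_left blinfun.scaleR_right scaleR_diff_right)
    then have "norm (S (l k) (g k)) = inverse (a k) * norm (?V (l k) (x k))"
      using a[of k] by (simp only: norm_scaleR abs_inverse abs_of_pos)
    then show ?thesis using a[of k] by (simp only: a_def[symmetric]) simp
  qed
  then have le: "norm (S (l k) (g k)) \<le> 1" for k by simp
  obtain h y where h: "strict_mono (h :: nat \<Rightarrow> nat)" and y: "(\<lambda>n. S (l (h n)) (g (h n))) \<longlonglongrightarrow> y"
    and ev: "\<forall>t. r < t \<and> t < b \<longrightarrow> (t - r) *\<^sub>R S t y = y"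
    by (rule S_subsequence[OF l _ _ g le]) (use lk in blast)+
  have "P (S (l k) (g k)) = 0" for k
  proof -
    have "P (g k) = 0" by (simp add: g_def blinfun.diff_right PP)
    then have "(l k - r) *\<^sub>R P (S (l k) (g k)) = 0" using PS lk[of k] by metis
    then show ?thesis using lk[of k] by simp
  qed
  then have "(\<lambda>n. 0) \<longlonglongrightarrow> P y" using blinfun.tendsto[OF tendsto_const y, of P] by simp
  then have "P y = 0" by (simp add: LIMSEQ_const_iff)
  with Pfix ev have "y = 0" by metis
  moreover have "norm y = 1" using LIMSEQ_unique[OF tendsto_norm[OF y]] by (simp add: Sg)
  ultimately show False by simp
qed

text \<open>The expansion is \<open>P / (l - r)\<close> plus the Taylor series of the
  pseudo-resolvent \<open>S(.) (I - P)\<close>, whose value at \<open>r\<close> is \<open>W\<close>.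
  The candidate is then tied to \<open>S m\<close> by both forms of the resolvent identity.\<close>

lemma pole: "resolvent_pole D (op_add A K) (complex_of_real r)"
proof -
  let ?r = "complex_of_real r"
  obtain P where P: "P \<in> bounded_ops" "P \<noteq> 0"
    and PS: "\<forall>t x. r < t \<and> t < b \<longrightarrow> (t - r) *\<^sub>R S t (P x) = P x \<and> (t - r) *\<^sub>R P (S t x) = P x"
    and Pfix: "\<forall>y. (\<forall>t. r < t \<and> t < b \<longrightarrow> (t - r) *\<^sub>R S t y = y) \<longrightarrow> P y = y"
    by (rule spectral_projection)
  have PP: "P (P x) = P x" for x using Pfix PS by blast
  obtain c C where c: "r < c" "c \<le> b" "0 \<le> C"
    and C: "\<forall>t. r < t \<and> t < c \<longrightarrow> norm (S t o\<^sub>L (id_blinfun - P)) \<le> C"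
    using complementary_resolvent_bounded[OF P(1) PS Pfix] by blast
  \<comment> \<open>Close enough to \<open>r\<close> for \<open>(m - r) C < 1\<close>, so that the
    Neumann series from \<open>m\<close> reaches \<open>r\<close>; \<open>C + 1\<close> guards
    against \<open>C = 0\<close>.\<close>
  define m where "m = r + min ((c - r) / 2) (1 / (2 * (C + 1)))"
  have "r < m" using c by (simp add: m_def)
  moreover have "m \<le> r + (c - r) / 2" unfolding m_def by (intro add_left_mono min.cobounded1)
  ultimately have m: "r < m" "m < c" "m < b" using c by (auto simp: field_simps)
  have m1: "m - r \<le> 1 / (2 * (C + 1))" by (simp add: m_def)
  define V where "V = S m o\<^sub>L (id_blinfun - P)"
  let ?m = "complex_of_real m"
  have V: "V \<in> bounded_ops" using S_bounded_ops m P by (simp add: V_def)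
  have "(m - r) * norm V \<le> 1 / (2 * (C + 1)) * C"
    by (rule mult_mono) (use C m m1 c in \<open>auto simp: V_def\<close>)
  also have "\<dots> < 1" using c(3) by (simp add: field_simps)
  finally have "cmod (?m - ?r) * norm V < 1" using m by (simp flip: of_real_diff)
  then obtain W where W: "W \<in> bounded_ops"
    and "(\<lambda>k. scalar_op ((?m - ?r) ^ k) o\<^sub>L bpow V (Suc k)) sums W" and
    VW: "\<forall>x. W x = V x + (?m - ?r) *\<^sub>C V (W x)" "\<forall>x. W x = V x + (?m - ?r) *\<^sub>C W (V x)"
    by (rule pseudo_resolvent_series[OF V])
  have div: "y = p /\<^sub>R a" if "a *\<^sub>R y = p" "a \<noteq> 0" for a :: real and y p :: "'a cpx"
    using that by auto
  have SP: "S m (P x) = P x /\<^sub>R (m - r)" "P (S m x) = P x /\<^sub>R (m - r)" for x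
  proof -
    have "(m - r) *\<^sub>R S m (P x) = P x" "(m - r) *\<^sub>R P (S m x) = P x" using PS m by blast+
    then show "S m (P x) = P x /\<^sub>R (m - r)" "P (S m x) = P x /\<^sub>R (m - r)"
      using m by (intro div; simp)+
  qed
  have Vx: "V x = S m x - P x /\<^sub>R (m - r)" for x
    by (simp add: V_def blinfun.diff_left blinfun.diff_right SP)
  have VP: "V (P x) = 0" "P (V x) = 0" for x
    by (simp_all add: Vx SP PP blinfun.diff_right blinfun.scaleR_right)
  define d where "d = 1 / (norm W + 1)"
  have d: "0 < d" by (simp add: d_def add_nonneg_pos)
  \<comment> \<open>Index \<open>0\<close> belongs to the power \<open>-1\<close>. The signs occur
    because the Taylor series of a resolvent runs in powers of \<open>r - l\<close>, while the
    definition of a pole uses \<open>l - r\<close>.\<close>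
  define U where "U = (\<lambda>k. case k of 0 \<Rightarrow> P | Suc j \<Rightarrow> scalar_op ((- 1) ^ j) o\<^sub>L bpow W (Suc j))"
  have "l \<in> resolvent_set D (op_add A K) \<and>
      (\<lambda>k. scalar_op ((l - ?r) powi (int k - int 1)) o\<^sub>L U k) sums resolvent D (op_add A K) l"
    if l: "l \<in> ball ?r d - {?r}" for l
  proof -
    have ln: "l \<noteq> ?r" using l by simp
    have "cmod (?r - l) * norm W \<le> d * norm W"
      using l by (intro mult_right_mono) (auto simp: dist_norm)
    also have "\<dots> < 1" unfolding d_def by (simp add: divide_less_eq add_nonneg_pos)
    finally obtain Z where Z: "Z \<in> bounded_ops"
      and Zs: "(\<lambda>k. scalar_op ((?r - l) ^ k) o\<^sub>L bpow W (Suc k)) sums Z"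
      and WZ: "\<forall>x. Z x = W x + (?r - l) *\<^sub>C W (Z x)" "\<forall>x. Z x = W x + (?r - l) *\<^sub>C Z (W x)"
      by (rule pseudo_resolvent_series[OF W])
    have VZ: "Z x = V x + (?m - l) *\<^sub>C V (Z x)" "Z x = V x + (?m - l) *\<^sub>C Z (V x)" for x
      by (rule pseudo_resolvent_trans[OF V W Z, of ?m ?r l];
          rule VW[rule_format] WZ[rule_format])+
    have ZP: "Z (P x) = 0" "P (Z x) = 0" for x
    proof -
      show "Z (P x) = 0" using VZ(2)[of "P x"] by (simp add: VP blinfun.zero_right)
      show "P (Z x) = 0"
        using arg_cong[OF VZ(1)[of x], of P] by (simp add: VP blinfun.add_right bounded_opsD[OF P(1)])
    qed
    define X where "X = (scalar_op (inverse (l - ?r)) o\<^sub>L P) + Z"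
    have X: "X \<in> bounded_ops" using P Z by (simp add: X_def)
    have Xx: "X x = inverse (l - ?r) *\<^sub>C P x + Z x" for x
      by (simp add: X_def blinfun.add_left scalar_op.rep_eq)
    have Sx: "S m x = inverse (?m - ?r) *\<^sub>C P x + V x" for x
      by (simp add: Vx flip: of_real_diff of_real_inverse)
    have Sb: "S m \<in> bounded_ops" using S_bounded_ops m by blast
    \<comment> \<open>A partial fraction identity: it is the resolvent identity on the range of
      \<open>P\<close>, where the resolvent acts as multiplication by
      \<open>1 / (l - r)\<close>.\<close>
    have frac: "inverse (?m - ?r) + (?m - l) * (inverse (?m - ?r) * inverse (l - ?r)) = inverse (l - ?r)"
    proof -
      have "inverse a + (a - b) * (inverse a * inverse b) = inverse b"
        if "a \<noteq> 0" "b \<noteq> 0" for a b :: complex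
        using that by (simp add: field_simps)
      from this[of "?m - ?r" "l - ?r"] show ?thesis using ln m by simp
    qed
    have P_part: "inverse (l - ?r) *\<^sub>C p = inverse (?m - ?r) *\<^sub>C p
        + (?m - l) *\<^sub>C inverse (?m - ?r) *\<^sub>C inverse (l - ?r) *\<^sub>C p" for p :: "'a cpx"
      using arg_cong[OF frac, of "\<lambda>c. c *\<^sub>C p"] by (simp only: cpx.scale_left_distrib cpx.scale_scale)
    have SX: "S m (X x) = inverse (?m - ?r) *\<^sub>C inverse (l - ?r) *\<^sub>C P x + V (Z x)" for x
      by (simp only: Xx Sx blinfun.add_right bounded_opsD[OF P(1)] bounded_opsD[OF V] PP ZP VP
          cpx.scale_zero_right add_0_left add_0_right)
    have XS: "X (S m x) = inverse (?m - ?r) *\<^sub>C inverse (l - ?r) *\<^sub>C P x + Z (V x)" for x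
      by (simp only: Xx Sx blinfun.add_right bounded_opsD[OF P(1)] bounded_opsD[OF Z] PP ZP VP
          cpx.scale_zero_right add_0_left add_0_right cpx.scale_left_commute)
    have "is_resolvent D (op_add A K) l X"
    proof (rule is_resolvent_of_identity[OF S[OF m(1,3)] X])
      fix x
      have "X x = (inverse (?m - ?r) *\<^sub>C P x
        + (?m - l) *\<^sub>C inverse (?m - ?r) *\<^sub>C inverse (l - ?r) *\<^sub>C P x) + (V x + (?m - l) *\<^sub>C V (Z x))"
        by (simp only: Xx P_part[symmetric] VZ(1)[symmetric])
      also have "\<dots> = (inverse (?m - ?r) *\<^sub>C P x + V x)
        + (?m - l) *\<^sub>C (inverse (?m - ?r) *\<^sub>C inverse (l - ?r) *\<^sub>C P x + V (Z x))"
        by (simp only: cpx.scale_right_distrib add_ac)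
      finally show "X x = S m x + (?m - l) *\<^sub>C S m (X x)"
        by (simp only: SX[of x, symmetric] Sx[of x, symmetric])
      have "X x = (inverse (?m - ?r) *\<^sub>C P x
        + (?m - l) *\<^sub>C inverse (?m - ?r) *\<^sub>C inverse (l - ?r) *\<^sub>C P x) + (V x + (?m - l) *\<^sub>C Z (V x))"
        by (simp only: Xx P_part[symmetric] VZ(2)[symmetric])
      also have "\<dots> = (inverse (?m - ?r) *\<^sub>C P x + V x)
        + (?m - l) *\<^sub>C (inverse (?m - ?r) *\<^sub>C inverse (l - ?r) *\<^sub>C P x + Z (V x))"
        by (simp only: cpx.scale_right_distrib add_ac)
      finally show "X x = S m x + (?m - l) *\<^sub>C X (S m x)"
        by (simp only: XS[of x, symmetric] Sx[of x, symmetric])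
    qed
    note res = is_resolventD[OF this]
    let ?f = "\<lambda>k. scalar_op ((l - ?r) powi (int k - int 1)) o\<^sub>L U k"
    have "?f (Suc k) = scalar_op ((?r - l) ^ k) o\<^sub>L bpow W (Suc k)" for k
    proof -
      have "(l - ?r) ^ k * (- 1) ^ k = (?r - l) ^ k" by (simp flip: power_mult_distrib)
      then show ?thesis
        by (intro blinfun_eqI) (simp add: U_def scalar_op.rep_eq)
    qed
    with Zs have "(\<lambda>k. ?f (Suc k)) sums Z" by simp
    then have "?f sums (Z + ?f 0)" by (rule sums_Suc)
    moreover have "Z + ?f 0 = X" by (simp add: X_def U_def power_int_minus)
    ultimately show ?thesis using res by simp
  qed
  moreover have "range U \<subseteq> bounded_ops"
    using P W by (auto simp: U_def bpow_bounded_ops simp del: bpow.simps split: nat.split)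
  moreover have "U 0 \<noteq> 0" using P by (simp add: U_def)
  ultimately show ?thesis unfolding resolvent_pole_def using d
    by (intro exI[of _ "1::nat"] exI[of _ d] exI[of _ U] conjI ballI) (simp | blast)+
qed

end

subsection \<open>Strict monotonicity of the real spectral bound\<close>

text \<open>Boundedness of the terms at \<open>p\<close> gives geometric decay of the terms at
  \<open>t\<close>, with ratio \<open>t / p\<close> at most \<open>1/2\<close>; hence the factor
  \<open>2\<close>. The resulting bound is linear in \<open>t\<close>.\<close>

lemma norm_power_series_diff_le:
  fixes U :: "nat \<Rightarrow> 'a::banach"
  assumes C: "\<And>k. norm (p ^ k *\<^sub>R U k) \<le> C" and t: "0 < t" "t \<le> p / 2"
    and F: "(\<lambda>k. t ^ k *\<^sub>R U k) sums F"
  shows "norm (F - U 0) \<le> 2 * C / p * t"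
proof -
  have C0: "0 \<le> C" using C[of 0] norm_ge_zero order_trans by blast
  define q where "q = t / p"
  have p: "0 < p" and q: "0 \<le> q" "q \<le> 1/2" using t by (auto simp: q_def field_simps)
  have bd: "norm (t ^ Suc k *\<^sub>R U (Suc k)) \<le> C * q * q ^ k" for k
  proof -
    have "t ^ Suc k *\<^sub>R U (Suc k) = q ^ Suc k *\<^sub>R (p ^ Suc k *\<^sub>R U (Suc k))"
      using p by (simp add: q_def power_divide)
    then have "norm (t ^ Suc k *\<^sub>R U (Suc k)) = q ^ Suc k * norm (p ^ Suc k *\<^sub>R U (Suc k))"
      using q by (simp only: norm_scaleR abs_of_nonneg zero_le_power)
    also have "\<dots> \<le> q ^ Suc k * C" by (intro mult_left_mono C) (use q in auto)
    finally show ?thesis by (simp add: mult_ac)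
  qed
  have "(\<lambda>k. t ^ Suc k *\<^sub>R U (Suc k)) sums (F - U 0)"
    using F sums_Suc_iff[of "\<lambda>k. t ^ k *\<^sub>R U k" "F - U 0"] by simp
  moreover have "(\<lambda>k. C * q * q ^ k) sums (C * q * (1 / (1 - q)))"
    by (intro sums_mult geometric_sums) (use q in auto)
  ultimately have "norm (F - U 0) \<le> C * q * (1 / (1 - q))"
    using bd by (rule norm_sums_le)
  also have "\<dots> \<le> C * q * 2"
    by (intro mult_left_mono) (use q C0 in \<open>auto simp: field_simps\<close>)
  finally show ?thesis by (simp add: q_def mult_ac)
qed

text \<open>Multiplying by \<open>(l - s)^n\<close> removes the pole, so the scaled resolvents tend
  in norm to the leading Laurent coefficient.\<close>

lemma scaled_resolvent_limit:
  fixes D :: "'a::banach_lattice cpx set" and s b :: real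
  assumes pole: "resolvent_pole D A (complex_of_real s)" and "s < b"
  obtains n Q l where "1 \<le> n" "Q \<in> bounded_ops" "Q \<noteq> 0" "l \<longlonglongrightarrow> s" "\<forall>j. s < l j \<and> l j < b"
    "(\<lambda>j. (l j - s) ^ n *\<^sub>R resolvent D A (complex_of_real (l j))) \<longlonglongrightarrow> Q"
proof -
  obtain n d and U :: "nat \<Rightarrow> 'a cpx \<Rightarrow>\<^sub>L 'a cpx" where n: "1 \<le> n" and d: "0 < d"
    and U: "range U \<subseteq> bounded_ops" "U 0 \<noteq> 0"
    and series: "\<forall>l\<in>ball (complex_of_real s) d - {complex_of_real s}. l \<in> resolvent_set D A \<and>
      (\<lambda>k. scalar_op ((l - complex_of_real s) powi (int k - int n)) o\<^sub>L U k) sums resolvent D A l"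
    using pole unfolding resolvent_pole_def by blast
  define F where "F t = t ^ n *\<^sub>R resolvent D A (complex_of_real (s + t))" for t
  have F: "(\<lambda>k. t ^ k *\<^sub>R U k) sums F t" if t: "0 < t" "t < d" for t
  proof -
    have "complex_of_real (s + t) \<in> ball (complex_of_real s) d - {complex_of_real s}"
      using t by (simp add: dist_norm)
    with series have "(\<lambda>k. scalar_op ((complex_of_real (s + t) - complex_of_real s) powi (int k - int n)) o\<^sub>L U k)
      sums resolvent D A (complex_of_real (s + t))" by blast
    then have "(\<lambda>k. t ^ n *\<^sub>R (scalar_op ((complex_of_real (s + t) - complex_of_real s) powi (int k - int n)) o\<^sub>L U k))
      sums F t" unfolding F_def by (rule sums_scaleR_right)
    moreover have "t ^ n *\<^sub>R (scalar_op ((complex_of_real (s + t) - complex_of_real s) powi (int k - int n)) o\<^sub>L U k)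
      = t ^ k *\<^sub>R U k" for k
    proof -
      have pw: "(complex_of_real (s + t) - complex_of_real s) powi (int k - int n) = complex_of_real (t ^ k / t ^ n)"
        using t by (simp add: power_int_diff)
      show ?thesis unfolding pw using t
        by (intro blinfun_eqI)
          (simp add: blinfun.scaleR_left scalar_op.rep_eq del: of_real_divide of_real_power)
    qed
    ultimately show ?thesis by simp
  qed
  define p where "p = d / 2"
  have p: "0 < p" "p < d" using d by (auto simp: p_def)
  have U0: "(\<lambda>k. p ^ k *\<^sub>R U k) \<longlonglongrightarrow> 0" by (rule summable_LIMSEQ_zero[OF sums_summable[OF F[OF p]]])
  obtain C where "0 < C" and "\<forall>k. norm (p ^ k *\<^sub>R U k) \<le> C"
    by (rule BseqE[OF convergent_imp_Bseq[OF convergentI[OF U0]]])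
  then have C: "norm (p ^ k *\<^sub>R U k) \<le> C" for k by blast
  \<comment> \<open>The bound \<open>p / 2\<close> serves the estimate of the power series, the
    bound \<open>b - s\<close> keeps the points below \<open>b\<close>.\<close>
  define e where "e = min (p / 2) (b - s)"
  have e: "0 < e" "e \<le> p / 2" "e \<le> b - s"
    unfolding e_def using p \<open>s < b\<close> by (simp, intro min.cobounded1, simp)
  define t where "t j = e * inverse (real (Suc (Suc j)))" for j
  have inv: "inverse (real (Suc (Suc j))) < 1" for j by (simp add: field_simps)
  have t: "0 < t j" "t j < e" for j
    using e inv[of j] by (auto simp: t_def simp del: of_nat_Suc)
  have "t \<longlonglongrightarrow> e * 0"
    unfolding t_def by (intro tendsto_intros LIMSEQ_Suc[OF LIMSEQ_inverse_real_of_nat])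
  then have t0: "t \<longlonglongrightarrow> 0" by simp
  have "norm (F (t j) - U 0) \<le> 2 * C / p * t j" for j
    by (rule norm_power_series_diff_le[OF C]) (use t[of j] e p F in auto)
  moreover have "(\<lambda>j. 2 * C / p * t j) \<longlonglongrightarrow> 0" using tendsto_mult_left[OF t0, of "2 * C / p"] by simp
  ultimately have "(\<lambda>j. F (t j) - U 0) \<longlonglongrightarrow> 0"
    by (intro Lim_null_comparison[of "\<lambda>j. F (t j) - U 0"] always_eventually allI)
  then have lim: "(\<lambda>j. F (t j)) \<longlonglongrightarrow> U 0" by (rule LIM_zero_cancel)
  show ?thesis
  proof (rule that[OF n])
    show "U 0 \<in> bounded_ops" "U 0 \<noteq> 0" using U by auto
    show "(\<lambda>j. s + t j) \<longlonglongrightarrow> s" using tendsto_add[OF tendsto_const t0, of s] by simp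
    show "\<forall>j. s < s + t j \<and> s + t j < b" using t e by (smt (verit))
    show "(\<lambda>j. (s + t j - s) ^ n *\<^sub>R resolvent D A (complex_of_real (s + t j))) \<longlonglongrightarrow> U 0"
      using lim by (simp add: F_def)
  qed
qed

text \<open>No norm bound on \<open>T\<close> is at hand. Instead \<open>H\<close> plays the role of
  a positive inverse of \<open>I - T\<close>: it dominates all iterates \<open>bpow T k g\<close>,
  so the factors \<open>\<theta> ^ k\<close> make their sum converge.\<close>

lemma positive_neumann_vector:
  fixes T :: "'a::banach_lattice cpx \<Rightarrow>\<^sub>L 'a cpx"
  assumes T: "positive_op T" and H: "\<And>z. 0 \<le> z \<Longrightarrow> 0 \<le> H z" "\<And>z. H z = z + T (H z)"
    and \<theta>: "0 \<le> \<theta>" "\<theta> < 1" and g: "0 \<le> g"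
  obtains x where "x = g + \<theta> *\<^sub>R T x" "g \<le> x"
proof -
  define f where "f k = \<theta> ^ k *\<^sub>R bpow T k g" for k
  have pos: "0 \<le> bpow T k g" for k by (rule positive_opD[OF bpow_positive[OF T] g])
  have le: "bpow T k g \<le> H g" for k
  proof (induction k)
    case 0
    have "0 \<le> T (H g)" by (rule positive_opD[OF T H(1)[OF g]])
    then show ?case using H(2)[of g] by (metis bpow.simps(1) id_apply id_blinfun.rep_eq le_add_same_cancel1)
  next
    case (Suc k)
    have "bpow T (Suc k) g \<le> T (H g)" using positive_op_mono[OF T Suc] by simp
    also have "\<dots> \<le> H g" using H(2)[of g] g by (metis le_add_same_cancel2)
    finally show ?case .
  qed
  have "norm (f k) \<le> norm (H g) * \<theta> ^ k" for k
    using norm_mono_cpx[OF pos le, of k] \<theta> by (simp add: f_def mult.commute mult_left_mono)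
  then have "summable f"
    using \<theta> by (intro summable_comparison_test'[OF summable_mult[OF summable_geometric[of \<theta>]]]) auto
  then obtain x where x: "f sums x" by (auto simp: summable_def)
  have "(\<lambda>k. \<theta> *\<^sub>R T (f k)) sums (\<theta> *\<^sub>R T x)"
    by (intro sums_scaleR_right bounded_linear.sums[OF blinfun.bounded_linear_right x])
  moreover have "\<theta> *\<^sub>R T (f k) = f (Suc k)" for k by (simp add: f_def blinfun.scaleR_right)
  moreover have "(\<lambda>k. f (Suc k)) sums (x - g)"
    using x sums_Suc_iff[of f "x - g"] by (simp add: f_def)
  ultimately have eq: "\<theta> *\<^sub>R T x = x - g" using sums_unique2 by simp
  have "0 \<le> x - g"
  proof (rule LIMSEQ_nonneg_cpx)
    show "(\<lambda>n. \<Sum>k<n. f (Suc k)) \<longlonglongrightarrow> x - g"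
      using \<open>(\<lambda>k. f (Suc k)) sums (x - g)\<close> by (simp add: sums_def)
    show "0 \<le> (\<Sum>k<n. f (Suc k))" for n
      unfolding f_def by (intro sum_nonneg scaleR_nonneg_nonneg pos) (use \<theta> in auto)
  qed
  with eq show ?thesis by (intro that) simp_all
qed

lemma resolvent_perturbed_ge:
  assumes R: "is_resolvent D A l R" "positive_op R"
    and S: "is_resolvent D (op_add A K) l S" "positive_op S" and K: "positive_op K" and x: "0 \<le> x"
  shows "blinfun_apply R x \<le> blinfun_apply S x"
proof -
  have "0 \<le> blinfun_apply R (blinfun_apply K (blinfun_apply S x))"
    by (intro positive_opD[OF R(2)] positive_opD[OF K] positive_opD[OF S(2)] x)
  then show ?thesis using is_resolvent_perturb_eq(1)[OF R(1) S(1), of x]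
    by (metis le_add_same_cancel1)
qed

text \<open>Near \<open>s\<close> the operators \<open>(l - s)\<^sup>n K R(l, A)\<close> converge to a compact operator \<open>K Q\<close> with
  positive spectral radius, whereas the spectral radius of \<open>K R(l, A)\<close> would stay below one if
  \<open>s\<close> were an upper bound of the real spectrum of \<open>A + K\<close>.\<close>

lemma real_spectrum_above:
  fixes u :: "'a::banach_lattice cpx" and K :: "'a cpx \<Rightarrow>\<^sub>L 'a cpx" and s b :: real
  assumes nontrivial: "(UNIV :: 'a cpx set) \<noteq> {0}" and u: "quasi_interior u"
    and A: "linear_operator D A" and pole: "resolvent_pole D A (complex_of_real s)" and sb: "s < b"
    and resA: "\<And>t. s < t \<Longrightarrow> t < b \<Longrightarrow> complex_of_real t \<in> resolvent_set D A"
    and strong: "\<And>t. s < t \<Longrightarrow> t < b \<Longrightarrow> op_strongly_pos u (resolvent D A (complex_of_real t))"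
    and resB: "\<And>t. s < t \<Longrightarrow> t < b \<Longrightarrow> complex_of_real t \<in> resolvent_set D (op_add A K)"
    and posB: "\<And>t. s < t \<Longrightarrow> t < b \<Longrightarrow> positive_op (resolvent D (op_add A K) (complex_of_real t))"
    and K: "K \<in> bounded_ops" "positive_op K" "relatively_compact_op D A K" "K \<noteq> 0"
  shows False
proof -
  let ?R = "\<lambda>t::real. resolvent D A (complex_of_real t)"
  let ?S = "\<lambda>t::real. resolvent D (op_add A K) (complex_of_real t)"
  have u0: "0 < u" by (rule quasi_interior_pos[OF nontrivial u])
  then have u1: "0 \<le> u" by simp
  have R: "is_resolvent D A (complex_of_real t) (?R t)" if "s < t" "t < b" for t
    by (rule is_resolvent_resolvent[OF A resA[OF that]])
  have S: "is_resolvent D (op_add A K) (complex_of_real t) (?S t)" if "s < t" "t < b" for t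
    by (rule is_resolvent_resolvent[OF linear_operator_op_add[OF A K(1)] resB[OF that]])
  have Rpos: "positive_op (?R t)" if "s < t" "t < b" for t
    by (rule op_strongly_pos_imp_positive[OF u1 strong[OF that]])
  obtain n Q l where n: "1 \<le> n" and Q: "Q \<in> bounded_ops" "Q \<noteq> 0" and l: "l \<longlonglongrightarrow> s"
    and l1: "\<forall>j. s < l j \<and> l j < b" and lim: "(\<lambda>j. (l j - s) ^ n *\<^sub>R ?R (l j)) \<longlonglongrightarrow> Q"
    by (rule scaled_resolvent_limit[OF pole sb])
  define X where "X j = (l j - s) ^ n *\<^sub>R ?R (l j)" for j
  have X: "X \<longlonglongrightarrow> Q" using lim by (simp only: X_def[abs_def])
  have Qpos: "positive_op Q"
    by (rule positive_op_limit[OF X]) (use l1 in \<open>auto simp: X_def less_imp_le intro!: positive_op_scaleR Rpos\<close>)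
  have ls: "(\<lambda>j. l j - s) \<longlonglongrightarrow> 0" using l by (simp add: LIM_zero)
  have lsn: "(\<lambda>j. (l j - s) ^ n) \<longlonglongrightarrow> 0"
    using tendsto_power[OF ls, of n] n by (simp add: power_0_left)
  define m where "m = (s + b) / 2"
  have m: "s < m" "m < b" using sb by (auto simp: m_def)
  \<comment> \<open>The resolvent identity multiplied by \<open>(l j - s)^n\<close> and passed to
    the limit; its first term vanishes because \<open>n\<close> is at least one.\<close>
  have RQ: "(m - s) *\<^sub>R ?R m (Q x) = Q x" and QR: "(m - s) *\<^sub>R Q (?R m x) = Q x" for x
  proof -
    have X1: "X j x = (l j - s) ^ n *\<^sub>R ?R m x + (m - l j) *\<^sub>R ?R m (X j x)" for j
    proof -
      have "?R (l j) x = ?R m x + (m - l j) *\<^sub>R ?R m (?R (l j) x)"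
        using resolvent_identity(1)[OF R[OF m] R, of "l j" x] l1 by (simp flip: of_real_diff)
      then have "X j x = (l j - s) ^ n *\<^sub>R (?R m x + (m - l j) *\<^sub>R ?R m (?R (l j) x))"
        unfolding X_def blinfun.scaleR_left by (rule arg_cong)
      also have "\<dots> = (l j - s) ^ n *\<^sub>R ?R m x + (m - l j) *\<^sub>R ?R m (X j x)"
        by (simp only: X_def blinfun.scaleR_left blinfun.scaleR_right scaleR_add_right scaleR_left_commute)
      finally show ?thesis .
    qed
    have "(\<lambda>j. (l j - s) ^ n *\<^sub>R ?R m x + (m - l j) *\<^sub>R ?R m (X j x))
        \<longlonglongrightarrow> 0 *\<^sub>R ?R m x + (m - s) *\<^sub>R ?R m (Q x)"
      by (intro tendsto_intros lsn l X)
    then have "(\<lambda>j. X j x) \<longlonglongrightarrow> (m - s) *\<^sub>R ?R m (Q x)" using X1 by simp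
    from LIMSEQ_unique[OF this blinfun_tendsto_apply[OF X]] show "(m - s) *\<^sub>R ?R m (Q x) = Q x" .
    have X2: "X j x = (l j - s) ^ n *\<^sub>R ?R m x + (m - l j) *\<^sub>R X j (?R m x)" for j
    proof -
      have "?R (l j) x = ?R m x + (m - l j) *\<^sub>R ?R (l j) (?R m x)"
        using resolvent_identity(2)[OF R[OF m] R, of "l j" x] l1 by (simp flip: of_real_diff)
      then have "X j x = (l j - s) ^ n *\<^sub>R (?R m x + (m - l j) *\<^sub>R ?R (l j) (?R m x))"
        unfolding X_def blinfun.scaleR_left by (rule arg_cong)
      also have "\<dots> = (l j - s) ^ n *\<^sub>R ?R m x + (m - l j) *\<^sub>R X j (?R m x)"
        by (simp only: X_def blinfun.scaleR_left blinfun.scaleR_right scaleR_add_right scaleR_left_commute)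
      finally show ?thesis .
    qed
    have "(\<lambda>j. (l j - s) ^ n *\<^sub>R ?R m x + (m - l j) *\<^sub>R X j (?R m x))
        \<longlonglongrightarrow> 0 *\<^sub>R ?R m x + (m - s) *\<^sub>R Q (?R m x)"
      by (intro tendsto_intros lsn l X)
    then have "(\<lambda>j. X j x) \<longlonglongrightarrow> (m - s) *\<^sub>R Q (?R m x)" using X2 by simp
    from LIMSEQ_unique[OF this blinfun_tendsto_apply[OF X]] show "(m - s) *\<^sub>R Q (?R m x) = Q x" .
  qed
  \<comment> \<open>First \<open>Q f\<close> cannot be zero, since otherwise \<open>Q u = 0\<close>
    and \<open>Q\<close> would vanish. Then \<open>Q f = (m - s) R(m) (Q f)\<close> inherits strong
    positivity from \<open>R(m)\<close>.\<close>
  have Qstrong: "\<exists>e>0. e *\<^sub>R u \<le> Q f" if f: "0 < f" for f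
  proof -
    obtain e where e: "0 < e" "e *\<^sub>R u \<le> ?R m f"
      using strong[OF m] f by (auto simp: op_strongly_pos_def vec_strongly_pos_def)
    have "Q f \<noteq> 0"
    proof
      assume "Q f = 0"
      with QR[of f] m have "Q (?R m f) = 0" by simp
      with positive_op_mono[OF Qpos e(2)] have "e *\<^sub>R Q u \<le> 0" by (simp add: blinfun.scaleR_right)
      moreover have "0 \<le> e *\<^sub>R Q u" using e positive_opD[OF Qpos u1] by (simp add: scaleR_nonneg_nonneg)
      ultimately have "e *\<^sub>R Q u = 0" by order
      with e have "Q u = 0" by simp
      with quasi_interior_positive_op_eq_0[OF u Q(1) Qpos] Q(2) show False by blast
    qed
    moreover have "0 \<le> Q f" using positive_opD[OF Qpos] f by simp
    ultimately have "0 < Q f" by simp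
    then obtain d where d: "0 < d" "d *\<^sub>R u \<le> ?R m (Q f)"
      using strong[OF m] by (auto simp: op_strongly_pos_def vec_strongly_pos_def)
    then have "(m - s) *\<^sub>R d *\<^sub>R u \<le> (m - s) *\<^sub>R ?R m (Q f)"
      using m by (intro scaleR_left_mono) auto
    then show ?thesis using RQ[of f] d m by (intro exI[of _ "(m - s) * d"]) simp
  qed
  define g where "g = K u"
  have "g \<noteq> 0" using quasi_interior_positive_op_eq_0[OF u K(1,2)] K(4) by (auto simp: g_def)
  moreover have "0 \<le> g" using positive_opD[OF K(2) u1] by (simp add: g_def)
  ultimately have g: "0 < g" "0 \<le> g" "0 < norm g" by auto
  obtain c where c: "0 < c" "c *\<^sub>R u \<le> Q g" using Qstrong[OF g(1)] by blast
  \<comment> \<open>Chosen so that \<open>\<tau> Q K u\<close> dominates \<open>2 u\<close>: this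
    doubling is what drives the final contradiction.\<close>
  define \<tau> where "\<tau> = 2 / c"
  have \<tau>: "0 < \<tau>" using c by (simp add: \<tau>_def)
  have "(\<lambda>j. \<tau> * (l j - s) ^ n) \<longlonglongrightarrow> 0" using tendsto_mult_left[OF lsn, of \<tau>] by simp
  then have "eventually (\<lambda>j. \<tau> * (l j - s) ^ n < 1) sequentially"
    by (rule order_tendstoD) simp
  then obtain N where N: "\<And>j. j \<ge> N \<Longrightarrow> \<tau> * (l j - s) ^ n < 1"
    by (auto simp: eventually_sequentially)
  \<comment> \<open>Here \<open>I + K S(t)\<close> is the positive inverse of
    \<open>I - K R(t)\<close>. The shift by \<open>N\<close> ensures that the scalar in front of
    \<open>K R(t)\<close> is below one.\<close>
  have "\<exists>x. x = g + \<tau> *\<^sub>R K (X (j + N) x) \<and> g \<le> x" for j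
  proof -
    define t where "t = l (j + N)"
    have t: "s < t" "t < b" using l1 by (auto simp: t_def)
    have "0 \<le> z + K (?S t z)" if "0 \<le> z" for z
      using that by (intro add_nonneg_nonneg positive_opD[OF K(2)] positive_opD[OF posB[OF t]])
    moreover have "z + K (?S t z) = z + (K o\<^sub>L ?R t) (z + K (?S t z))" for z
      using arg_cong[OF is_resolvent_perturb_eq(1)[OF R[OF t] S[OF t], of z], of "\<lambda>y. z + K y"]
      by (simp add: blinfun.add_right)
    moreover have "0 \<le> \<tau> * (t - s) ^ n" using \<tau> t by simp
    moreover have "\<tau> * (t - s) ^ n < 1" using N[of "j + N"] by (simp add: t_def)
    ultimately obtain x where "x = g + (\<tau> * (t - s) ^ n) *\<^sub>R (K o\<^sub>L ?R t) x" "g \<le> x"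
      using positive_neumann_vector[OF positive_op_compose[OF K(2) Rpos[OF t]], of "\<lambda>z. z + K (?S t z)" "\<tau> * (t - s) ^ n" g]
        g(2) by metis
    then show ?thesis
      by (intro exI[of _ x]) (simp add: X_def t_def blinfun.scaleR_left blinfun.scaleR_right)
  qed
  \<comment> \<open>The norms of \<open>x j\<close> may or may not stay bounded. Both cases are
    covered by normalising: the factors \<open>a j\<close> lie in a compact interval because
    \<open>x j\<close> dominates \<open>g\<close>, and a limit \<open>a0 = 0\<close> is
    allowed.\<close>
  then obtain x where x: "\<And>j. x j = g + \<tau> *\<^sub>R K (X (j + N) (x j))" and gx: "\<And>j. g \<le> x j" by metis
  define a where "a j = inverse (norm (x j))" for j
  have nx: "norm g \<le> norm (x j)" for j by (rule norm_mono_cpx[OF g(2) gx])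
  then have a: "0 < a j" "a j \<le> inverse (norm g)" for j
    using g(3) less_le_trans[OF g(3) nx[of j]] by (auto simp: a_def le_imp_inverse_le)
  define y where "y j = a j *\<^sub>R x j" for j
  have y1: "norm (y j) = 1" for j using less_le_trans[OF g(3) nx[of j]] by (simp add: y_def a_def)
  have y0: "0 \<le> y j" for j
    using a[of j] g(2) gx[of j] by (auto simp: y_def intro!: scaleR_nonneg_nonneg intro: order_trans)
  have yeq: "y j = a j *\<^sub>R g + \<tau> *\<^sub>R (K ((X (j + N) - Q) (y j)) + K (Q (y j)))" for j
  proof -
    have "y j = a j *\<^sub>R (g + \<tau> *\<^sub>R K (X (j + N) (x j)))"
      unfolding y_def by (rule arg_cong[OF x])
    also have "\<dots> = a j *\<^sub>R g + \<tau> *\<^sub>R K (X (j + N) (y j))"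
      by (simp only: y_def blinfun.scaleR_right scaleR_add_right scaleR_left_commute)
    also have "K (X (j + N) (y j)) = K ((X (j + N) - Q) (y j)) + K (Q (y j))"
      by (simp add: blinfun.diff_left blinfun.diff_right)
    finally show ?thesis .
  qed
  \<comment> \<open>Compactness of \<open>K Q\<close> comes from
    \<open>K Q = (m - s) K R(m) Q\<close>.\<close>
  have "norm (Q (y j)) \<le> norm Q" for j using norm_blinfun[of Q "y j"] by (simp add: y1)
  then obtain h1 k where h1: "strict_mono (h1 :: nat \<Rightarrow> nat)" and k: "(\<lambda>j. K (?R m (Q (y (h1 j))))) \<longlonglongrightarrow> k"
    by (rule relatively_compact_subsequence[OF A K(1,3) resA[OF m]])
  have "\<forall>j. a (h1 j) \<in> {0..inverse (norm g)}" using a less_imp_le by auto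
  from compact_Icc[THEN compact_imp_seq_compact, THEN seq_compactE, OF this]
  obtain a0 h2 where a0: "a0 \<in> {0..inverse (norm g)}" and h2: "strict_mono (h2 :: nat \<Rightarrow> nat)"
    and al: "(\<lambda>j. a (h1 (h2 j))) \<longlonglongrightarrow> a0"
    by (auto simp: o_def)
  define h where "h j = h1 (h2 j)" for j
  have h: "strict_mono h" using strict_mono_o[OF h1 h2] by (simp add: h_def[abs_def] o_def)
  have "(\<lambda>j. (m - s) *\<^sub>R K (?R m (Q (y (h j))))) \<longlonglongrightarrow> (m - s) *\<^sub>R k"
    using tendsto_scaleR[OF tendsto_const LIMSEQ_subseq_LIMSEQ[OF k h2]] by (simp add: o_def h_def)
  moreover have "(m - s) *\<^sub>R K (?R m (Q z)) = K (Q z)" for z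
    using arg_cong[OF RQ[of z], of K] by (simp add: blinfun.scaleR_right)
  ultimately have kl: "(\<lambda>j. K (Q (y (h j)))) \<longlonglongrightarrow> (m - s) *\<^sub>R k" by simp
  have Kx: "(\<lambda>j. K ((X (h j + N) - Q) (y (h j)))) \<longlonglongrightarrow> K 0"
  proof (intro blinfun.tendsto tendsto_const)
    have "(\<lambda>j. X (j + N)) \<longlonglongrightarrow> Q" using X by (rule LIMSEQ_ignore_initial_segment)
    from LIMSEQ_subseq_LIMSEQ[OF this h]
    have "(\<lambda>j. norm (X (h j + N) - Q)) \<longlonglongrightarrow> 0" by (simp add: o_def LIM_zero tendsto_norm_zero)
    then show "(\<lambda>j. (X (h j + N) - Q) (y (h j))) \<longlonglongrightarrow> 0"
      by (rule Lim_null_comparison[rotated])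
        (use norm_blinfun[of "X (_ + N) - Q" "y _"] y1 in \<open>simp add: always_eventually\<close>)
  qed
  have "(\<lambda>j. a (h j)) \<longlonglongrightarrow> a0" using al by (simp only: h_def)
  then have "(\<lambda>j. a (h j) *\<^sub>R g + \<tau> *\<^sub>R (K ((X (h j + N) - Q) (y (h j))) + K (Q (y (h j)))))
      \<longlonglongrightarrow> a0 *\<^sub>R g + \<tau> *\<^sub>R (K 0 + (m - s) *\<^sub>R k)"
    by (intro tendsto_add tendsto_scaleR tendsto_const Kx kl)
  then have "(\<lambda>j. y (h j)) \<longlonglongrightarrow> a0 *\<^sub>R g + \<tau> *\<^sub>R (K 0 + (m - s) *\<^sub>R k)"
    by (simp only: yeq[symmetric])
  then obtain z where z: "(\<lambda>j. y (h j)) \<longlonglongrightarrow> z" and zeq: "z = a0 *\<^sub>R g + \<tau> *\<^sub>R ((m - s) *\<^sub>R k)"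
    by (simp add: blinfun.zero_right)
  have "(m - s) *\<^sub>R k = K (Q z)"
    by (rule LIMSEQ_unique[OF kl]) (intro blinfun.tendsto tendsto_const z)
  with zeq have zeq: "z = a0 *\<^sub>R g + \<tau> *\<^sub>R K (Q z)" by simp
  have "0 \<le> z" by (rule LIMSEQ_nonneg_cpx[OF z y0])
  moreover have "norm z = 1" using LIMSEQ_unique[OF tendsto_norm[OF z]] by (simp add: y1)
  ultimately have "0 < z" by (auto simp: less_le)
  then obtain e where e: "0 < e" "e *\<^sub>R u \<le> Q z" using Qstrong by blast
  have ge: "\<tau> *\<^sub>R Q (K (Q z)) \<le> Q z"
  proof -
    have "Q z = a0 *\<^sub>R Q g + \<tau> *\<^sub>R Q (K (Q z))"
      using arg_cong[OF zeq, of Q] by (simp only: blinfun.add_right blinfun.scaleR_right)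
    moreover have "0 \<le> a0 *\<^sub>R Q g" using a0 positive_opD[OF Qpos g(2)] by (intro scaleR_nonneg_nonneg) auto
    ultimately show ?thesis by (metis le_add_same_cancel2)
  qed
  \<comment> \<open>Iterating \<open>Q z \<ge> \<tau> Q K (Q z)\<close> doubles the multiple of
    \<open>u\<close> below \<open>Q z\<close> each time, which contradicts the monotonicity of the
    norm.\<close>
  have grow: "(e * 2 ^ k) *\<^sub>R u \<le> Q z" for k
  proof (induction k)
    case (Suc k)
    let ?d = "e * 2 ^ k"
    have "(e * 2 ^ Suc k) *\<^sub>R u = (\<tau> * ?d) *\<^sub>R (c *\<^sub>R u)" using c by (simp add: \<tau>_def)
    also have "\<dots> \<le> (\<tau> * ?d) *\<^sub>R Q g" using c(2) \<tau> e by (intro scaleR_left_mono) auto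
    also have "\<dots> = \<tau> *\<^sub>R Q (K (?d *\<^sub>R u))" by (simp add: g_def blinfun.scaleR_right)
    also have "\<dots> \<le> \<tau> *\<^sub>R Q (K (Q z))"
      using \<tau> by (intro scaleR_left_mono positive_op_mono[OF Qpos] positive_op_mono[OF K(2)] Suc) auto
    also have "\<dots> \<le> Q z" by (rule ge)
    finally show ?case .
  qed (use e in simp)
  have nu: "0 < e * norm u" using e u0 by auto
  obtain k where "norm (Q z) / (e * norm u) < 2 ^ k" using real_arch_pow[of 2] by auto
  with nu have "norm (Q z) < 2 ^ k * (e * norm u)" by (simp only: divide_less_eq if_True)
  also have "\<dots> = norm ((e * 2 ^ k) *\<^sub>R u)" using e by simp
  also have "\<dots> \<le> norm (Q z)"
    by (rule norm_mono_cpx[OF _ grow]) (use e u1 in \<open>auto intro!: scaleR_nonneg_nonneg\<close>)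
  finally show False by simp
qed

section \<open>The four properties of the real spectral bound\<close>

theorem theorem3p9:
  fixes u :: "'a::banach_lattice cpx"
    and D :: "'a cpx set" and A :: "'a cpx \<Rightarrow> 'a cpx"
    and s l\<^sub>1 M :: real
    and K :: "'a cpx \<Rightarrow>\<^sub>L 'a cpx"
  assumes nontrivial: "(UNIV :: 'a cpx set) \<noteq> {0}"
    and u: "quasi_interior u"
    and A: "linear_operator D A" "densely_defined D" "real_operator D A"
    and s: "spectral_bound D A = ereal s" "complex_of_real s \<in> spectrum D A"
      "resolvent_pole D A (complex_of_real s)"
    and l\<^sub>1: "s < l\<^sub>1"
      "\<And>l::real. s < l \<Longrightarrow> l < l\<^sub>1 \<Longrightarrow> op_strongly_pos u (resolvent D A (complex_of_real l))"
    and M: "bdd_above ((\<lambda>l. norm (resolvent D A l)) ` {l. Re l \<ge> l\<^sub>1})"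
      "M = (SUP l\<in>{l. Re l \<ge> l\<^sub>1}. norm (resolvent D A l))"
    and K: "K \<in> bounded_ops" "positive_op K" "norm K < 1 / M"
  shows "(real_spectral_bound D (op_add A K) \<le> spectral_bound D (op_add A K) \<and>
        spectral_bound D (op_add A K) < ereal l\<^sub>1) \<and>
    (\<forall>l::real. real_spectral_bound D (op_add A K) < ereal l \<and> l < l\<^sub>1 \<longrightarrow>
        op_strongly_pos u (resolvent D (op_add A K) (complex_of_real l))) \<and>
    (relatively_compact_op D A K \<longrightarrow>
        ereal s \<le> real_spectral_bound D (op_add A K) \<and>
        (\<exists>r::real. real_spectral_bound D (op_add A K) = ereal r \<and>
          resolvent_pole D (op_add A K) (complex_of_real r))) \<and>
    (relatively_compact_op D A K \<and> K \<noteq> 0 \<longrightarrow>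
        ereal s < real_spectral_bound D (op_add A K))"
proof -
  let ?B = "op_add A K"
  let ?R = "\<lambda>t::real. resolvent D A (complex_of_real t)"
  let ?S = "\<lambda>t::real. resolvent D ?B (complex_of_real t)"
  let ?sB = "real_spectral_bound D ?B"
  have u0: "0 < u" by (rule quasi_interior_pos[OF nontrivial u])
  then have u1: "0 \<le> u" by simp
  have B: "linear_operator D ?B" by (rule linear_operator_op_add[OF A(1) K(1)])
  have resA: "l \<in> resolvent_set D A" if "s < Re l" for l
    using less_spectral_bound_resolvent_set[of D A l] s(1) that by simp
  have R: "is_resolvent D A l (resolvent D A l)" if "s < Re l" for l
    by (rule is_resolvent_resolvent[OF A(1) resA[OF that]])
  have Rpos: "positive_op (?R t)" if "s < t" "t < l\<^sub>1" for t
    by (rule op_strongly_pos_imp_positive[OF u1 l\<^sub>1(2)[OF that]])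
  have RM: "norm (resolvent D A l) \<le> M" if "l\<^sub>1 \<le> Re l" for l
    unfolding M(2) by (rule cSUP_upper[OF _ M(1)]) (use that in simp)
  have "0 \<le> M" by (rule order_trans[OF norm_ge_zero RM[of "complex_of_real l\<^sub>1"]]) simp
  \<comment> \<open>Division by zero yields zero, so \<open>norm K < 1 / M\<close> already excludes
    \<open>M = 0\<close>.\<close>
  moreover have "M \<noteq> 0" using K(3) by (auto simp: not_less)
  ultimately have M0: "0 < M" by simp

  \<comment> \<open>Half of the gap between \<open>norm K\<close> and \<open>1 / M\<close>, used as
    the width of a spectrum-free strip left of \<open>l\<^sub>1\<close>; the strip makes the bound
    in (i) strict.\<close>
  define \<delta> where "\<delta> = (1 / M - norm K) / 2"
  have \<delta>: "0 < \<delta>" using K(3) by (simp add: \<delta>_def)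
  have "(norm K + \<delta>) * M < 1"
  proof -
    have "norm K + \<delta> < 1 / M" using K(3) by (simp add: \<delta>_def field_simps)
    then show ?thesis using M0 by (simp add: less_divide_eq)
  qed
  have far: "m \<in> resolvent_set D ?B" if m: "l\<^sub>1 - \<delta> < Re m" for m
  proof -
    \<comment> \<open>The point \<open>m\<close> is moved horizontally into the half-plane where
      \<open>M\<close> bounds the resolvent; the move is treated together with \<open>K\<close> as
      one perturbation of norm at most \<open>norm K + \<delta>\<close>.\<close>
    define l where "l = Complex (max (Re m) l\<^sub>1) (Im m)"
    have l: "l\<^sub>1 \<le> Re l" by (simp add: l_def)
    have "l - m = complex_of_real (max (Re m) l\<^sub>1 - Re m)" by (simp add: l_def complex_eq_iff)
    then have lm: "cmod (l - m) \<le> \<delta>" using m \<delta> by (simp only: norm_of_real)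
    have eq: "op_add A (K + scalar_op (l - m)) = op_add ?B (scalar_op (l - m))"
      by (simp add: op_add_def blinfun.add_left add.assoc)
    have "norm ((K + scalar_op (l - m)) o\<^sub>L resolvent D A l) \<le> (norm K + \<delta>) * M"
    proof (rule order_trans[OF norm_blinfun_compose], rule mult_mono)
      show "norm (K + scalar_op (l - m)) \<le> norm K + \<delta>"
        using norm_triangle_ineq[of K "scalar_op (l - m)"] norm_scalar_op[of "l - m", where 'a='a] lm
        by linarith
    qed (use RM l \<delta> in auto)
    also have "\<dots> < 1" by fact
    finally obtain X where "is_resolvent D (op_add A (K + scalar_op (l - m))) l X"
      using is_resolvent_neumann[OF R, of l "K + scalar_op (l - m)"] K(1) l l\<^sub>1(1) by force
    then have "is_resolvent D ?B m X" by (simp add: eq is_resolvent_shift)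
    then show ?thesis by (rule is_resolventD(1))
  qed
  have "spectral_bound D ?B \<le> ereal (l\<^sub>1 - \<delta>)"
    unfolding spectral_bound_def
  proof (rule SUP_least)
    fix m assume "m \<in> spectrum D ?B"
    then have "\<not> l\<^sub>1 - \<delta> < Re m" using far by (auto simp: spectrum_def)
    then show "ereal (Re m) \<le> ereal (l\<^sub>1 - \<delta>)" by simp
  qed
  also have "\<dots> < ereal l\<^sub>1" using \<delta> by simp
  finally have i: "spectral_bound D ?B < ereal l\<^sub>1" .
  have sB_le: "?sB \<le> spectral_bound D ?B" by (rule real_spectral_bound_le)
  have resB: "complex_of_real t \<in> resolvent_set D ?B" if "?sB < ereal t" for t
    by (rule less_real_spectral_bound_resolvent_set[OF that])

  \<comment> \<open>Positivity of \<open>?R\<close> is given only strictly left of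
    \<open>l\<^sub>1\<close>, so the Neumann condition at \<open>l\<^sub>1\<close> is first carried
    a little to the left by continuity.\<close>
  have start: "\<exists>l>t. s < l \<and> l < l\<^sub>1 \<and> complex_of_real l \<in> resolvent_set D ?B \<and> positive_op (?S l)"
    if t: "t < l\<^sub>1" for t
  proof -
    have "((\<lambda>t. complex_of_real t) \<longlongrightarrow> complex_of_real l\<^sub>1) (at_left l\<^sub>1)"
      by (intro tendsto_intros)
    from isCont_tendsto_compose[OF isCont_resolvent[OF A(1) resA] this]
    have "((\<lambda>t. ?R t) \<longlongrightarrow> ?R l\<^sub>1) (at_left l\<^sub>1)" using l\<^sub>1(1) by simp
    then have "((\<lambda>t. norm K * norm (?R t)) \<longlongrightarrow> norm K * norm (?R l\<^sub>1)) (at_left l\<^sub>1)"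
      by (intro tendsto_intros)
    moreover have "norm K * norm (?R l\<^sub>1) < 1"
    proof -
      have "norm K * norm (?R l\<^sub>1) \<le> norm K * M" by (intro mult_left_mono RM) auto
      also have "\<dots> < 1" using K(3) M0 by (simp add: less_divide_eq)
      finally show ?thesis .
    qed
    ultimately have "eventually (\<lambda>t. norm K * norm (?R t) < 1) (at_left l\<^sub>1)"
      by (rule order_tendstoD)
    moreover have "eventually (\<lambda>l. l \<in> {max t s<..<l\<^sub>1}) (at_left l\<^sub>1)"
      by (rule eventually_at_leftI[of "max t s"]) (use t l\<^sub>1(1) in auto)
    ultimately have "eventually (\<lambda>l. norm K * norm (?R l) < 1 \<and> l \<in> {max t s<..<l\<^sub>1}) (at_left l\<^sub>1)"
      by (rule eventually_conj)
    then obtain l where l: "norm K * norm (?R l) < 1" "t < l" "s < l" "l < l\<^sub>1"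
      using eventually_happens[of _ "at_left l\<^sub>1"] by (auto simp: trivial_limit_at_left_real)
    have "norm (K o\<^sub>L ?R l) < 1" using norm_blinfun_compose l(1) by (rule le_less_trans)
    then obtain X where X: "is_resolvent D ?B (complex_of_real l) X"
      "positive_op (?R l) \<and> positive_op K \<longrightarrow> positive_op X"
      using is_resolvent_neumann[OF R K(1), of "complex_of_real l"] l(3) by auto
    with Rpos K(2) l is_resolventD[OF X(1)] show ?thesis by (intro exI[of _ l]) auto
  qed

  have ii: "op_strongly_pos u (?S t)" and Spos: "positive_op (?S t)"
    if t: "?sB < ereal t" "t < l\<^sub>1" for t
  proof -
    obtain l where l: "t < l" "s < l" "l < l\<^sub>1" "complex_of_real l \<in> resolvent_set D ?B" "positive_op (?S l)"
      using start[OF t(2)] by blast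
    have res: "complex_of_real m \<in> resolvent_set D ?B" if "t \<le> m" "m \<le> l" for m
      using resB[of m] t(1) that by (meson ereal_less_eq(3) less_le_trans)
    show pos: "positive_op (?S t)"
      by (rule positive_resolvent_left[OF B res _ l(5)]) (use l in auto)
    show "op_strongly_pos u (?S t)"
      unfolding op_strongly_pos_def
    proof (intro allI impI)
      fix f :: "'a cpx" assume f: "0 < f"
      then have f0: "0 \<le> f" by simp
      \<comment> \<open>The lower bound is taken at \<open>l > s\<close>, as \<open>t\<close> itself
        may lie at or below \<open>s\<close>; monotonicity of \<open>?S\<close> then transports it
        from \<open>l\<close> to \<open>t\<close>.\<close>
      obtain e where e: "0 < e" "e *\<^sub>R u \<le> ?R l f"
        using l\<^sub>1(2)[OF l(2,3)] f by (auto simp: op_strongly_pos_def vec_strongly_pos_def)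
      note e(2)
      also have "?R l f \<le> ?S l f"
        by (rule resolvent_perturbed_ge[OF R Rpos is_resolvent_resolvent[OF B] _ K(2) f0]) (use l in auto)
      also have "\<dots> \<le> ?S t f"
        by (rule resolvent_antimono[OF B res l(4) pos l(5) _ f0]) (use l in auto)
      finally show "vec_strongly_pos u (?S t f)" using e(1) by (auto simp: vec_strongly_pos_def)
    qed
  qed

  have sB_ge: "ereal s \<le> ?sB"
  proof (rule ccontr)
    assume "\<not> ereal s \<le> ?sB"
    then have lt: "?sB < ereal s" by simp
    then have above: "?sB < ereal t" if "s < t" for t
      using that by (meson ereal_less_eq(3) less_imp_le less_le_trans)
    obtain X where X: "X \<longlonglongrightarrow> s" "\<forall>k. s < X k \<and> X k < l\<^sub>1 \<and> True"
    proof (rule right_sequence[OF l\<^sub>1(1), of "\<lambda>_ _. True"])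
      fix d :: real assume "0 < d"
      then show "\<exists>t>s. t < s + d \<and> True" by (intro exI[of _ "s + d / 2"]) auto
    qed
    have Xk: "s < X k" "X k < l\<^sub>1" for k using X(2) by auto
    \<comment> \<open>Convergence bounds the norms of \<open>?S (X k)\<close>, and domination passes
      the bound on to \<open>?R (X k)\<close>.\<close>
    have "(\<lambda>k. ?S (X k)) \<longlonglongrightarrow> ?S s" by (rule LIMSEQ_resolvent[OF B resB[OF lt] X(1)])
    then obtain C where "0 < C" and C: "\<forall>k. norm (?S (X k)) \<le> C"
      by (rule BseqE[OF convergent_imp_Bseq[OF convergentI]])
    have "norm (?R (X k)) \<le> C" for k
    proof (rule order_trans[OF norm_le_of_dominated])
      show "?R (X k) \<in> bounded_ops" using R Xk is_resolventD(3) by force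
      show "positive_op (?R (X k))" by (rule Rpos[OF Xk])
      show "?R (X k) x \<le> ?S (X k) x" if "0 \<le> x" for x
        by (rule resolvent_perturbed_ge[OF R Rpos[OF Xk]
              is_resolvent_resolvent[OF B resB[OF above]] Spos[OF above] K(2) that]) (use Xk in auto)
      show "norm (?S (X k)) \<le> C" using C by blast
    qed
    then have "complex_of_real s \<in> resolvent_set D A"
      by (rule LIMSEQ_resolvent_bounded[OF A(1) tendsto_of_real[OF X(1)], rotated])
        (use Xk resA in auto)
    with s(2) show False by (simp add: spectrum_def)
  qed
  obtain r where r: "?sB = ereal r" "s \<le> r" "r < l\<^sub>1"
    using sB_ge le_less_trans[OF sB_le i] by (cases ?sB) auto

  have iv: "s < r" if "relatively_compact_op D A K" "K \<noteq> 0"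
  proof (rule ccontr)
    assume "\<not> s < r"
    with r(2) have "r = s" by simp
    have above: "?sB < ereal t" if "s < t" for t using r(1) \<open>r = s\<close> that by simp
    show False
      by (rule real_spectrum_above[OF nontrivial u A(1) s(3) l\<^sub>1(1) resA l\<^sub>1(2) resB[OF above]
            Spos[OF above] K(1,2) that]) auto
  qed

  have iii: "resolvent_pole D ?B (complex_of_real r)" if Kc: "relatively_compact_op D A K"
  proof (cases "K = 0")
    case True
    then have BA: "?B = A" by (simp add: op_add_def)
    have "?sB \<le> ereal s" using sB_le s(1) BA by simp
    with r have "r = s" by simp
    with s(3) BA show ?thesis by simp
  next
    case False
    have sr: "s < r" by (rule iv[OF Kc False])
    interpret compact_perturbation u D A K r l\<^sub>1
    proof
      fix t
      show "complex_of_real t \<in> resolvent_set D A" if "r \<le> t" "t < l\<^sub>1"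
        using sr that by (intro resA) simp
      show "complex_of_real t \<in> resolvent_set D ?B" if "r < t" "t < l\<^sub>1"
        using r(1) that by (intro resB) simp
      show "op_strongly_pos u (?S t)" if "r < t" "t < l\<^sub>1"
        using r(1) that by (intro ii) simp_all
    qed (use u u0 A K Kc r real_spectral_bound_spectrum[OF B r(1)] in auto)
    show ?thesis by (rule pole)
  qed

  show ?thesis using sB_le i ii sB_ge r(1) iii iv by auto
qed

end
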